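(* Let $n\ge2$ and let $f:\overline{\mathbb B}^n_0\to\mathbb R^n$ be a locally quasiconformal embedding. If $f$ does not admit cavitation at the origin, then $$I_Q(f):=\int_{\mathbb S^{n-1}}\left(\int_0^1Q_f(tu)\frac{dt}{t}\right)^{1-n}d\sigma(u)=0.$$
   Context: Notation: $\mathbb B^n_0=\{x\in\mathbb R^n:0<|x|<1\}$; $\overline{\mathbb B}^n_0=\{0<|x|\le1\}$; $S_r=\{|x|=r\}$; $\mathbb S^{n-1}$ is the unit sphere with $(n-1)$-dimensional area element $d\sigma$. Convention: $(+\infty)^{1-n}=0$. Quasiconformality: a homeomorphism $f:G\to G'$ between domains of $\mathbb R^n$ is $K$-quasiconformal if $f$ is absolutely continuous on lines (ACL) in $G$ and $K_f(x)=\|f'(x)\|^n/J_f(x)\le K$ for a.e. $x\in G$, where $J_f$ is the Jacobian determinant and $\|f'(x)\|=\max_{|h|=1}|f'(x)h|$; it is quasiconformal if this holds for some $K<\infty$. A locally quasiconformal embedding $f$ of $\overline{\mathbb B}^n_0$ into $\mathbb R^n$ is an embedding that extends to a domain $G\not\ni0$ containing $\overline{\mathbb B}^n_0$ in such a way that $f$ is quasiconformal on $\{x\in G:|x|>\varepsilon\}$ for each $\varepsilon\in(0,1)$. Standing assumptions: $f$ is orientation-preserving (so $J_f>0$ a.e.), and for $0<r_1<r_2<1$ the surface $f(S_{r_1})$ lies inside $f(S_{r_2})$, i.e. in the bounded component of $\mathbb R^n\setminus f(S_{r_2})$. Cavitation: $f$ admits cavitation at the origin if the bounded connected component of $\mathbb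 R^n\setminus f(\mathbb B^n_0)$ is a non-degenerate continuum (a compact connected set with more than one point). Normal dilatation: at a regular point $x\ne0$ of $f$ (differentiable with $J_f(x)>0$; a.e. point is regular), with $u=x/|x|$ and $\partial_uf(x)=f'(x)u$, $Q_f(x)=\left(|\partial_uf(x)|^n/J_f(x)\right)^{1/(n-1)}$. *)

theory Defs
  imports "HOL-Analysis.Analysis"
begin

definition punctured_ball :: "(real ^ 'n) set" where
  "punctured_ball = {x. 0 < norm x \<and> norm x < 1}"

definition closed_punctured_ball :: "(real ^ 'n) set" where
  "closed_punctured_ball = {x. 0 < norm x \<and> norm x \<le> 1}"

definition is_domain :: "'a::topological_space set \<Rightarrow> bool" where
  "is_domain G \<longleftrightarrow> open G \<and> connected G \<and> G \<noteq> {}"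

text \<open>The Frechet derivative and the Jacobian determinant are arbitrary where f is not
  differentiable; differentiability is demanded separately wherever they are used.\<close>

abbreviation Df :: "(real ^ 'n \<Rightarrow> real ^ 'n) \<Rightarrow> real ^ 'n \<Rightarrow> real ^ 'n \<Rightarrow> real ^ 'n" where
  "Df f x \<equiv> frechet_derivative f (at x)"

definition jacobian_det :: "(real ^ 'n \<Rightarrow> real ^ 'n) \<Rightarrow> real ^ 'n \<Rightarrow> real" where
  "jacobian_det f x = det (matrix (Df f x))"

definition regular_point :: "(real ^ 'n \<Rightarrow> real ^ 'n) \<Rightarrow> real ^ 'n \<Rightarrow> bool" where
  "regular_point f x \<longleftrightarrow> f differentiable (at x) \<and> 0 < jacobian_det f x"


subsection \<open>Absolute continuity on lines\<close>

text \<open>The usual epsilon-delta definition; a division of t is a finite family of nonoverlapping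
  closed intervals with union t, and t is allowed to be any subset of S that has a division.\<close>

definition absolutely_continuous_on :: "real set \<Rightarrow> (real \<Rightarrow> 'a::real_normed_vector) \<Rightarrow> bool" where
  "absolutely_continuous_on S g \<longleftrightarrow>
     (\<forall>\<epsilon>>0. \<exists>\<delta>>0. \<forall>d t. d division_of t \<longrightarrow> t \<subseteq> S \<longrightarrow>
        (\<Sum>k\<in>d. Sup k - Inf k) < \<delta> \<longrightarrow> (\<Sum>k\<in>d. norm (g (Sup k) - g (Inf k))) < \<epsilon>)"

text \<open>In every closed box in G and every coordinate direction i, f is absolutely continuous on
  almost every segment parallel to the i-th axis. The segments are indexed by their remaining
  coordinates, and "almost every" refers to (n-1)-dimensional Lebesgue measure, i.e. the product
  of the one-dimensional ones over the index set without i.\<close>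

definition ACL_on :: "(real ^ 'n) set \<Rightarrow> (real ^ 'n \<Rightarrow> 'a::real_normed_vector) \<Rightarrow> bool" where
  "ACL_on G f \<longleftrightarrow> continuous_on G f \<and>
     (\<forall>a b i. cbox a b \<subseteq> G \<longrightarrow>
        (AE y in (\<Pi>\<^sub>M j\<in>UNIV - {i}. lborel).
           (\<forall>j\<in>UNIV - {i}. a $ j \<le> y j \<and> y j \<le> b $ j) \<longrightarrow>
           absolutely_continuous_on {a $ i..b $ i} (\<lambda>s. f (\<chi> j. if j = i then s else y j))))"


subsection \<open>Quasiconformality\<close>

text \<open>With values in the extended nonnegative reals, the quotient is infinite if the derivative is
  nonzero and the Jacobian is not positive.\<close>

definition outer_dilatation :: "(real ^ 'n \<Rightarrow> real ^ 'n) \<Rightarrow> real ^ 'n \<Rightarrow> ennreal" where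
  "outer_dilatation f x = ennreal (onorm (Df f x) ^ CARD('n)) / ennreal (jacobian_det f x)"

definition K_quasiconformal ::
    "real \<Rightarrow> (real ^ 'n \<Rightarrow> real ^ 'n) \<Rightarrow> (real ^ 'n) set \<Rightarrow> (real ^ 'n) set \<Rightarrow> bool" where
  "K_quasiconformal K f G G' \<longleftrightarrow>
     is_domain G \<and> is_domain G' \<and> (\<exists>g. homeomorphism G G' f g) \<and> ACL_on G f \<and>
     (AE x in lebesgue_on G. f differentiable (at x) \<and> outer_dilatation f x \<le> ennreal K)"

definition quasiconformal ::
    "(real ^ 'n \<Rightarrow> real ^ 'n) \<Rightarrow> (real ^ 'n) set \<Rightarrow> (real ^ 'n) set \<Rightarrow> bool" where
  "quasiconformal f G G' \<longleftrightarrow> (\<exists>K. K_quasiconformal K f G G')"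

text \<open>Maps on the closed punctured ball are total functions whose values elsewhere are
  irrelevant; F below is the extension to G.\<close>

definition locally_quasiconformal_embedding :: "(real ^ 'n \<Rightarrow> real ^ 'n) \<Rightarrow> bool" where
  "locally_quasiconformal_embedding f \<longleftrightarrow>
     (\<exists>g. homeomorphism closed_punctured_ball (f ` closed_punctured_ball) f g) \<and>
     (\<exists>G F. is_domain G \<and> 0 \<notin> G \<and> closed_punctured_ball \<subseteq> G \<and>
        (\<forall>x\<in>closed_punctured_ball. F x = f x) \<and>
        (\<forall>\<epsilon>. 0 < \<epsilon> \<and> \<epsilon> < 1 \<longrightarrow>
           quasiconformal F {x \<in> G. \<epsilon> < norm x} (F ` {x \<in> G. \<epsilon> < norm x})))"

text \<open>A homeomorphism preserves orientation near a point of differentiability with nonzero Jacobian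
  iff the Jacobian is positive there, and a quasiconformal map has nonzero Jacobian almost
  everywhere; hence orientation is expressed by the sign of the Jacobian.\<close>

definition orientation_preserving_on :: "(real ^ 'n) set \<Rightarrow> (real ^ 'n \<Rightarrow> real ^ 'n) \<Rightarrow> bool" where
  "orientation_preserving_on S f \<longleftrightarrow> (AE x in lebesgue_on S. regular_point f x)"

definition nested_sphere_images :: "(real ^ 'n \<Rightarrow> real ^ 'n) \<Rightarrow> bool" where
  "nested_sphere_images f \<longleftrightarrow>
     (\<forall>r1 r2. 0 < r1 \<and> r1 < r2 \<and> r2 < 1 \<longrightarrow> f ` sphere 0 r1 \<subseteq> inside (f ` sphere 0 r2))"


subsection \<open>Cavitation\<close>

text \<open>For the embeddings considered here the complement of the image of the punctured ball has
  exactly one bounded component.\<close>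

definition admits_cavitation :: "(real ^ 'n \<Rightarrow> real ^ 'n) \<Rightarrow> bool" where
  "admits_cavitation f \<longleftrightarrow>
     (\<exists>C \<in> components (- (f ` punctured_ball)). bounded C \<and>
        compact C \<and> connected C \<and> (\<exists>x\<in>C. \<exists>y\<in>C. x \<noteq> y))"


subsection \<open>Normal dilatation and the cavitation integral\<close>

text \<open>Points that are not regular form a null set; the value 0 there is a dummy.\<close>

definition normal_dilatation :: "(real ^ 'n \<Rightarrow> real ^ 'n) \<Rightarrow> real ^ 'n \<Rightarrow> real" where
  "normal_dilatation f x =
     (if regular_point f x
      then (norm (Df f x (sgn x)) ^ CARD('n) / jacobian_det f x) powr (1 / (real CARD('n) - 1))
      else 0)"

text \<open>The (n-1)-dimensional area measure of the unit sphere in polar-coordinate form: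
  the area of a Borel set A is n times the volume of the cone of all tu with
  u in A and 0 < t < 1.\<close>

definition sphere_area :: "(real ^ 'n) measure" where
  "sphere_area = scale_measure (of_nat CARD('n))
     (distr (restrict_space lborel punctured_ball) (restrict_space borel (sphere 0 1)) sgn)"

text \<open>The inner integral may be infinite; the convention that infinity to the power 1 - n is 0 is
  built into the extended nonnegative reals.\<close>

definition I_Q :: "(real ^ 'n \<Rightarrow> real ^ 'n) \<Rightarrow> ennreal" where
  "I_Q f = (\<integral>\<^sup>+u. inverse
     ((\<integral>\<^sup>+t\<in>{0<..<1}. ennreal (normal_dilatation f (t *\<^sub>R u) / t) \<partial>lborel) ^ (CARD('n) - 1))
     \<partial>sphere_area)"

end

theory Submission
  imports Defs
begin

text \<open>Without cavitation the compact sets bounded by the surfaces f(S_r) shrink to a point y0, so f has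
  the limit y0 at the origin. Consider the density \<rho>(y) = 1 / (r (1 - ln r)), r = |y - y0| < 1. It
  has infinite length along every curve ending at y0, whereas the integral of its n-th power is
  finite, because n is at least 2. On a ray t u the derivative satisfies
  (\<rho>(f) |\<partial>f|)^n = Z (Q/t)^(n-1) with Z = \<rho>(f)^n J t^(n-1), and therefore \<rho>(f) |\<partial>f| \<le> Q/t + Z. By the
  change of variables inequality and polar coordinates, Z has a finite integral along almost
  every ray; since \<rho>(f) |\<partial>f| has infinite integral, so has Q/t.

  The curves f(t u) have to be absolutely continuous for almost every u, whereas ACL only refers to
  lines parallel to the axes. By bounded dilatation the partial derivatives are locally integrable,
  and f(b x) - f(a x) is compared with the sum of its increments along a staircase that follows the
  ray.\<close>

section \<open>Shrinking surfaces and the limit at the origin\<close>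

text \<open>The dilatation bound may degenerate at the origin, so it is used on compact boxes away
  from it only; there it makes the partial derivatives integrable. Up to the origin one estimate has
  to suffice: the integral of the Jacobian against a weight on the target is at most the integral of
  the weight. It rests on injectivity and on differentiability in a set of full measure.

  The weight is the classical one behind the vanishing n-capacity of a point. 1 / r just fails to
  have an integrable n-th power in dimension n; the factor 1 - ln r repairs this, as 1 / (r (1 - ln
  r)^n) is integrable at 0 for n at least 2, while 1 / (r (1 - ln r)) still has the unbounded
  antiderivative - ln (1 - ln r). The 1 keeps the factor at least 1 for r < 1.

  Only finiteness of integrals matters, so Hoelder's inequality gives way to a pointwise
  alternative: \<rho>(f) |\<partial>f| is at most Q/t or at most Z.\<close>

lemma not_subset_inside_each_other:
  fixes A B :: "'a::euclidean_space set"
  assumes dim: "2 \<le> DIM('a)" and A: "compact A" "A \<noteq> {}" and B: "compact B"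
    and AB: "A \<subseteq> inside B"
  shows "\<not> B \<subseteq> inside A"
proof
  assume BA: "B \<subseteq> inside A"
  \<comment> \<open>By the two inclusions, a point of greatest norm in the union lies inside the
    other set. The complement of the ball through it is connected and unbounded, hence outside that
    set, yet has \<open>p\<close> in its closure; so the open inside would meet the outside.\<close>
  obtain p where p: "p \<in> A \<union> B" "\<And>x. x \<in> A \<union> B \<Longrightarrow> norm x \<le> norm p"
  proof -
    have "compact (A \<union> B)" "A \<union> B \<noteq> {}" using A B by auto
    then have "\<exists>p\<in>A \<union> B. \<forall>x\<in>A \<union> B. norm x \<le> norm p"
      by (intro continuous_attains_sup continuous_intros)
    then show thesis using that by blast
  qed
  have far: False if C: "compact C" "p \<in> inside C" "\<And>x. x \<in> C \<Longrightarrow> norm x \<le> norm p" for C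
  proof -
    have "connected (- cball 0 (norm p) :: 'a set)"
      by (rule connected_complement_bounded_convex) (use dim in auto)
    moreover have conv: "C \<subseteq> cball 0 (norm p)" using C by auto
    ultimately have "- cball 0 (norm p) \<subseteq> outside C"
      using outside_subset_convex[OF convex_cball conv] by blast
    moreover have "p \<in> closure (- cball 0 (norm p))"
    proof -
      have "p \<notin> interior (cball 0 (norm p))"
        by simp
      then show ?thesis by (simp add: closure_complement)
    qed
    moreover have "open (inside C)"
      using C by (simp add: open_inside compact_imp_closed)
    ultimately have "inside C \<inter> outside C \<noteq> {}"
      using C(2) by (meson closure_mono in_mono open_Int_closure_eq_empty disjoint_iff)
    then show False by simp
  qed
  show False
    using far[of A] far[of B] p A B AB BA by (metis Un_iff in_mono)
qed

text \<open>The filled surfaces \<open>K r\<close> are nested continua, so their intersection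
  \<open>C\<close> is a continuum. It avoids the image, because each surface misses all smaller
  \<open>K r\<close>, and it is a maximal connected set in the complement. Without cavitation it is
  a single point, the limit.\<close>

lemma limit_at_0_of_no_cavitation:
  fixes f :: "real ^ 'n \<Rightarrow> real ^ 'n"
  assumes card: "CARD('n) \<ge> 2"
    and cont: "continuous_on punctured_ball f" and inj: "inj_on f punctured_ball"
    and nested: "nested_sphere_images f"
    and cav: "\<not> admits_cavitation f"
  obtains y0 where "y0 \<notin> f ` punctured_ball" "(f \<longlongrightarrow> y0) (at 0)"
proof -
  have dim: "2 \<le> DIM(real ^ 'n)" using card by simp
  define S where "S r = f ` sphere 0 r" for r
  define K where "K r = S r \<union> inside (S r)" for r
  have sph: "sphere 0 r \<subseteq> punctured_ball" if "0 < r" "r < 1" for r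
    using that by (auto simp: punctured_ball_def)
  have cS: "compact (S r)" "connected (S r)" "S r \<noteq> {}" if r: "0 < r" "r < 1" for r
  proof -
    have "continuous_on (sphere 0 r) f" using cont sph[OF r] continuous_on_subset by blast
    then show "compact (S r)" "connected (S r)"
      unfolding S_def using dim
      by (auto intro!: compact_continuous_image connected_continuous_image connected_sphere)
    show "S r \<noteq> {}" using r unfolding S_def by simp
  qed
  have cK: "compact (K r)" "connected (K r)" "K r \<noteq> {}" if r: "0 < r" "r < 1" for r
  proof -
    have "closed (K r)" unfolding K_def union_with_inside
      using cS[OF r] by (simp add: open_outside compact_imp_closed closed_Compl)
    moreover have "bounded (K r)" unfolding K_def
      using cS[OF r] dim by (simp add: bounded_inside compact_imp_bounded)
    ultimately show "compact (K r)" by (simp add: compact_eq_bounded_closed)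
    show "connected (K r)" unfolding K_def
      using cS[OF r] by (intro connected_with_inside compact_imp_closed)
    show "K r \<noteq> {}" using cS[OF r] unfolding K_def by auto
  qed
  have nest: "S r \<subseteq> inside (S s)" if "0 < r" "r < s" "s < 1" for r s
    using nested that unfolding nested_sphere_images_def S_def by blast
  have K_mono: "K r \<subseteq> K s" if "0 < r" "r \<le> s" "s < 1" for r s
  proof (cases "r = s")
    case False
    then have "r < s" using that by simp
    then have "inside (S r) \<subseteq> inside (S s)"
      using that cS[of r] cS[of s] nest[of r s]
      by (intro inside_inside_compact_connected) (auto intro: compact_imp_closed)
    then show ?thesis using nest[of r s] that \<open>r < s\<close> unfolding K_def by blast
  qed auto
  \<comment> \<open>The surface at \<open>s\<close> is connected and, by injectivity, misses the one
    at \<open>r\<close>, so it lies entirely inside or entirely outside it. Inside is impossible,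
    since each would then lie inside the other.\<close>
  have disj: "S s \<inter> K r = {}" if "0 < r" "r < s" "s < 1" for r s
  proof -
    have d: "S s \<inter> S r = {}"
    proof -
      have "sphere 0 r \<inter> sphere 0 s = ({} :: (real^'n) set)" using that by auto
      moreover have "sphere 0 r \<subseteq> (punctured_ball :: (real^'n) set)" "sphere 0 s \<subseteq> (punctured_ball :: (real^'n) set)"
        using that by (auto simp: punctured_ball_def)
      ultimately show ?thesis unfolding S_def using inj_on_image_Int[OF inj]
        by (metis image_empty inf_commute)
    qed
    moreover have "S s \<inter> inside (S r) = {}"
    proof (rule ccontr)
      assume "S s \<inter> inside (S r) \<noteq> {}"
      moreover have "connected (S s)" using cS that by auto
      ultimately have "S s \<inter> outside (S r) = {}"
        using inside_outside_intersect_connected[of "S s" "S r"] d by blast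
      then have "S s \<subseteq> inside (S r)" using d union_with_inside[of "S r"] by blast
      then show False
        using not_subset_inside_each_other[OF dim, of "S r" "S s"] nest that cS[of r] cS[of s] by auto
    qed
    ultimately show ?thesis unfolding K_def by blast
  qed
  \<comment> \<open>Countably many radii decreasing to 0; the shift by 2 keeps all of them below
    1.\<close>
  define R where "R m = inverse (real (m + 2))" for m :: nat
  have R: "0 < R m" "R m < 1" for m unfolding R_def by (auto simp: field_simps)
  have R_anti: "R n \<le> R m" if "m \<le> n" for m n using that unfolding R_def by (auto simp: field_simps)
  have R_small: "\<exists>m. R m < r" if "0 < r" for r
  proof -
    obtain m where "inverse (real (Suc m)) < r" using reals_Archimedean[OF \<open>0 < r\<close>] by blast
    moreover have "R m \<le> inverse (real (Suc m))" unfolding R_def by (auto simp: field_simps)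
    ultimately show ?thesis by (meson le_less_trans)
  qed
  define C where "C = \<Inter> (range (\<lambda>m. K (R m)))"
  have KR_anti: "K (R n) \<subseteq> K (R m)" if "m \<le> n" for m n
    using K_mono[OF R(1) R_anti[OF that] R(2)] .
  have conC: "connected C" unfolding C_def
    by (rule connected_nest) (use cK R KR_anti in auto)
  have neC: "C \<noteq> {}" unfolding C_def
    by (rule compact_nest) (use cK R KR_anti in auto)
  have compC: "compact C" unfolding C_def
    by (rule compact_Inter) (use cK R in auto)
  have CK: "C \<subseteq> K r" if "0 < r" "r < 1" for r
  proof -
    obtain m where "R m < r" using R_small \<open>0 < r\<close> by blast
    then have "K (R m) \<subseteq> K r" using K_mono R that by (meson less_imp_le)
    then show ?thesis unfolding C_def by blast
  qed
  have CS: "C \<inter> S s = {}" if s: "0 < s" "s < 1" for s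
    using disj[of "s/2" s] CK[of "s/2"] s by force
  have Cf: "C \<inter> f ` punctured_ball = {}"
  proof -
    have "f x \<notin> C" if x: "x \<in> punctured_ball" for x
    proof -
      have "f x \<in> S (norm x)" unfolding S_def by auto
      then show ?thesis using CS[of "norm x"] x unfolding punctured_ball_def by auto
    qed
    then show ?thesis by blast
  qed
  have "C \<in> components (- (f ` punctured_ball))"
  proof -
    \<comment> \<open>A connected \<open>D\<close> in the complement contains points of
      \<open>C\<close>, which are inside every surface, and cannot cross a surface; so it stays in
      every \<open>K (R m)\<close>.\<close>
    have max: "D = C" if D: "D \<noteq> {}" "C \<subseteq> D" "D \<subseteq> - (f ` punctured_ball)" "connected D" for D
    proof -
      have "D \<subseteq> K (R m)" for m
      proof -
        have dj: "D \<inter> S (R m) = {}" using D(3) sph[OF R] unfolding S_def by blast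
        have "C \<subseteq> inside (S (R m))" using CK[OF R] CS[OF R] unfolding K_def by blast
        then have "inside (S (R m)) \<inter> D \<noteq> {}" using D neC by blast
        then have "outside (S (R m)) \<inter> D = {}"
          using inside_outside_intersect_connected[OF D(4)] dj by blast
        then show ?thesis unfolding K_def union_with_inside by blast
      qed
      then show ?thesis using D unfolding C_def by blast
    qed
    show ?thesis unfolding in_components_maximal
      using neC Cf conC max by blast
  qed
  then have "\<not> (\<exists>x\<in>C. \<exists>y\<in>C. x \<noteq> y)"
    using cav compC conC unfolding admits_cavitation_def by (meson compact_imp_bounded)
  with neC obtain y0 where y0: "C = {y0}" by (metis is_singletonI' is_singleton_def)
  have "(f \<longlongrightarrow> y0) (at 0)"
  proof (rule topological_tendstoI)
    fix U assume U: "open U" "y0 \<in> U"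
    \<comment> \<open>If every \<open>K (R m)\<close> left the open set \<open>U\<close>, the nested
      compact sets \<open>K (R m) - U\<close> would have a common point, which could only be
      \<open>y0\<close>.\<close>
    have "\<exists>m. K (R m) \<subseteq> U"
    proof (rule ccontr)
      assume "\<nexists>m. K (R m) \<subseteq> U"
      then have ne: "K (R m) - U \<noteq> {}" for m by blast
      have "\<Inter> (range (\<lambda>m. K (R m) - U)) \<noteq> {}"
      proof (rule compact_nest)
        show "compact (K (R m) - U)" for m using cK(1)[OF R] U(1) by (rule compact_diff)
        show "K (R n) - U \<subseteq> K (R m) - U" if "m \<le> n" for m n using KR_anti[OF that] by blast
      qed (rule ne)
      then show False using y0 U unfolding C_def by blast
    qed
    then obtain m where m: "K (R m) \<subseteq> U" by blast
    have "f x \<in> U" if "x \<noteq> 0" "dist x 0 < R m" for x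
    proof -
      have "f x \<in> K (norm x)" unfolding K_def S_def by auto
      moreover have "K (norm x) \<subseteq> K (R m)" using K_mono[of "norm x" "R m"] that R by auto
      ultimately show ?thesis using m by blast
    qed
    then show "eventually (\<lambda>x. f x \<in> U) (at 0)"
      using R unfolding eventually_at by blast
  qed
  moreover have "y0 \<notin> f ` punctured_ball" using Cf y0 by auto
  ultimately show thesis using that by blast
qed

section \<open>Change of variables over finite index types\<close>

text \<open>The library states the change of variables theorem for well-ordered index types only; a
  finite index type is transferred to its copy with an arbitrary linear order.\<close>

datatype 'a ordered_copy = Copy (uncopy: 'a)

instantiation ordered_copy :: (finite) wellorder
begin

definition "x \<le> y \<longleftrightarrow> to_nat (uncopy x) \<le> to_nat (uncopy y)"

definition "x < y \<longleftrightarrow> to_nat (uncopy x) < to_nat (uncopy y)"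

instance
proof
  fix x y z :: "'a ordered_copy"
  show "x \<le> y \<Longrightarrow> y \<le> x \<Longrightarrow> x = y"
    unfolding less_eq_ordered_copy_def by (metis dual_order.antisym from_nat_to_nat ordered_copy.expand)
next
  fix P :: "'a ordered_copy \<Rightarrow> bool" and a :: "'a ordered_copy"
  assume "\<And>x. (\<And>y. y < x \<Longrightarrow> P y) \<Longrightarrow> P x"
  then show "P a"
    unfolding less_ordered_copy_def by (rule measure_induct_rule[of "\<lambda>x. to_nat (uncopy x)"])
qed (auto simp: less_eq_ordered_copy_def less_ordered_copy_def)

end

lemma UNIV_ordered_copy: "(UNIV :: 'a ordered_copy set) = range Copy"
proof -
  have "x \<in> range Copy" for x :: "'a ordered_copy" by (cases x) auto
  then show ?thesis by blast
qed

instance ordered_copy :: (finite) finite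
  by standard (simp add: UNIV_ordered_copy)

lemma bij_uncopy: "bij uncopy"
  by (rule o_bij[of Copy]) auto

text \<open>Conjugation with \<pi> identifies the permutations of the two index types and preserves
  the sign; in the Leibniz formula the factors of each product are merely reordered.\<close>

lemma det_reindex:
  fixes A :: "'a::comm_ring_1 ^ 'n ^ 'n" and \<pi> :: "'m::finite \<Rightarrow> 'n"
  assumes \<pi>: "bij \<pi>"
  shows "det (\<chi> i j. A $ \<pi> i $ \<pi> j) = det A"
proof -
  have inv: "\<pi> (inv \<pi> x) = x" "inv \<pi> (\<pi> y) = y" for x y
    using \<pi> by (simp_all add: bij_is_surj surj_f_inv_f bij_is_inj)
  have perm: "\<pi> \<circ> p \<circ> inv \<pi> = map_permutation UNIV \<pi> p" for p :: "'m \<Rightarrow> 'm"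
    using \<pi> by (auto simp: map_permutation_def restrict_id_def bij_is_surj fun_eq_iff)
  have s: "sign (\<pi> \<circ> p \<circ> inv \<pi>) = sign p" if "p permutes UNIV" for p :: "'m \<Rightarrow> 'm"
    unfolding perm using \<pi> that by (intro sign_map_permutation) (auto simp: bij_is_inj)
  have p2: "(\<pi> \<circ> p \<circ> inv \<pi>) permutes UNIV" if "p permutes UNIV" for p :: "'m \<Rightarrow> 'm"
    using permutes_bij[OF that] \<pi> by (intro bij_imp_permutes[of _ UNIV]) (auto intro!: bij_comp bij_imp_bij_inv)
  have p3: "(inv \<pi> \<circ> q \<circ> \<pi>) permutes UNIV" if "q permutes UNIV" for q :: "'n \<Rightarrow> 'n"
    using permutes_bij[OF that] \<pi> by (intro bij_imp_permutes[of _ UNIV]) (auto intro!: bij_comp bij_imp_bij_inv)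
  show ?thesis
    unfolding det_def
  proof (rule sum.reindex_bij_witness[of _ "\<lambda>q. inv \<pi> \<circ> q \<circ> \<pi>" "\<lambda>p. \<pi> \<circ> p \<circ> inv \<pi>"])
    fix p :: "'m \<Rightarrow> 'm" assume p: "p \<in> {p. p permutes UNIV}"
    have "(\<Prod>i\<in>UNIV. A $ \<pi> i $ (\<pi> \<circ> p \<circ> inv \<pi>) (\<pi> i)) = (\<Prod>i\<in>UNIV. A $ i $ (\<pi> \<circ> p \<circ> inv \<pi>) i)"
      using \<pi> by (intro prod.reindex_bij_betw)
    then show "of_int (sign (\<pi> \<circ> p \<circ> inv \<pi>)) * (\<Prod>i\<in>UNIV. A $ i $ (\<pi> \<circ> p \<circ> inv \<pi>) i)
        = of_int (sign p) * (\<Prod>i\<in>UNIV. (\<chi> i j. A $ \<pi> i $ \<pi> j) $ i $ p i)"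
      using s p by (simp add: inv)
  qed (use p2 p3 in \<open>auto simp: inv fun_eq_iff\<close>)
qed

definition to_copy :: "real ^ 'n \<Rightarrow> real ^ 'n ordered_copy" where
  "to_copy x = (\<chi> i. x $ uncopy i)"

definition of_copy :: "real ^ 'n ordered_copy \<Rightarrow> real ^ 'n" where
  "of_copy y = (\<chi> j. y $ Copy j)"

lemma of_to_copy [simp]: "of_copy (to_copy x) = x" and to_of_copy [simp]: "to_copy (of_copy y) = y"
  by (simp_all add: to_copy_def of_copy_def vec_eq_iff)

lemma linear_to_copy: "linear to_copy" and linear_of_copy: "linear of_copy"
  by (auto intro!: linearI simp: to_copy_def of_copy_def vec_eq_iff)

lemma borel_measurable_to_copy [measurable]: "to_copy \<in> borel_measurable borel"
  and borel_measurable_of_copy [measurable]: "of_copy \<in> borel_measurable borel"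
  by (intro borel_measurable_continuous_onI linear_continuous_on linear_linear[THEN iffD1]
        linear_to_copy linear_of_copy bounded_linear.linear
      | simp add: linear_conv_bounded_linear[symmetric] linear_to_copy linear_of_copy)+

lemma prod_Basis_cart:
  fixes g :: "real ^ 'n \<Rightarrow> real"
  shows "(\<Prod>b\<in>Basis. g b) = (\<Prod>i\<in>UNIV. g (axis i 1))"
proof -
  have inj: "inj (\<lambda>i::'n. axis i (1::real))" by (auto simp: inj_on_def axis_eq_axis)
  have B: "(Basis :: (real ^ 'n) set) = range (\<lambda>i. axis i 1)" by (auto simp: Basis_vec_def)
  show ?thesis unfolding B by (subst prod.reindex[OF inj]) simp
qed

text \<open>Relabelling the coordinates permutes the side lengths of a box, and Lebesgue measure is
  determined by its values on boxes.\<close>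

lemma lborel_distr_to_copy: "lborel = distr lborel borel (to_copy :: real ^ 'n \<Rightarrow> _)"
proof (rule lborel_eqI)
  fix l u :: "real ^ 'n ordered_copy"
  assume "\<And>b. b \<in> Basis \<Longrightarrow> l \<bullet> b \<le> u \<bullet> b"
  then have lu: "l $ i \<le> u $ i" for i
    by (metis axis_in_Basis_iff inner_axis inner_real_def mult.right_neutral Basis_real_def insertI1)
  have "to_copy -` box l u = box (of_copy l) (of_copy u)"
    by (auto simp: mem_box_cart to_copy_def of_copy_def) (metis ordered_copy.collapse ordered_copy.sel)+
  then have "emeasure (distr lborel borel to_copy) (box l u) = emeasure lborel (box (of_copy l) (of_copy u))"
    by (simp add: emeasure_distr)
  also have "\<dots> = (\<Prod>b\<in>Basis. (of_copy u - of_copy l) \<bullet> b)"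
    using lu by (subst emeasure_lborel_box) (auto simp: Basis_vec_def inner_axis of_copy_def)
  also have "\<dots> = (\<Prod>j\<in>UNIV. u $ Copy j - l $ Copy j)"
    by (simp add: prod_Basis_cart inner_axis of_copy_def)
  also have "\<dots> = (\<Prod>i\<in>UNIV. u $ i - l $ i)"
    by (rule arg_cong[where f=ennreal], rule prod.reindex_bij_witness[of _ uncopy Copy]) auto
  also have "\<dots> = (\<Prod>b\<in>Basis. (u - l) \<bullet> b)"
    by (simp add: prod_Basis_cart inner_axis)
  finally show "emeasure (distr lborel borel to_copy) (box l u) = (\<Prod>b\<in>Basis. (u - l) \<bullet> b)" .
qed simp

text \<open>The change of variables theorem gives equality with the integral of \<open>w\<close>
  over the image of \<open>S\<close>; enlarging the image to the whole space gives the
  inequality.\<close>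

lemma nn_integral_change_of_variables_le_wellorder:
  fixes f :: "real ^ 'm::{finite,wellorder} \<Rightarrow> real ^ 'm::_" and w :: "real ^ 'm::_ \<Rightarrow> real"
  assumes S: "S \<in> sets borel" and der: "\<And>x. x \<in> S \<Longrightarrow> (f has_derivative f' x) (at x)"
    and inj: "inj_on f S" and w: "integrable lborel w" "\<And>x. 0 \<le> w x"
  shows "(\<integral>\<^sup>+x\<in>S. ennreal (\<bar>det (matrix (f' x))\<bar> * w (f x)) \<partial>lebesgue) \<le> (\<integral>\<^sup>+y. ennreal (w y) \<partial>lborel)"
proof -
  have SL: "S \<in> sets lebesgue" using S by simp
  have der': "(f has_derivative f' x) (at x within S)" if "x \<in> S" for x
    using der[OF that] has_derivative_at_withinI by blast
  have "f differentiable_on S"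
    unfolding differentiable_on_def differentiable_def using der' by blast
  \<comment> \<open>A differentiable map between spaces of equal dimension takes Lebesgue sets to
    Lebesgue sets.\<close>
  then have fS: "f ` S \<in> sets lebesgue"
    using SL by (intro differentiable_image_in_sets_lebesgue) auto
  have wL: "integrable lebesgue w"
    using w by (simp add: integrable_completion)
  have wfS: "set_integrable lebesgue (f ` S) w"
    unfolding set_integrable_def using integrable_mult_indicator[OF fS wL] .
  \<comment> \<open>The theorem is applied to a vector-valued integrand: \<open>v\<close> is
    \<open>w\<close> with values in \<open>real ^ 1\<close>, and the scalar identity is read off
    from the only component.\<close>
  define v where "v x = (vec (w x) :: real ^ 1)" for x
  have "v absolutely_integrable_on f ` S"
    using wfS unfolding v_def by (subst absolutely_integrable_on_1_iff) simp
  from has_absolute_integral_change_of_variables[OF SL der' inj, of v "integral (f ` S) v"] this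
  have A: "(\<lambda>x. \<bar>det (matrix (f' x))\<bar> *\<^sub>R v (f x)) absolutely_integrable_on S"
    and B: "integral S (\<lambda>x. \<bar>det (matrix (f' x))\<bar> *\<^sub>R v (f x)) = integral (f ` S) v" by auto
  let ?g = "\<lambda>x. \<bar>det (matrix (f' x))\<bar> * w (f x)"
  have A': "?g absolutely_integrable_on S"
    using A by (subst (asm) absolutely_integrable_on_1_iff) (simp add: v_def)
  have B': "integral S ?g = integral (f ` S) w"
  proof -
    have "integral S (\<lambda>x. (\<bar>det (matrix (f' x))\<bar> *\<^sub>R v (f x)) $ 1) = integral S (\<lambda>x. \<bar>det (matrix (f' x))\<bar> *\<^sub>R v (f x)) $ 1"
      using A set_lebesgue_integral_eq_integral(1) by (intro integral_component_eq_cart) blast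
    also have "\<dots> = integral (f ` S) (\<lambda>x. v x $ 1)"
      unfolding B using \<open>v absolutely_integrable_on f ` S\<close> set_lebesgue_integral_eq_integral(1)
      by (intro integral_component_eq_cart[symmetric]) blast
    finally have "integral S (\<lambda>x. (\<bar>det (matrix (f' x))\<bar> *\<^sub>R v (f x)) $ 1) = integral (f ` S) (\<lambda>x. v x $ 1)" .
    then show ?thesis by (simp add: v_def)
  qed
  have "(\<integral>\<^sup>+x\<in>S. ennreal (?g x) \<partial>lebesgue) = (\<integral>\<^sup>+x. ennreal (indicator S x *\<^sub>R ?g x) \<partial>lebesgue)"
    by (intro nn_integral_cong) (auto simp: indicator_def)
  also have "\<dots> = ennreal (\<integral>x. indicator S x *\<^sub>R ?g x \<partial>lebesgue)"
    using A' w unfolding set_integrable_def by (intro nn_integral_eq_integral) auto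
  also have "(\<integral>x. indicator S x *\<^sub>R ?g x \<partial>lebesgue) = integral S ?g"
    using set_lebesgue_integral_eq_integral(2)[OF A'] by (simp add: set_lebesgue_integral_def)
  also have "\<dots> = (\<integral>x. indicator (f ` S) x *\<^sub>R w x \<partial>lebesgue)"
    unfolding B' using set_lebesgue_integral_eq_integral(2)[OF wfS] by (simp add: set_lebesgue_integral_def)
  also have "\<dots> \<le> (\<integral>x. w x \<partial>lebesgue)"
    using wfS wL w unfolding set_integrable_def by (intro integral_mono) (auto simp: indicator_def)
  also have "ennreal \<dots> = (\<integral>\<^sup>+y. ennreal (w y) \<partial>lborel)"
    using w by (simp add: nn_integral_eq_integral integral_completion)
  finally show ?thesis using ennreal_leI by simp
qed

text \<open>All data are carried to the ordered copy of the index type, where the conjugated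
  derivative has the same determinant by \<open>det_reindex\<close>. The measurability
  \<open>meas\<close> lets the integrand pass through the image measure.\<close>

lemma nn_integral_change_of_variables_le:
  fixes f :: "real ^ 'n \<Rightarrow> real ^ 'n" and w :: "real ^ 'n \<Rightarrow> real"
  assumes S[measurable]: "S \<in> sets borel" and der: "\<And>x. x \<in> S \<Longrightarrow> (f has_derivative f' x) (at x)"
    and inj: "inj_on f S" and w: "integrable lborel w" "\<And>x. 0 \<le> w x"
    and meas: "(\<lambda>x. indicator S x * ennreal (\<bar>det (matrix (f' x))\<bar> * w (f x))) \<in> borel_measurable borel"
  shows "(\<integral>\<^sup>+x\<in>S. ennreal (\<bar>det (matrix (f' x))\<bar> * w (f x)) \<partial>lborel) \<le> (\<integral>\<^sup>+y. ennreal (w y) \<partial>lborel)"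
proof -
  have [measurable]: "w \<in> borel_measurable borel" using w by auto
  define S1 where "S1 = of_copy -` S"
  have S1: "S1 \<in> sets borel" unfolding S1_def
    using measurable_sets[OF borel_measurable_of_copy S] by simp
  define f1 where "f1 y = to_copy (f (of_copy y))" for y
  define f1' where "f1' y = to_copy \<circ> f' (of_copy y) \<circ> of_copy" for y
  define w1 where "w1 y = w (of_copy y)" for y
  have lin: "(to_copy has_derivative to_copy) F" "(of_copy has_derivative of_copy) G" for F G
    using linear_to_copy linear_of_copy by (auto intro: linear_imp_has_derivative)
  have der1: "(f1 has_derivative f1' y) (at y)" if "y \<in> S1" for y
    unfolding f1_def f1'_def o_def
    by (rule has_derivative_compose[OF has_derivative_compose[OF lin(2) der] lin(1)])
      (use that in \<open>auto simp: S1_def\<close>)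
  have inj1: "inj_on f1 S1"
    using inj unfolding f1_def S1_def inj_on_def by (metis of_to_copy to_of_copy vimageD)
  have int1: "(\<integral>\<^sup>+y. ennreal (w1 y) \<partial>lborel) = (\<integral>\<^sup>+y. ennreal (w y) \<partial>lborel)"
    unfolding w1_def by (subst lborel_distr_to_copy) (subst nn_integral_distr, auto)
  have w1: "integrable lborel w1" "\<And>y. 0 \<le> w1 y"
    using w int1 unfolding w1_def by (auto simp: integrable_iff_bounded)
  have mat: "matrix (f1' (to_copy x)) = (\<chi> i j. matrix (f' x) $ uncopy i $ uncopy j)" for x
  proof -
    have "of_copy (axis j 1) = axis (uncopy j) (1::real)" for j :: "'n ordered_copy"
      by (auto simp: of_copy_def axis_def vec_eq_iff)
    then have "f1' (to_copy x) (axis j 1) = to_copy (f' x (axis (uncopy j) 1))" for j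
      unfolding f1'_def by simp
    then show ?thesis unfolding matrix_def by (simp add: vec_eq_iff to_copy_def)
  qed
  have det1: "det (matrix (f1' (to_copy x))) = det (matrix (f' x))" for x
    unfolding mat by (rule det_reindex[OF bij_uncopy])
  let ?h = "\<lambda>x. indicator S x * ennreal (\<bar>det (matrix (f' x))\<bar> * w (f x))"
  have pt: "ennreal (\<bar>det (matrix (f1' y))\<bar> * w1 (f1 y)) * indicator S1 y = ?h (of_copy y)" for y
    using det1[of "of_copy y"] by (simp add: S1_def f1_def w1_def indicator_def)
  have [measurable]: "(\<lambda>y. ?h (of_copy y)) \<in> borel_measurable borel"
    using measurable_compose[OF borel_measurable_of_copy meas] .
  have "(\<integral>\<^sup>+x\<in>S. ennreal (\<bar>det (matrix (f' x))\<bar> * w (f x)) \<partial>lborel) = (\<integral>\<^sup>+x. ?h x \<partial>lborel)"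
    by (simp only: mult.commute)
  also have "\<dots> = (\<integral>\<^sup>+y. ?h (of_copy y) \<partial>distr lborel borel to_copy)"
    by (subst nn_integral_distr) simp_all
  also have "\<dots> = (\<integral>\<^sup>+y. ?h (of_copy y) \<partial>lebesgue)"
    unfolding lborel_distr_to_copy[symmetric] by (rule nn_integral_completion[symmetric])
  also have "\<dots> = (\<integral>\<^sup>+y\<in>S1. ennreal (\<bar>det (matrix (f1' y))\<bar> * w1 (f1 y)) \<partial>lebesgue)"
    unfolding pt ..
  also have "\<dots> \<le> (\<integral>\<^sup>+y. ennreal (w1 y) \<partial>lborel)"
    by (rule nn_integral_change_of_variables_le_wellorder[OF S1 der1 inj1 w1])
  finally show ?thesis unfolding int1 .
qed

section \<open>Polar coordinates\<close>

lemma nn_integral_scaleR: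
  fixes h :: "'a::euclidean_space \<Rightarrow> ennreal"
  assumes [measurable]: "h \<in> borel_measurable borel" and s: "0 < s"
  shows "(\<integral>\<^sup>+x. h x \<partial>lborel) = ennreal (s ^ DIM('a)) * (\<integral>\<^sup>+x. h (s *\<^sub>R x) \<partial>lborel)"
  using s by (subst lborel_affine[of s 0])
    (simp_all add: nn_integral_density nn_integral_distr nn_integral_cmult)

text \<open>The antiderivative is - 1 / (n s^n). In the polar formula \<open>r\<close> is
  \<open>norm y\<close>, and the value cancels the factor n of \<open>sphere_area\<close> together
  with a power of the norm.\<close>

lemma nn_integral_powr_tail:
  assumes r: "0 < r" and n: "0 < n"
  shows "(\<integral>\<^sup>+s\<in>{r<..}. ennreal (1 / s ^ Suc n) \<partial>lborel) = ennreal (1 / (real n * r ^ n))"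
proof -
  have "(\<integral>\<^sup>+s. ennreal (1 / s ^ Suc n) * indicator {r..} s \<partial>lborel) = ennreal (0 - (- (1 / (real n * r ^ n))))"
  proof (rule nn_integral_FTC_atLeast)
    show "((\<lambda>s. - (1 / (real n * s ^ n))) has_real_derivative 1 / x ^ Suc n) (at x)" if "r \<le> x" for x
    proof -
      have x: "x > 0" using that r by simp
      obtain m where m: "n = Suc m" using n by (metis gr0_implies_Suc)
      have "((\<lambda>s. - (inverse (real n) * inverse (s ^ n))) has_real_derivative
          - (inverse (real n) * - (real n * x ^ (n - Suc 0) * inverse ((x ^ n) ^ Suc (Suc 0))))) (at x)"
        using x by (intro DERIV_minus DERIV_cmult DERIV_inverse_fun DERIV_pow) auto
      moreover have "- (inverse (real n) * - (real n * x ^ (n - Suc 0) * inverse ((x ^ n) ^ Suc (Suc 0)))) = 1 / x ^ Suc n"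
        using x m by (simp add: field_simps power_add flip: power_mult del: of_nat_Suc)
      moreover have "(\<lambda>s. - (inverse (real n) * inverse (s ^ n))) = (\<lambda>s. - (1 / (real n * s ^ n)))"
        by (simp add: divide_inverse)
      ultimately show ?thesis by simp
    qed
    show "((\<lambda>s. - (1 / (real n * s ^ n))) \<longlongrightarrow> 0) at_top"
    proof -
      have "filterlim (\<lambda>s::real. real n * s ^ n) at_top at_top"
        using n by (intro filterlim_tendsto_pos_mult_at_top[OF tendsto_const] filterlim_pow_at_top filterlim_ident) auto
      then have "((\<lambda>s::real. 1 / (real n * s ^ n)) \<longlongrightarrow> 0) at_top"
        by (intro tendsto_divide_0[OF tendsto_const] filterlim_at_top_imp_at_infinity)
      then show ?thesis using tendsto_minus by fastforce
    qed
  qed (use r in auto)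
  moreover have "(\<integral>\<^sup>+s\<in>{r<..}. ennreal (1 / s ^ Suc n) \<partial>lborel)
      = (\<integral>\<^sup>+s. ennreal (1 / s ^ Suc n) * indicator {r..} s \<partial>lborel)"
    by (intro nn_integral_cong_AE eventually_mono[OF AE_lborel_singleton[of r]]) (auto simp: indicator_def)
  ultimately show ?thesis by simp
qed

lemma borel_measurable_sgn' [measurable]: "(sgn :: real ^ 'n \<Rightarrow> _) \<in> borel_measurable borel"
  unfolding sgn_vec_def by simp

lemma open_punctured_ball: "open punctured_ball"
  unfolding punctured_ball_def by (intro open_Collect_conj open_Collect_less continuous_intros)

lemma sets_punctured_ball [measurable]: "punctured_ball \<in> sets borel"
  by (rule borel_open[OF open_punctured_ball])

lemma measurable_sgn_sphere:
  "sgn \<in> restrict_space lborel punctured_ball \<rightarrow>\<^sub>M restrict_space borel (sphere 0 (1::real) :: (real ^ 'n) set)"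
  by (rule measurable_restrict_space3) (simp, auto simp: punctured_ball_def norm_sgn)

lemma AE_sphere_area_norm: "AE u in sphere_area. norm (u :: real ^ 'n) = 1"
  by (rule AE_I2) (simp add: sphere_area_def space_scale_measure space_restrict_space)

lemma nn_integral_sphere_area:
  fixes h :: "real ^ 'n \<Rightarrow> ennreal"
  assumes [measurable]: "h \<in> borel_measurable borel"
  shows "(\<integral>\<^sup>+u. h u \<partial>sphere_area) = of_nat CARD('n) * (\<integral>\<^sup>+x\<in>punctured_ball. h (sgn x) \<partial>lborel)"
proof -
  have "h \<in> borel_measurable (restrict_space borel (sphere 0 1))"
    by (simp add: measurable_restrict_space1)
  then show ?thesis
    unfolding sphere_area_def
    by (simp add: nn_integral_scale_measure nn_integral_distr[OF measurable_sgn_sphere] nn_integral_restrict_space)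
qed

text \<open>Substituting t = s |x| and then y = s x turns the cone integral into an integral over the
  whole space, weighted by a tail integral in s that cancels the factor n.\<close>

lemma nn_integral_polar:
  fixes h :: "real ^ 'n \<Rightarrow> ennreal"
  assumes [measurable]: "h \<in> borel_measurable borel"
  shows "(\<integral>\<^sup>+u. (\<integral>\<^sup>+t\<in>{0<..}. h (t *\<^sub>R u) * ennreal (t ^ (CARD('n) - 1)) \<partial>lborel) \<partial>sphere_area)
    = (\<integral>\<^sup>+x. h x \<partial>lborel)"
proof -
  define n where "n = CARD('n)"
  have n: "0 < n" unfolding n_def by simp
  obtain m where m: "n = Suc m" using n by (metis gr0_implies_Suc)
  \<comment> \<open>The integrand after t = s |x|, where t^(n-1) dt becomes s^(n-1) |x|^n
    ds.\<close>
  define w where "w s x = h (s *\<^sub>R x) * ennreal (s ^ (n - 1) * norm x ^ n) * indicator {0<..} s * indicator punctured_ball x"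
    for s :: real and x :: "real ^ 'n"
  have [measurable]: "case_prod w \<in> borel_measurable (lborel \<Otimes>\<^sub>M lborel)" unfolding w_def by measurable
  have radial: "(\<integral>\<^sup>+t\<in>{0<..}. h (t *\<^sub>R sgn x) * ennreal (t ^ (n - 1)) \<partial>lborel) * indicator punctured_ball x
      = (\<integral>\<^sup>+s. w s x \<partial>lborel)" for x :: "real ^ 'n"
  proof (cases "x \<in> punctured_ball")
    case True
    then have x: "0 < norm x" by (simp add: punctured_ball_def)
    have "(\<integral>\<^sup>+t\<in>{0<..}. h (t *\<^sub>R sgn x) * ennreal (t ^ (n - 1)) \<partial>lborel)
      = ennreal (norm x) * (\<integral>\<^sup>+s. h ((norm x * s) *\<^sub>R sgn x) * ennreal ((norm x * s) ^ (n - 1)) * indicator {0<..} (norm x * s) \<partial>lborel)"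
      using x by (subst nn_integral_real_affine[where c="norm x" and t=0]) auto
    also have "\<dots> = (\<integral>\<^sup>+s. ennreal (norm x) * (h ((norm x * s) *\<^sub>R sgn x) * ennreal ((norm x * s) ^ (n - 1)) * indicator {0<..} (norm x * s)) \<partial>lborel)"
      by (rule nn_integral_cmult[symmetric]) simp
    also have "\<dots> = (\<integral>\<^sup>+s. w s x \<partial>lborel)"
    proof (rule nn_integral_cong)
      fix s :: real
      show "ennreal (norm x) * (h ((norm x * s) *\<^sub>R sgn x) * ennreal ((norm x * s) ^ (n - 1)) * indicator {0<..} (norm x * s)) = w s x"
      proof (cases "0 < s")
        case s: True
        have v: "(norm x * s) *\<^sub>R sgn x = s *\<^sub>R x" using x by (simp add: sgn_div_norm)
        have "norm x * (norm x * s) ^ (n - 1) = s ^ (n - 1) * norm x ^ n"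
          by (simp add: m power_mult_distrib)
        then have "ennreal (norm x) * ennreal ((norm x * s) ^ (n - 1)) = ennreal (s ^ (n - 1) * norm x ^ n)"
          using s x by (simp flip: ennreal_mult)
        note E = this[symmetric]
        show ?thesis unfolding w_def E v using True s x by (simp add: ac_simps)
      next
        case False
        then show ?thesis using x by (simp add: w_def zero_less_mult_iff)
      qed
    qed
    finally show ?thesis using True by simp
  qed (simp add: w_def)
  \<comment> \<open>After y = s x the unit ball becomes |y| < s, and s^(n-1) |x|^n dx becomes |y|^n
    / s^(n+1) dy; \<open>k\<close> is the part without the power of s.\<close>
  define k where "k s y = h y * ennreal (norm y ^ n) * indicator {y. 0 < norm y \<and> norm y < s} y" for s :: real and y :: "real ^ 'n"
  have inner: "(\<integral>\<^sup>+x. w s x \<partial>lborel) = indicator {0<..} s * (\<integral>\<^sup>+y. ennreal (1 / s ^ Suc n) * k s y \<partial>lborel)" for s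
  proof (cases "0 < s")
    case s: True
    have [measurable]: "k s \<in> borel_measurable borel" unfolding k_def by measurable
    have "(\<integral>\<^sup>+y. ennreal (1 / s ^ Suc n) * k s y \<partial>lborel)
       = ennreal (s ^ n) * (\<integral>\<^sup>+x. ennreal (1 / s ^ Suc n) * k s (s *\<^sub>R x) \<partial>lborel)"
      using nn_integral_scaleR[OF _ s, of "\<lambda>y. ennreal (1 / s ^ Suc n) * k s y"] by (simp add: n_def)
    also have "\<dots> = (\<integral>\<^sup>+x. ennreal (s ^ n) * (ennreal (1 / s ^ Suc n) * k s (s *\<^sub>R x)) \<partial>lborel)"
      by (rule nn_integral_cmult[symmetric]) simp
    also have "\<dots> = (\<integral>\<^sup>+x. w s x \<partial>lborel)"
    proof (rule nn_integral_cong)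
      fix x :: "real ^ 'n"
      have "s ^ n * ((1 / s ^ Suc n) * (s * norm x) ^ n) = s ^ (n - 1) * norm x ^ n"
        using s by (simp add: m power_mult_distrib field_simps)
      then have "ennreal (s ^ n) * (ennreal (1 / s ^ Suc n) * ennreal ((s * norm x) ^ n)) = ennreal (s ^ (n - 1) * norm x ^ n)"
        using s by (simp flip: ennreal_mult)
      note E = this[symmetric]
      have ind: "indicator {y. 0 < norm y \<and> norm y < s} (s *\<^sub>R x) = (indicator punctured_ball x :: ennreal)"
        using s by (auto simp: indicator_def punctured_ball_def zero_less_mult_iff)
      have "norm (s *\<^sub>R x) = s * norm x" using s by simp
      then show "ennreal (s ^ n) * (ennreal (1 / s ^ Suc n) * k s (s *\<^sub>R x)) = w s x"
        using s unfolding k_def w_def E ind by (simp only: ac_simps indicator_simps greaterThan_iff mult_1_left mult_1_right)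
    qed
    finally show ?thesis using s by simp
  qed (simp add: w_def)
  have "(\<integral>\<^sup>+u. (\<integral>\<^sup>+t\<in>{0<..}. h (t *\<^sub>R u) * ennreal (t ^ (n - 1)) \<partial>lborel) \<partial>sphere_area)
      = of_nat n * (\<integral>\<^sup>+x. (\<integral>\<^sup>+s. w s x \<partial>lborel) \<partial>lborel)"
    unfolding n_def[symmetric] radial[symmetric]
    by (subst nn_integral_sphere_area) (simp_all add: n_def)
  also have "(\<integral>\<^sup>+x. (\<integral>\<^sup>+s. w s x \<partial>lborel) \<partial>lborel) = (\<integral>\<^sup>+s. (\<integral>\<^sup>+x. w s x \<partial>lborel) \<partial>lborel)"
    by (rule lborel_pair.Fubini') measurable
  also have "\<dots> = (\<integral>\<^sup>+s. (\<integral>\<^sup>+y. indicator {0<..} s * (ennreal (1 / s ^ Suc n) * k s y) \<partial>lborel) \<partial>lborel)"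
    unfolding inner by (intro nn_integral_cong nn_integral_cmult[symmetric]) (simp add: k_def)
  also have "\<dots> = (\<integral>\<^sup>+y. (\<integral>\<^sup>+s. indicator {0<..} s * (ennreal (1 / s ^ Suc n) * k s y) \<partial>lborel) \<partial>lborel)"
    unfolding k_def by (rule lborel_pair.Fubini') measurable
  also have "of_nat n * \<dots> = (\<integral>\<^sup>+y. of_nat n * (\<integral>\<^sup>+s. indicator {0<..} s * (ennreal (1 / s ^ Suc n) * k s y) \<partial>lborel) \<partial>lborel)"
    unfolding k_def by (rule nn_integral_cmult[symmetric]) measurable
  also have "\<dots> = (\<integral>\<^sup>+y. h y \<partial>lborel)"
  proof (rule nn_integral_cong_AE, rule eventually_mono[OF AE_lborel_singleton[of 0]])
    fix y :: "real ^ 'n" assume "y \<noteq> 0"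
    then have y: "0 < norm y" by simp
    have "(\<integral>\<^sup>+s. indicator {0<..} s * (ennreal (1 / s ^ Suc n) * k s y) \<partial>lborel)
        = (\<integral>\<^sup>+s. h y * ennreal (norm y ^ n) * (ennreal (1 / s ^ Suc n) * indicator {norm y<..} s) \<partial>lborel)"
      using y by (intro nn_integral_cong) (auto simp: k_def indicator_def ac_simps dest: le_less_trans[OF norm_ge_zero])
    also have "\<dots> = h y * ennreal (norm y ^ n) * ennreal (1 / (real n * norm y ^ n))"
      by (subst nn_integral_cmult, simp) (simp only: nn_integral_powr_tail[OF y n])
    also have "of_nat n * \<dots> = h y * (ennreal (real n) * (ennreal (norm y ^ n) * ennreal (1 / (real n * norm y ^ n))))"
      by (simp add: ac_simps ennreal_of_nat_eq_real_of_nat)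
    also have "ennreal (real n) * (ennreal (norm y ^ n) * ennreal (1 / (real n * norm y ^ n))) = 1"
      using y n by (simp flip: ennreal_mult)
    finally show "of_nat n * (\<integral>\<^sup>+s. indicator {0<..} s * (ennreal (1 / s ^ Suc n) * k s y) \<partial>lborel) = h y"
      by simp
  qed
  finally show ?thesis unfolding n_def .
qed

section \<open>Absolute continuity on lines\<close>

text \<open>The gauge makes the tags in the exceptional null set contribute little, by absolute
  continuity; at the other tags it is the one from the derivative.\<close>

lemma fundamental_theorem_of_calculus_absolutely_continuous:
  fixes g :: "real \<Rightarrow> 'a::banach"
  assumes "a \<le> b" and ac: "absolutely_continuous_on {a..b} g"
    and N: "negligible N"
    and der: "\<And>x. x \<in> {a..b} - N \<Longrightarrow> (g has_vector_derivative g' x) (at x)"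
  shows "(g' has_integral (g b - g a)) {a..b}"
proof -
  \<comment> \<open>With the derivative replaced by 0 on \<open>N\<close>, a tag in \<open>N\<close>
    contributes only the increment of \<open>g\<close>; the integral does not see the
    change.\<close>
  define h where "h x = (if x \<in> N then 0 else g' x)" for x
  have "(h has_integral (g b - g a)) {a..b}"
    unfolding has_integral_factor_content_real
  proof (cases "a = b")
    case True
    then show "\<forall>e>0. \<exists>d. gauge d \<and> (\<forall>p. p tagged_division_of {a..b} \<and> d fine p \<longrightarrow>
      norm ((\<Sum>(x,k)\<in>p. measure lborel k *\<^sub>R h x) - (g b - g a)) \<le> e * measure lborel {a..b})"
      using has_integral_factor_content_real[of h 0 a b] has_integral_refl[of h a] 
      by (simp add: cbox_interval)
  next
    case False
    then have ab: "a < b" using \<open>a \<le> b\<close> by simp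
    show "\<forall>e>0. \<exists>d. gauge d \<and> (\<forall>p. p tagged_division_of {a..b} \<and> d fine p \<longrightarrow>
      norm ((\<Sum>(x,k)\<in>p. measure lborel k *\<^sub>R h x) - (g b - g a)) \<le> e * measure lborel {a..b})"
    proof (intro allI impI)
      fix e :: real assume e: "e > 0"
      \<comment> \<open>Half of the admissible error \<open>e * (b - a)\<close>; it is reserved for
        the intervals with tag in \<open>N\<close>, the other half for the rest.\<close>
      define \<epsilon> where "\<epsilon> = e * (b - a) / 2"
      have "\<epsilon> > 0" using e ab by (simp add: \<epsilon>_def)
      then obtain \<delta> where "\<delta> > 0" and \<delta>: "\<And>d t. d division_of t \<Longrightarrow> t \<subseteq> {a..b} \<Longrightarrow>
        (\<Sum>k\<in>d. Sup k - Inf k) < \<delta> \<Longrightarrow> (\<Sum>k\<in>d. norm (g (Sup k) - g (Inf k))) < \<epsilon>"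
        using ac unfolding absolutely_continuous_on_def by metis
      have NL: "N \<in> sets lebesgue" "emeasure lebesgue N = 0"
        using N by (auto simp: negligible_iff_null_sets)
      \<comment> \<open>The gauge will keep the intervals with tag in \<open>N\<close> inside
        \<open>T\<close>, so their total length is below the \<delta> of absolute
        continuity.\<close>
      obtain T where T: "open T" "N \<subseteq> T" "T - N \<in> lmeasurable" "emeasure lebesgue (T - N) < ennreal \<delta>"
        using sets_lebesgue_outer_open[OF NL(1) \<open>\<delta> > 0\<close>] by blast
      have Tsmall: "emeasure lebesgue T < ennreal \<delta>"
      proof -
        have "emeasure lebesgue T \<le> emeasure lebesgue (T - N) + emeasure lebesgue N"
          using emeasure_subadditive[of "T - N" lebesgue N] T NL
          by (metis Diff_partition T(2) Un_commute fmeasurableD)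
        then show ?thesis using T NL by simp
      qed
      have "\<exists>d>0. \<forall>y. \<bar>y - x\<bar> < d \<longrightarrow> norm (g y - g x - (y - x) *\<^sub>R g' x) \<le> e/2 * \<bar>y - x\<bar>"
        if "x \<in> {a..b} - N" for x
        using der[OF that] e unfolding has_vector_derivative_def has_derivative_at_alt
        by (metis half_gt_zero real_norm_def)
      then obtain D where D: "\<And>x. x \<in> {a..b} - N \<Longrightarrow> D x > 0"
        "\<And>x y. x \<in> {a..b} - N \<Longrightarrow> \<bar>y - x\<bar> < D x \<Longrightarrow> norm (g y - g x - (y - x) *\<^sub>R g' x) \<le> e/2 * \<bar>y - x\<bar>"
        by metis
      define d where "d x = (if x \<in> N then T else if x \<in> {a..b} then ball x (D x) else UNIV)" for x
      have "gauge d" unfolding gauge_def d_def using T D by auto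
      have main: "norm ((\<Sum>(x,k)\<in>p. measure lborel k *\<^sub>R h x) - (g b - g a)) \<le> e * measure lborel {a..b}"
        if p: "p tagged_division_of {a..b}" "d fine p" for p
      proof -
        note p' = tagged_division_ofD[OF p(1)]
        have Kin: "\<exists>u v. K = {u..v} \<and> u \<le> v \<and> x \<in> {u..v} \<and> x \<in> {a..b} \<and> {u..v} \<subseteq> {a..b}" if "(x,K) \<in> p" for x K
          using p'(2,3,4)[OF that] by (metis atLeastatMost_empty_iff box_real(2) empty_iff subsetD)
        define dif where "dif = (\<lambda>(x, K). measure lborel K *\<^sub>R h x - (g (Sup K) - g (Inf K)))"
        let ?A = "{z \<in> p. fst z \<in> N}"
        have tel: "(\<Sum>(x,K)\<in>p. g (Sup K) - g (Inf K)) = g b - g a"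
          using additive_tagged_division_1[OF \<open>a \<le> b\<close> p(1), of g] by simp
        have tel1: "(\<Sum>(x,K)\<in>p. Sup K - Inf K) = b - a"
          using additive_tagged_division_1[OF \<open>a \<le> b\<close> p(1), of "\<lambda>x. x"] by simp
        have fin: "finite p" using p'(1) .
        have "(\<Sum>(x,k)\<in>p. measure lborel k *\<^sub>R h x) - (g b - g a) = sum dif p"
          unfolding tel[symmetric] dif_def by (simp add: sum_subtractf case_prod_unfold)
        also have "\<dots> = sum dif ?A + sum dif (p - ?A)"
          using fin by (metis (no_types, lifting) Diff_disjoint Diff_partition finite_Diff finite_subset mem_Collect_eq subsetI sum.union_disjoint)
        finally have split: "norm ((\<Sum>(x,k)\<in>p. measure lborel k *\<^sub>R h x) - (g b - g a))
            \<le> norm (sum dif ?A) + norm (sum dif (p - ?A))" by (simp add: norm_triangle_ineq)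
        have "norm (sum dif (p - ?A)) \<le> (\<Sum>(x,K)\<in>p - ?A. e/2 * (Sup K - Inf K))"
        proof (rule sum_norm_le)
          fix z assume z: "z \<in> p - ?A"
          obtain x K where zx: "z = (x,K)" by force
          obtain u v where uv: "K = {u..v}" "u \<le> v" "x \<in> {u..v}" "x \<in> {a..b}" using Kin z zx by blast
          have xN: "x \<in> {a..b} - N" using z zx uv by auto
          have "K \<subseteq> d x" using p(2) z zx unfolding fine_def by blast
          then have sub: "{u..v} \<subseteq> ball x (D x)" using uv xN unfolding d_def by auto
          then have "\<bar>u - x\<bar> < D x" "\<bar>v - x\<bar> < D x"
            using uv subsetD[OF sub, of u] subsetD[OF sub, of v] by (auto simp: dist_real_def abs_minus_commute)
          \<comment> \<open>The straddle estimate: the tag \<open>x\<close> lies between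
            \<open>u\<close> and \<open>v\<close>, so the two one-sided errors add up to a multiple
            of \<open>v - u\<close>.\<close>
          then have "norm (g u - g x - (u - x) *\<^sub>R g' x) + norm (g v - g x - (v - x) *\<^sub>R g' x)
              \<le> e/2 * \<bar>u - x\<bar> + e/2 * \<bar>v - x\<bar>"
            using D(2)[OF xN] by (intro add_mono) auto
          moreover have "dif z = (g u - g x - (u - x) *\<^sub>R g' x) - (g v - g x - (v - x) *\<^sub>R g' x)"
            using uv xN unfolding dif_def zx h_def by (auto simp: algebra_simps)
          ultimately have "norm (dif z) \<le> e/2 * \<bar>u - x\<bar> + e/2 * \<bar>v - x\<bar>"
            by (simp only: norm_triangle_le_diff)
          also have "\<dots> = e/2 * (\<bar>u - x\<bar> + \<bar>v - x\<bar>)" by (simp only: distrib_left)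
          also have "\<bar>u - x\<bar> + \<bar>v - x\<bar> = v - u" using uv by auto
          finally show "norm (dif z) \<le> (case z of (x, K) \<Rightarrow> e/2 * (Sup K - Inf K))"
            using uv zx by simp
        qed
        also have "\<dots> \<le> (\<Sum>(x,K)\<in>p. e/2 * (Sup K - Inf K))"
        proof (rule sum_mono2)
          fix z assume "z \<in> p - (p - ?A)"
          then obtain x K where "z = (x,K)" "(x,K) \<in> p" by (metis DiffD1 surj_pair)
          then show "0 \<le> (case z of (x, K) \<Rightarrow> e/2 * (Sup K - Inf K))"
            using Kin[of x K] e by auto
        qed (use fin in auto)
        also have "\<dots> = e/2 * (b - a)"
          unfolding tel1[symmetric] by (simp add: sum_distrib_left case_prod_unfold)
        finally have I: "norm (sum dif (p - ?A)) \<le> e/2 * (b - a)" .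
        have tpA: "?A tagged_partial_division_of {a..b}"
          using p(1) by (auto intro: tagged_partial_division_subset simp: tagged_division_of_def)
        have tdA: "?A tagged_division_of \<Union>(snd ` ?A)"
          using tpA by (rule tagged_partial_division_of_Union_self)
        have dA: "snd ` ?A division_of \<Union>(snd ` ?A)"
          using tpA by (rule partial_division_of_tagged_division)
        have subab: "\<Union>(snd ` ?A) \<subseteq> {a..b}" using p'(3) by force
        have subT: "\<Union>(snd ` ?A) \<subseteq> T"
        proof -
          have "K \<subseteq> T" if "(x,K) \<in> p" "x \<in> N" for x K
            using p(2) that unfolding fine_def d_def by force
          then show ?thesis by fastforce
        qed
        have "(\<Sum>k\<in>snd ` ?A. Sup k - Inf k) = (\<Sum>k\<in>snd ` ?A. measure lebesgue k)"
        proof (rule sum.cong)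
          fix K assume "K \<in> snd ` ?A"
          then obtain x where "(x,K) \<in> p" by force
          then show "Sup K - Inf K = measure lebesgue K" using Kin by fastforce
        qed simp
        also have "\<dots> = measure lebesgue (\<Union>(snd ` ?A))"
          using content_division[OF dA] .
        also have "\<dots> < \<delta>"
        proof -
          have "emeasure lebesgue (\<Union>(snd ` ?A)) \<le> emeasure lebesgue T"
            by (rule emeasure_mono[OF subT]) (use T in auto)
          then have "emeasure lebesgue (\<Union>(snd ` ?A)) < ennreal \<delta>" using Tsmall by simp
          moreover from this have "emeasure lebesgue (\<Union>(snd ` ?A)) \<noteq> \<infinity>" by auto
          ultimately show ?thesis by (simp add: emeasure_eq_ennreal_measure ennreal_less_iff)
        qed
        finally have "(\<Sum>k\<in>snd ` ?A. norm (g (Sup k) - g (Inf k))) < \<epsilon>"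
          using \<delta>[OF dA subab] by blast
        moreover have "(\<Sum>(x,k)\<in>?A. norm (g (Sup k) - g (Inf k))) = (\<Sum>k\<in>snd ` ?A. norm (g (Sup k) - g (Inf k)))"
        proof -
          \<comment> \<open>The passage from tagged pairs to intervals asks for a function that
            vanishes on all degenerate intervals. \<open>Sup\<close> and \<open>Inf\<close> of the
            empty one have no useful value, hence the case distinction.\<close>
          define \<nu> where "\<nu> k = (if k = {} then 0 else norm (g (Sup k) - g (Inf k)))" for k
          have ne: "k \<noteq> {}" if "(x, k) \<in> p" for x k using p'(2)[OF that] by blast
          have "(\<Sum>(x,k)\<in>?A. \<nu> k) = (\<Sum>k\<in>snd ` ?A. \<nu> k)"
          proof (rule sum.over_tagged_division_lemma[OF tdA])
            fix u v :: real assume "box u v = {}"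
            then show "\<nu> (cbox u v) = 0"
              unfolding \<nu>_def by (cases "u = v") auto
          qed
          moreover have "(\<Sum>(x,k)\<in>?A. \<nu> k) = (\<Sum>(x,k)\<in>?A. norm (g (Sup k) - g (Inf k)))"
            using ne by (intro sum.cong) (auto simp: \<nu>_def)
          moreover have "(\<Sum>k\<in>snd ` ?A. \<nu> k) = (\<Sum>k\<in>snd ` ?A. norm (g (Sup k) - g (Inf k)))"
            using ne by (intro sum.cong) (auto simp: \<nu>_def)
          ultimately show ?thesis by simp
        qed
        moreover have "norm (sum dif ?A) \<le> (\<Sum>(x,k)\<in>?A. norm (g (Sup k) - g (Inf k)))"
          by (rule sum_norm_le) (auto simp: dif_def h_def norm_minus_commute)
        ultimately have "norm (sum dif ?A) \<le> e/2 * (b - a)" unfolding \<epsilon>_def by simp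
        then show ?thesis using split I ab by simp
      qed
      show "\<exists>d. gauge d \<and> (\<forall>p. p tagged_division_of {a..b} \<and> d fine p \<longrightarrow>
        norm ((\<Sum>(x,k)\<in>p. measure lborel k *\<^sub>R h x) - (g b - g a)) \<le> e * measure lborel {a..b})" 
        by (intro exI[of _ d] conjI allI impI main \<open>gauge d\<close>) auto
    qed
  qed
  then show ?thesis
    by (rule has_integral_spike[OF N, rotated]) (simp add: h_def)
qed

section \<open>Lines parallel to the axes and exceptional null sets\<close>

definition coord_upd :: "real ^ 'n \<Rightarrow> 'n \<Rightarrow> real \<Rightarrow> real ^ 'n" where
  "coord_upd x i s = (\<chi> j. if j = i then s else x $ j)"

lemma coord_upd_nth [simp]: "coord_upd x i s $ j = (if j = i then s else x $ j)"
  by (simp add: coord_upd_def)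

lemma coord_upd_coord_upd [simp]: "coord_upd (coord_upd x i s) i t = coord_upd x i t"
  by (simp add: vec_eq_iff)

lemma coord_upd_eq_translate: "coord_upd x i (x $ i + s) = x + s *\<^sub>R axis i 1"
  by (auto simp: vec_eq_iff axis_def)

lemma borel_measurable_coord_upd [measurable]:
  assumes [measurable]: "f \<in> borel_measurable M" "g \<in> borel_measurable M"
  shows "(\<lambda>x. coord_upd (f x) i (g x)) \<in> borel_measurable M"
proof (rule borel_measurable_continuous_Pair[OF assms])
  have "continuous_on UNIV (\<lambda>p :: (real ^ 'b) \<times> real. if j = i then snd p else fst p $ j)" for j
    by (cases "j = i") (auto intro!: continuous_intros)
  then show "continuous_on UNIV (\<lambda>p. coord_upd (fst p) i (snd p))"
    unfolding coord_upd_def by (intro continuous_on_vec_lambda)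
qed

text \<open>The fibres are integrated over all of space: moving the base point along its own line by a
  bounded amount does not change the total integral.\<close>

lemma AE_nn_integral_line_finite:
  fixes g :: "real ^ 'n \<Rightarrow> ennreal"
  assumes [measurable]: "g \<in> borel_measurable borel" and fin: "(\<integral>\<^sup>+x. g x \<partial>lborel) < \<infinity>"
  shows "AE x in lborel. \<forall>\<alpha> \<beta>. (\<integral>\<^sup>+s\<in>{\<alpha>..\<beta>}. g (coord_upd x i s) \<partial>lborel) < \<infinity>"
proof -
  have "AE x in lborel. (\<integral>\<^sup>+s\<in>{-real m..real m}. g (x + s *\<^sub>R axis i 1) \<partial>lborel) \<noteq> \<infinity>" for m
  proof (rule nn_integral_PInf_AE)
    have "(\<integral>\<^sup>+x. (\<integral>\<^sup>+s\<in>{-real m..real m}. g (x + s *\<^sub>R axis i 1) \<partial>lborel) \<partial>lborel)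
        = (\<integral>\<^sup>+s. (\<integral>\<^sup>+x. g (x + s *\<^sub>R axis i 1) * indicator {-real m..real m} s \<partial>lborel) \<partial>lborel)"
      by (rule lborel_pair.Fubini') measurable
    also have "\<dots> = (\<integral>\<^sup>+s. (\<integral>\<^sup>+x. g x \<partial>lborel) * indicator {-real m..real m} s \<partial>lborel)"
    proof (rule nn_integral_cong)
      fix s :: real
      have "(\<integral>\<^sup>+x. g (x + s *\<^sub>R axis i 1) \<partial>lborel) = (\<integral>\<^sup>+x. g x \<partial>distr lborel borel ((+) (s *\<^sub>R axis i 1)))"
        by (simp add: nn_integral_distr add.commute)
      then show "(\<integral>\<^sup>+x. g (x + s *\<^sub>R axis i 1) * indicator {-real m..real m} s \<partial>lborel)
          = (\<integral>\<^sup>+x. g x \<partial>lborel) * indicator {-real m..real m} s"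
        by (simp add: nn_integral_multc lborel_distr_plus)
    qed
    also have "\<dots> = (\<integral>\<^sup>+x. g x \<partial>lborel) * ennreal (2 * real m)"
      by (simp add: nn_integral_cmult_indicator)
    finally show "(\<integral>\<^sup>+x. (\<integral>\<^sup>+s\<in>{-real m..real m}. g (x + s *\<^sub>R axis i 1) \<partial>lborel) \<partial>lborel) \<noteq> \<infinity>"
      using fin by (simp add: ennreal_mult_eq_top_iff less_top)
  qed measurable
  then have "AE x in lborel. \<forall>m. (\<integral>\<^sup>+s\<in>{-real m..real m}. g (x + s *\<^sub>R axis i 1) \<partial>lborel) \<noteq> \<infinity>"
    by (simp add: AE_all_countable)
  then show ?thesis
  proof (rule eventually_mono, intro allI)
    fix x :: "real ^ 'n" and \<alpha> \<beta> :: real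
    assume fin': "\<forall>m. (\<integral>\<^sup>+s\<in>{-real m..real m}. g (x + s *\<^sub>R axis i 1) \<partial>lborel) \<noteq> \<infinity>"
    \<comment> \<open>In the hypothesis the parameter is measured from the base point, in the claim
      from 0; \<open>m\<close> is so large that the shifted interval lies in [-m, m].\<close>
    obtain m where m: "\<bar>\<alpha> - x $ i\<bar> + \<bar>\<beta> - x $ i\<bar> \<le> real m" using real_arch_simple by blast
    have "(\<integral>\<^sup>+s\<in>{\<alpha>..\<beta>}. g (coord_upd x i s) \<partial>lborel)
        = (\<integral>\<^sup>+s. g (x + s *\<^sub>R axis i 1) * indicator {\<alpha>..\<beta>} (x $ i + s) \<partial>lborel)"
      by (subst nn_integral_real_affine[where c=1 and t="x $ i"]) (simp_all add: coord_upd_eq_translate)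
    also have "\<dots> \<le> (\<integral>\<^sup>+s\<in>{-real m..real m}. g (x + s *\<^sub>R axis i 1) \<partial>lborel)"
      using m by (intro nn_integral_mono) (auto simp: indicator_def split: if_splits)
    also have "\<dots> < \<infinity>" using fin' by (simp add: less_top)
    finally show "(\<integral>\<^sup>+s\<in>{\<alpha>..\<beta>}. g (coord_upd x i s) \<partial>lborel) < \<infinity>" .
  qed
qed

text \<open>A covering null set gives a function with values 0 and \<infinity> and integral 0. Its
  integral over segments of almost every line is finite, so these segments meet the null set in null
  sets.\<close>

lemma AE_line:
  fixes P :: "real ^ 'n \<Rightarrow> bool"
  assumes "AE x in lborel. P x"
  shows "AE x in lborel. \<forall>\<alpha> \<beta>. AE s in lborel. s \<in> {\<alpha>..\<beta>} \<longrightarrow> P (coord_upd x i s)"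
proof -
  from AE_E[OF assms] obtain N where N: "{x \<in> space lborel. \<not> P x} \<subseteq> N" "emeasure lborel N = 0" "N \<in> sets lborel" .
  have [measurable]: "N \<in> sets borel" using N by simp
  let ?g = "\<lambda>x. \<infinity> * indicator N x :: ennreal"
  have "(\<integral>\<^sup>+x. ?g x \<partial>lborel) = 0" using N by (simp add: nn_integral_cmult_indicator)
  then have "AE x in lborel. \<forall>\<alpha> \<beta>. (\<integral>\<^sup>+s\<in>{\<alpha>..\<beta>}. ?g (coord_upd x i s) \<partial>lborel) < \<infinity>"
    by (intro AE_nn_integral_line_finite) simp_all
  then show ?thesis
  proof (rule eventually_mono, intro allI)
    fix x \<alpha> \<beta> assume "\<forall>\<alpha> \<beta>. (\<integral>\<^sup>+s\<in>{\<alpha>..\<beta>}. ?g (coord_upd x i s) \<partial>lborel) < \<infinity>"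
    then have "(\<integral>\<^sup>+s\<in>{\<alpha>..\<beta>}. ?g (coord_upd x i s) \<partial>lborel) \<noteq> \<infinity>" using less_top by fastforce
    then have "AE s in lborel. ?g (coord_upd x i s) * indicator {\<alpha>..\<beta>} s \<noteq> \<infinity>"
      by (intro nn_integral_PInf_AE) simp_all
    then show "AE s in lborel. s \<in> {\<alpha>..\<beta>} \<longrightarrow> P (coord_upd x i s)"
      by eventually_elim (use N(1) in \<open>auto simp: indicator_def ennreal_top_mult split: if_splits\<close>)
  qed
qed

section \<open>Lebesgue measure as a product of one-dimensional measures\<close>

lemma measurable_vec_lambda_PiM [measurable]:
  "vec_lambda \<in> (\<Pi>\<^sub>M j\<in>UNIV. lborel) \<rightarrow>\<^sub>M (borel :: (real ^ 'n) measure)"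
proof -
  have "(\<lambda>\<omega>. \<omega> j) \<in> borel_measurable (\<Pi>\<^sub>M j\<in>(UNIV::'n set). lborel :: real measure)" for j
    using measurable_component_singleton[of j UNIV "\<lambda>_. lborel :: real measure"] by simp
  then show ?thesis
    by (subst borel_measurable_euclidean_space) (auto simp: Basis_vec_def inner_axis)
qed

lemma lborel_vec_eq_PiM:
  "(lborel :: (real ^ 'n) measure) = distr (\<Pi>\<^sub>M j\<in>UNIV. lborel) borel vec_lambda"
proof (rule lborel_eqI)
  fix l u :: "real ^ 'n"
  assume "\<And>b. b \<in> Basis \<Longrightarrow> l \<bullet> b \<le> u \<bullet> b"
  then have lu: "l $ i \<le> u $ i" for i
    by (metis axis_in_Basis_iff inner_axis inner_real_def mult.right_neutral Basis_real_def insertI1)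
  interpret product_sigma_finite "\<lambda>_::'n. lborel :: real measure" by standard
  have "vec_lambda -` box l u \<inter> space (\<Pi>\<^sub>M j\<in>UNIV. lborel) = Pi\<^sub>E UNIV (\<lambda>j. {l $ j<..<u $ j})"
    by (auto simp: mem_box_cart space_PiM PiE_def Pi_def)
  then have "emeasure (distr (\<Pi>\<^sub>M j\<in>UNIV. lborel) borel vec_lambda) (box l u)
      = emeasure (\<Pi>\<^sub>M j\<in>UNIV. lborel) (Pi\<^sub>E UNIV (\<lambda>j. {l $ j<..<u $ j}))"
    by (subst emeasure_distr) simp_all
  also have "\<dots> = (\<Prod>j\<in>UNIV. ennreal (u $ j - l $ j))"
    using lu by (subst emeasure_PiM) simp_all
  also have "\<dots> = ennreal (\<Prod>j\<in>UNIV. u $ j - l $ j)"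
    using lu by (intro prod_ennreal) simp
  also have "\<dots> = ennreal (\<Prod>b\<in>Basis. (u - l) \<bullet> b)"
    by (simp add: prod_Basis_cart inner_axis)
  finally show "emeasure (distr (\<Pi>\<^sub>M j\<in>UNIV. lborel) borel vec_lambda) (box l u) = (\<Prod>b\<in>Basis. (u - l) \<bullet> b)" .
qed simp

text \<open>The exceptional set is a cylinder over a null set of the other coordinates, and
  integrating in coordinate \<open>i\<close> shows that it is null. This turns "almost every line"
  of \<open>ACL_on\<close> into "almost every point".\<close>

lemma AE_lborel_of_AE_PiM:
  fixes R :: "('n::finite \<Rightarrow> real) \<Rightarrow> bool"
  assumes "AE y in (\<Pi>\<^sub>M j\<in>UNIV - {i}. lborel). R y"
  shows "AE x in (lborel :: (real ^ 'n) measure). R (restrict (($) x) (UNIV - {i}))"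
proof -
  interpret product_sigma_finite "\<lambda>_::'n. lborel :: real measure" by standard
  let ?P = "\<Pi>\<^sub>M j\<in>UNIV - {i}. lborel :: real measure"
  from AE_E[OF assms] obtain N where N: "{y \<in> space ?P. \<not> R y} \<subseteq> N" "emeasure ?P N = 0" "N \<in> sets ?P" .
  note N(3)[measurable]
  have r[measurable]: "(\<lambda>\<omega>. restrict \<omega> (UNIV - {i})) \<in> (\<Pi>\<^sub>M j\<in>UNIV. lborel) \<rightarrow>\<^sub>M ?P"
    by (rule measurable_restrict_subset) simp
  have U: "insert i (UNIV - {i}) = UNIV" by blast
  have r': "(\<lambda>\<omega>. indicator N (restrict \<omega> (UNIV - {i})) :: ennreal) \<in> borel_measurable (\<Pi>\<^sub>M j\<in>insert i (UNIV - {i}). lborel)"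
    unfolding U by measurable
  have "(\<integral>\<^sup>+\<omega>. indicator N (restrict \<omega> (UNIV - {i})) \<partial>(\<Pi>\<^sub>M j\<in>insert i (UNIV - {i}). lborel))
      = (\<integral>\<^sup>+y. (\<integral>\<^sup>+s. indicator N (restrict (y(i := s)) (UNIV - {i})) \<partial>lborel) \<partial>?P)"
    by (rule product_nn_integral_insert) (use r' in auto)
  also have "\<dots> = (\<integral>\<^sup>+y. (\<integral>\<^sup>+s. indicator N y \<partial>(lborel :: real measure)) \<partial>?P)"
  proof (rule nn_integral_cong)
    fix y assume "y \<in> space ?P"
    then have "restrict (y(i := s)) (UNIV - {i}) = y" for s
      by (auto simp: space_PiM PiE_def extensional_def restrict_def fun_eq_iff)
    then show "(\<integral>\<^sup>+s. indicator N (restrict (y(i := s)) (UNIV - {i})) \<partial>lborel) = (\<integral>\<^sup>+s. indicator N y \<partial>(lborel :: real measure))"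
      by simp
  qed
  also have "\<dots> = 0"
    using N by (simp add: nn_integral_multc nn_integral_cmult_indicator mult.commute[of "indicator N _"])
  finally have "AE \<omega> in (\<Pi>\<^sub>M j\<in>UNIV. lborel). indicator N (restrict \<omega> (UNIV - {i})) = (0 :: ennreal)"
    unfolding U by (subst (asm) nn_integral_0_iff_AE) simp_all
  then have *: "AE \<omega> in (\<Pi>\<^sub>M j\<in>UNIV. lborel). R (restrict \<omega> (UNIV - {i}))"
  proof eventually_elim
    case (elim \<omega>)
    then have "restrict \<omega> (UNIV - {i}) \<notin> N" by (simp add: indicator_def split: if_splits)
    moreover have "restrict \<omega> (UNIV - {i}) \<in> space ?P" by (auto simp: space_PiM)
    ultimately show ?case using N(1) by blast
  qed
  from AE_E[OF *] obtain M where M: "{\<omega> \<in> space (\<Pi>\<^sub>M j\<in>UNIV. lborel). \<not> R (restrict \<omega> (UNIV - {i}))} \<subseteq> M"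
    "emeasure (\<Pi>\<^sub>M j\<in>UNIV. lborel) M = 0" "M \<in> sets (\<Pi>\<^sub>M j\<in>(UNIV :: 'n set). lborel :: real measure)" .
  have [measurable]: "(\<lambda>x. (\<lambda>j. x $ j)) \<in> (borel :: (real ^ 'n) measure) \<rightarrow>\<^sub>M (\<Pi>\<^sub>M j\<in>UNIV. lborel)"
    by (rule measurable_PiM_single') (auto simp: space_PiM)
  let ?M = "{x :: real ^ 'n. (\<lambda>j. x $ j) \<in> M}"
  have "?M \<in> sets borel"
    using measurable_sets[OF \<open>(\<lambda>x. (\<lambda>j. x $ j)) \<in> _\<close> M(3)] by (simp add: vimage_def)
  moreover have "vec_lambda -` ?M \<inter> space (\<Pi>\<^sub>M j\<in>UNIV. lborel) = M"
    using sets.sets_into_space[OF M(3)] by (auto simp: vec_lambda_inverse)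
  ultimately have "emeasure (lborel :: (real ^ 'n) measure) ?M = 0"
    using M(2) by (subst lborel_vec_eq_PiM) (simp add: emeasure_distr)
  then have "?M \<in> null_sets lborel" using \<open>?M \<in> sets borel\<close> by (intro null_setsI) auto
  then show ?thesis
    by (rule AE_I') (use M(1) in \<open>auto simp: space_PiM\<close>)
qed

lemma absolutely_continuous_on_subset:
  "absolutely_continuous_on S g \<Longrightarrow> T \<subseteq> S \<Longrightarrow> absolutely_continuous_on T g"
  unfolding absolutely_continuous_on_def by (meson subset_trans)

text \<open>On almost every line three things hold together: absolute continuity, the derivative at
  almost every parameter, and integrability of \<open>h\<close> over segments. The fundamental
  theorem yields a gauge integral, which integrability turns into a Lebesgue integral. One null set
  serves all \<open>s1\<close> and \<open>s2\<close>, since the three facts hold for all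
  subintervals at once.\<close>

lemma ACL_on_line_integral:
  fixes f :: "real ^ 'n \<Rightarrow> 'b::euclidean_space" and h :: "real ^ 'n \<Rightarrow> 'b"
  assumes acl: "ACL_on G f" and G: "cbox a b \<subseteq> G"
    and der: "AE x in lborel. x \<in> cbox a b \<longrightarrow> ((\<lambda>s. f (coord_upd x i s)) has_vector_derivative h x) (at (x $ i))"
    and int: "integrable lborel h"
  shows "AE x in lborel. (\<forall>j. j \<noteq> i \<longrightarrow> a $ j \<le> x $ j \<and> x $ j \<le> b $ j) \<longrightarrow>
    (\<forall>s1 s2. a $ i \<le> s1 \<longrightarrow> s1 \<le> s2 \<longrightarrow> s2 \<le> b $ i \<longrightarrow>
      set_integrable lborel {s1..s2} (\<lambda>s. h (coord_upd x i s)) \<and>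
      f (coord_upd x i s2) - f (coord_upd x i s1) = (LINT s:{s1..s2}|lborel. h (coord_upd x i s)))"
proof -
  have [measurable]: "h \<in> borel_measurable borel" using int by auto
  have "AE y in (\<Pi>\<^sub>M j\<in>UNIV - {i}. lborel). (\<forall>j\<in>UNIV - {i}. a $ j \<le> y j \<and> y j \<le> b $ j) \<longrightarrow>
      absolutely_continuous_on {a $ i..b $ i} (\<lambda>s. f (\<chi> j. if j = i then s else y j))"
    using acl G unfolding ACL_on_def by blast
  from AE_lborel_of_AE_PiM[OF this]
  have 1: "AE x in lborel. (\<forall>j. j \<noteq> i \<longrightarrow> a $ j \<le> x $ j \<and> x $ j \<le> b $ j) \<longrightarrow>
      absolutely_continuous_on {a $ i..b $ i} (\<lambda>s. f (coord_upd x i s))"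
  proof eventually_elim
    case (elim x)
    have "(\<chi> j. if j = i then s else restrict (($) x) (UNIV - {i}) j) = coord_upd x i s" for s
      by (simp add: vec_eq_iff)
    then show ?case using elim by auto
  qed
  have 2: "AE x in lborel. \<forall>\<alpha> \<beta>. AE s in lborel. s \<in> {\<alpha>..\<beta>} \<longrightarrow> (coord_upd x i s \<in> cbox a b \<longrightarrow>
      ((\<lambda>s. f (coord_upd (coord_upd x i s) i s)) has_vector_derivative h (coord_upd x i s)) (at (coord_upd x i s $ i)))"
    using AE_line[OF der, of i] by simp
  have "(\<integral>\<^sup>+x. ennreal (norm (h x)) \<partial>lborel) < \<infinity>" using int by (simp add: integrable_iff_bounded)
  then have 3: "AE x in lborel. \<forall>\<alpha> \<beta>. (\<integral>\<^sup>+s\<in>{\<alpha>..\<beta>}. ennreal (norm (h (coord_upd x i s))) \<partial>lborel) < \<infinity>"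
    by (intro AE_nn_integral_line_finite) simp_all
  from 1 2 3 show ?thesis
  proof eventually_elim
    case (elim x)
    show ?case
    proof (intro impI allI)
      fix s1 s2
      assume x: "\<forall>j. j \<noteq> i \<longrightarrow> a $ j \<le> x $ j \<and> x $ j \<le> b $ j" and s: "a $ i \<le> s1" "s1 \<le> s2" "s2 \<le> b $ i"
      have "absolutely_continuous_on {a $ i..b $ i} (\<lambda>s. f (coord_upd x i s))" using elim(1) x by blast
      then have ac: "absolutely_continuous_on {s1..s2} (\<lambda>s. f (coord_upd x i s))"
        by (rule absolutely_continuous_on_subset) (use s in auto)
      have "AE s in lborel. s \<in> {s1..s2} \<longrightarrow> (coord_upd x i s \<in> cbox a b \<longrightarrow>
        ((\<lambda>s. f (coord_upd (coord_upd x i s) i s)) has_vector_derivative h (coord_upd x i s)) (at (coord_upd x i s $ i)))"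
        using elim(2) by blast
      then have "AE s in lborel. s \<in> {s1..s2} \<longrightarrow> ((\<lambda>s. f (coord_upd x i s)) has_vector_derivative h (coord_upd x i s)) (at s)"
        by eventually_elim (use x s in \<open>auto simp: mem_box_cart\<close>)
      from AE_E[OF this] obtain N where N: "{s \<in> space lborel. \<not> (s \<in> {s1..s2} \<longrightarrow> ((\<lambda>s. f (coord_upd x i s)) has_vector_derivative h (coord_upd x i s)) (at s))} \<subseteq> N"
        "emeasure lborel N = 0" "N \<in> sets lborel" .
      have "negligible N" using N by (auto simp: negligible_iff_null_sets intro!: null_sets_completionI)
      then have hi: "((\<lambda>s. h (coord_upd x i s)) has_integral (f (coord_upd x i s2) - f (coord_upd x i s1))) {s1..s2}"
        using N(1) by (intro fundamental_theorem_of_calculus_absolutely_continuous[OF s(2) ac]) auto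
      have "(\<integral>\<^sup>+s. ennreal (norm (indicator {s1..s2} s *\<^sub>R h (coord_upd x i s))) \<partial>lborel)
          = (\<integral>\<^sup>+s\<in>{s1..s2}. ennreal (norm (h (coord_upd x i s))) \<partial>lborel)"
        by (intro nn_integral_cong) (auto simp: indicator_def)
      also have "\<dots> < \<infinity>" using elim(3) by blast
      finally have si: "set_integrable lborel {s1..s2} (\<lambda>s. h (coord_upd x i s))"
        unfolding set_integrable_def by (simp add: integrable_iff_bounded)
      show "set_integrable lborel {s1..s2} (\<lambda>s. h (coord_upd x i s)) \<and>
        f (coord_upd x i s2) - f (coord_upd x i s1) = (LINT s:{s1..s2}|lborel. h (coord_upd x i s))"
        using si hi set_borel_integral_eq_integral(2)[OF si] integral_unique by metis
    qed
  qed
qed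

section \<open>Dilations and integrable functions\<close>

lemma borel_measurable_times_vec [measurable]:
  fixes f g :: "'a \<Rightarrow> real ^ 'n"
  assumes [measurable]: "f \<in> borel_measurable M" "g \<in> borel_measurable M"
  shows "(\<lambda>x. f x * g x) \<in> borel_measurable M"
proof (rule borel_measurable_continuous_Pair[OF assms])
  show "continuous_on UNIV (\<lambda>p :: (real ^ 'n) \<times> (real ^ 'n). fst p * snd p)"
    unfolding times_vec_def by (intro continuous_on_vec_lambda continuous_intros)
qed

text \<open>The product of vectors is componentwise, so \<open>d * x\<close> is the image of
  \<open>x\<close> under the diagonal matrix with entries \<open>d\<close>, whose determinant is the
  product of the entries.\<close>

lemma nn_integral_diag_scale:
  fixes g :: "real ^ 'n \<Rightarrow> ennreal"
  assumes [measurable]: "g \<in> borel_measurable borel" and d: "\<And>j. 0 < d $ j"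
  shows "(\<integral>\<^sup>+x. g x \<partial>lborel) = ennreal (\<Prod>j\<in>UNIV. d $ j) * (\<integral>\<^sup>+x. g (d * x) \<partial>lborel)"
proof -
  have T: "(0 :: real ^ 'n) + (\<Sum>b\<in>Basis. ((d \<bullet> b) * (x \<bullet> b)) *\<^sub>R b) = d * x" for x
  proof (rule euclidean_eqI)
    fix b :: "real ^ 'n" assume b: "b \<in> Basis"
    then obtain i where "b = axis i 1" by (auto simp: Basis_vec_def)
    then have "(d * x) \<bullet> b = (d \<bullet> b) * (x \<bullet> b)" by (simp add: inner_axis)
    then show "(0 + (\<Sum>b\<in>Basis. ((d \<bullet> b) * (x \<bullet> b)) *\<^sub>R b)) \<bullet> b = (d * x) \<bullet> b"
      using inner_sum_left_Basis[OF b, of "\<lambda>b. (d \<bullet> b) * (x \<bullet> b)"] by simp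
  qed
  have nz: "d \<bullet> b \<noteq> 0" if "b \<in> Basis" for b
    using that d by (auto simp: Basis_vec_def inner_axis) (metis less_irrefl)
  have P: "(\<Prod>b\<in>Basis. \<bar>d \<bullet> b\<bar>) = (\<Prod>j\<in>UNIV. d $ j)"
    unfolding prod_Basis_cart using d by (auto simp: inner_axis abs_of_pos intro!: prod.cong)
  have eq: "lborel = density (distr lborel borel (\<lambda>x. d * x)) (\<lambda>_. ennreal (\<Prod>j\<in>UNIV. d $ j))"
    using lborel_affine_euclidean[of "\<lambda>b. d \<bullet> b" 0] nz unfolding T P by simp
  show ?thesis
    by (subst eq) (simp add: nn_integral_density nn_integral_distr nn_integral_cmult)
qed

text \<open>The determinant is at least \<open>a ^ CARD('n)\<close>. The constant is common to all
  \<open>d\<close> with entries at least \<open>a\<close>, which makes the later estimates uniform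
  in the dilation.\<close>

lemma nn_integral_diag_scale_le:
  fixes g :: "real ^ 'n \<Rightarrow> ennreal"
  assumes [measurable]: "g \<in> borel_measurable borel" and a: "0 < a" and d: "\<And>j. a \<le> d $ j"
  shows "(\<integral>\<^sup>+x. g (d * x) \<partial>lborel) \<le> ennreal (1 / a ^ CARD('n)) * (\<integral>\<^sup>+x. g x \<partial>lborel)"
proof -
  have "a ^ CARD('n) \<le> (\<Prod>j\<in>UNIV. d $ j)"
    using prod_mono[of UNIV "\<lambda>_. a" "\<lambda>j. d $ j"] a d by simp
  then have "ennreal (a ^ CARD('n)) * (\<integral>\<^sup>+x. g (d * x) \<partial>lborel) \<le> (\<integral>\<^sup>+x. g x \<partial>lborel)"
    using a d by (subst nn_integral_diag_scale[of g d])
      (auto intro!: mult_right_mono ennreal_leI intro: less_le_trans)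
  then have "ennreal (1 / a ^ CARD('n)) * (ennreal (a ^ CARD('n)) * (\<integral>\<^sup>+x. g (d * x) \<partial>lborel))
      \<le> ennreal (1 / a ^ CARD('n)) * (\<integral>\<^sup>+x. g x \<partial>lborel)"
    by (intro mult_left_mono) auto
  moreover have "ennreal (1 / a ^ CARD('n)) * ennreal (a ^ CARD('n)) = 1"
    using a by (simp flip: ennreal_mult)
  ultimately show ?thesis by (simp flip: mult.assoc)
qed

lemma AE_diag_scale:
  assumes "AE x in lborel. P x" and d: "\<And>j. 0 < (d :: real ^ 'n) $ j"
  shows "AE x in lborel. P (d * x)"
proof -
  from AE_E[OF assms(1)] obtain N where N: "{x \<in> space lborel. \<not> P x} \<subseteq> N" "emeasure lborel N = 0" "N \<in> sets lborel" .
  have [measurable]: "N \<in> sets borel" using N by simp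
  have "ennreal (\<Prod>j\<in>UNIV. d $ j) * (\<integral>\<^sup>+x. indicator N (d * x) \<partial>lborel) = 0"
    using nn_integral_diag_scale[of "indicator N" d] d N by simp
  moreover have "(\<Prod>j\<in>UNIV. d $ j) > 0" using d by (intro prod_pos) auto
  ultimately have "(\<integral>\<^sup>+x. indicator N (d * x) \<partial>lborel) = 0"
    by (metis ennreal_eq_0_iff mult_eq_0_iff not_le)
  then have "AE x in lborel. indicator N (d * x) = (0 :: ennreal)"
    by (subst (asm) nn_integral_0_iff_AE) simp_all
  then show ?thesis
    by eventually_elim (use N(1) in \<open>auto simp: indicator_def split: if_splits\<close>)
qed

text \<open>For positive \<open>M\<close> this is the retraction onto the closed ball of radius
  \<open>M\<close> along rays from 0. It truncates vector-valued functions and keeps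
  continuity.\<close>

definition radial_clamp :: "real \<Rightarrow> 'a::real_normed_vector \<Rightarrow> 'a" where
  "radial_clamp M v = v /\<^sub>R max 1 (norm v / M)"

lemma continuous_radial_clamp: "continuous_on S (radial_clamp M)"
  unfolding radial_clamp_def by (cases "M = 0") (auto intro!: continuous_intros)

lemma norm_radial_clamp_le:
  assumes "0 < M" shows "norm (radial_clamp M v) \<le> M" "norm (radial_clamp M v) \<le> norm v"
proof -
  have "norm v \<le> M * max 1 (norm v / M)" using assms by (simp add: max_def field_simps)
  then show "norm (radial_clamp M v) \<le> M" 
    unfolding radial_clamp_def by (simp add: divide_inverse[symmetric] field_simps abs_if max_def split: if_splits)
  show "norm (radial_clamp M v) \<le> norm v"
    unfolding radial_clamp_def by (simp add: mult_left_le_one_le inverse_le_1_iff)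
qed

lemma radial_clamp_eq: "norm v \<le> M \<Longrightarrow> radial_clamp M v = v"
proof -
  assume v: "norm v \<le> M"
  then have "norm v / M \<le> 1" by (cases "M = 0") (auto simp: divide_le_eq_1 dest: order_trans[OF norm_ge_zero])
  then show ?thesis unfolding radial_clamp_def by (simp add: max_def)
qed

text \<open>Two dominated convergences: clamping \<open>k\<close> at a large height \<open>M\<close>
  costs little, and the clamped continuous functions \<open>g n\<close> converge to the clamped
  \<open>k\<close> almost everywhere with the common bound \<open>M\<close>. That bound is
  integrable on balls only, so the approximation is local.\<close>

lemma integrable_approx_continuous:
  fixes k :: "'a::euclidean_space \<Rightarrow> 'b::euclidean_space"
  assumes k: "integrable lborel k" and \<eta>: "0 < \<eta>"
  obtains g where "continuous_on UNIV g" "(\<integral>\<^sup>+x\<in>cball 0 R. ennreal (norm (k x - g x)) \<partial>lborel) \<le> ennreal \<eta>"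
proof -
  have [measurable]: "k \<in> borel_measurable borel" using k by auto
  have [measurable]: "radial_clamp M \<in> borel_measurable borel" for M :: real
    by (rule borel_measurable_continuous_onI[OF continuous_radial_clamp])
  have "(\<lambda>i. \<integral>\<^sup>+x. norm (k x - radial_clamp (real (Suc i)) (k x)) \<partial>lborel) \<longlonglongrightarrow> 0"
  proof (rule nn_integral_dominated_convergence_norm)
    show "AE x in lborel. norm (radial_clamp (real (Suc j)) (k x)) \<le> norm (k x)" for j
      by (simp add: norm_radial_clamp_le)
    show "(\<integral>\<^sup>+x. ennreal (norm (k x)) \<partial>lborel) < \<infinity>" using k by (simp add: integrable_iff_bounded)
    have "(\<lambda>i. radial_clamp (real (Suc i)) (k x)) \<longlonglongrightarrow> k x" for x
    proof (rule tendsto_eventually)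
      obtain m where "norm (k x) \<le> real m" using real_arch_simple by blast
      then show "\<forall>\<^sub>F i in sequentially. radial_clamp (real (Suc i)) (k x) = k x"
        by (intro eventually_sequentiallyI[of m] radial_clamp_eq) auto
    qed
    then show "AE x in lborel. (\<lambda>i. radial_clamp (real (Suc i)) (k x)) \<longlonglongrightarrow> k x" by simp
  qed simp_all
  moreover have "0 < ennreal (\<eta> / 2)" using \<eta> by simp
  ultimately have "\<forall>\<^sub>F i in sequentially. (\<integral>\<^sup>+x. norm (k x - radial_clamp (real (Suc i)) (k x)) \<partial>lborel) < ennreal (\<eta> / 2)"
    by (rule order_tendstoD(2))
  then obtain i where i: "(\<integral>\<^sup>+x. norm (k x - radial_clamp (real (Suc i)) (k x)) \<partial>lborel) < ennreal (\<eta> / 2)"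
    by (auto simp: eventually_sequentially)
  define M where "M = real (Suc i)"
  have M: "0 < M" by (simp add: M_def)
  have "k measurable_on UNIV"
    by (intro lebesgue_measurable_imp_measurable_on) (simp_all add: measurable_completion)
  then obtain N g where N: "negligible N" and g: "\<And>n. continuous_on UNIV (g n)"
    and lim: "\<And>x. x \<notin> N \<Longrightarrow> (\<lambda>n. g n x) \<longlonglongrightarrow> k x"
    unfolding measurable_on_def by auto
  have [measurable]: "g n \<in> borel_measurable borel" for n by (rule borel_measurable_continuous_onI[OF g])
  have "AE x in lebesgue. x \<notin> N" using N by (simp add: negligible_iff_null_sets AE_not_in)
  then have AE_N: "AE x in lborel. x \<notin> N" by (simp add: AE_completion_iff)
  let ?B = "cball 0 R :: 'a set"
  have [measurable]: "?B \<in> sets borel" by simp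
  have "(\<lambda>n. \<integral>\<^sup>+x. norm (indicator ?B x *\<^sub>R radial_clamp M (k x) - indicator ?B x *\<^sub>R radial_clamp M (g n x)) \<partial>lborel) \<longlonglongrightarrow> 0"
  proof (rule nn_integral_dominated_convergence_norm)
    show "AE x in lborel. norm (indicator ?B x *\<^sub>R radial_clamp M (g j x)) \<le> M * indicator ?B x" for j
      using M by (auto simp: indicator_def norm_radial_clamp_le)
    have "(\<integral>\<^sup>+x. ennreal (M * indicator ?B x) \<partial>lborel) = ennreal M * emeasure lborel ?B"
      using M by (subst nn_integral_cmult_indicator[symmetric]) (auto simp: indicator_def intro!: nn_integral_cong)
    then show "(\<integral>\<^sup>+x. ennreal (M * indicator ?B x) \<partial>lborel) < \<infinity>"
      using emeasure_lborel_cball_finite[of "0 :: 'a" R] by (simp add: ennreal_mult_less_top)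
    show "AE x in lborel. (\<lambda>n. indicator ?B x *\<^sub>R radial_clamp M (g n x)) \<longlonglongrightarrow> indicator ?B x *\<^sub>R radial_clamp M (k x)"
      using AE_N
    proof eventually_elim
      case (elim x)
      have "isCont (radial_clamp M) (k x)"
        using continuous_radial_clamp[of "UNIV :: 'b set" M] by (simp add: continuous_on_eq_continuous_at)
      then have "(\<lambda>n. radial_clamp M (g n x)) \<longlonglongrightarrow> radial_clamp M (k x)"
        using isCont_tendsto_compose lim[OF elim] by blast
      then show ?case by (intro tendsto_intros)
    qed
  qed simp_all
  from order_tendstoD(2)[OF this \<open>0 < ennreal (\<eta> / 2)\<close>]
  obtain n where n: "(\<integral>\<^sup>+x. norm (indicator ?B x *\<^sub>R radial_clamp M (k x) - indicator ?B x *\<^sub>R radial_clamp M (g n x)) \<partial>lborel) < ennreal (\<eta> / 2)"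
    by (auto simp: eventually_sequentially)
  have "(\<integral>\<^sup>+x\<in>?B. ennreal (norm (k x - radial_clamp M (g n x))) \<partial>lborel)
    \<le> (\<integral>\<^sup>+x. ennreal (norm (k x - radial_clamp M (k x)))
        + ennreal (norm (indicator ?B x *\<^sub>R radial_clamp M (k x) - indicator ?B x *\<^sub>R radial_clamp M (g n x))) \<partial>lborel)"
  proof (rule nn_integral_mono)
    fix x
    have "norm (k x - radial_clamp M (g n x)) \<le> norm (k x - radial_clamp M (k x)) + norm (radial_clamp M (k x) - radial_clamp M (g n x))"
      using norm_triangle_ineq[of "k x - radial_clamp M (k x)" "radial_clamp M (k x) - radial_clamp M (g n x)"] by simp
    then show "ennreal (norm (k x - radial_clamp M (g n x))) * indicator ?B x
      \<le> ennreal (norm (k x - radial_clamp M (k x)))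
        + ennreal (norm (indicator ?B x *\<^sub>R radial_clamp M (k x) - indicator ?B x *\<^sub>R radial_clamp M (g n x)))"
      by (auto simp: indicator_def simp flip: ennreal_plus)
  qed
  also have "\<dots> = (\<integral>\<^sup>+x. norm (k x - radial_clamp M (k x)) \<partial>lborel)
    + (\<integral>\<^sup>+x. norm (indicator ?B x *\<^sub>R radial_clamp M (k x) - indicator ?B x *\<^sub>R radial_clamp M (g n x)) \<partial>lborel)"
    by (rule nn_integral_add) simp_all
  also have "\<dots> \<le> ennreal (\<eta> / 2) + ennreal (\<eta> / 2)"
    using i n unfolding M_def by (intro add_mono) auto
  also have "\<dots> = ennreal \<eta>" using \<eta> by (simp flip: ennreal_plus)
  finally have "(\<integral>\<^sup>+x\<in>?B. ennreal (norm (k x - radial_clamp M (g n x))) \<partial>lborel) \<le> ennreal \<eta>" .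
  moreover have "continuous_on UNIV (\<lambda>x. radial_clamp M (g n x))"
    by (rule continuous_on_compose2[OF continuous_radial_clamp[of UNIV] g]) simp
  ultimately show thesis using that by blast
qed

lemma norm_diag_scale_le:
  fixes c x :: "real ^ 'n"
  assumes "\<And>j. \<bar>c $ j\<bar> \<le> b" shows "norm (c * x) \<le> b * norm x"
proof -
  have "0 \<le> b" using assms[of undefined] by linarith
  then have "norm (c * x) \<le> norm (b *\<^sub>R x)"
    using assms by (intro norm_le_componentwise_cart) (auto simp: abs_mult intro!: mult_right_mono)
  then show ?thesis using \<open>0 \<le> b\<close> by simp
qed

text \<open>For a continuous function in place of \<open>k\<close> this is uniform continuity on a
  ball containing all dilated copies of \<Omega>; the cost of the replacement is bounded uniformly
  in the dilation. A single \<delta> therefore works for all pairs of dilations with entries between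
  \<open>a\<close> and \<open>b\<close>.\<close>

lemma L1_continuous_diag_scale:
  fixes k :: "real ^ 'n \<Rightarrow> 'b::euclidean_space"
  assumes k: "integrable lborel k" and a: "0 < a" and \<Omega>: "bounded \<Omega>" "\<Omega> \<in> sets borel" and \<epsilon>: "0 < \<epsilon>"
  obtains \<delta> where "0 < \<delta>" "\<And>c d. (\<And>j. a \<le> c $ j \<and> c $ j \<le> b \<and> a \<le> d $ j \<and> d $ j \<le> b \<and> \<bar>c $ j - d $ j\<bar> \<le> \<delta>) \<Longrightarrow>
    (\<integral>\<^sup>+x\<in>\<Omega>. ennreal (norm (k (c * x) - k (d * x))) \<partial>lborel) \<le> ennreal \<epsilon>"
proof -
  have [measurable]: "k \<in> borel_measurable borel" "\<Omega> \<in> sets borel" using k \<Omega> by auto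
  obtain r where r: "0 < r" "\<And>x. x \<in> \<Omega> \<Longrightarrow> norm x \<le> r" using \<Omega>(1) bounded_pos by metis
  define R where "R = \<bar>b\<bar> * r"
  define V where "V = measure lborel (cball (0 :: real ^ 'n) r)"
  have V: "0 \<le> V" by (simp add: V_def)
  have emV: "emeasure lborel (cball (0 :: real ^ 'n) r) = ennreal V"
    unfolding V_def using emeasure_lborel_cball_finite[of "0 :: real ^ 'n" r]
    by (intro emeasure_eq_ennreal_measure) (simp add: less_top)
  have an: "0 < a ^ CARD('n)" using a by simp
  \<comment> \<open>A dilation with entries at least \<open>a\<close> enlarges an integral at most
    by the factor \<open>1 / a ^ CARD('n)\<close>. The tolerance compensates for it, so that the
    errors at \<open>c\<close> and at \<open>d\<close> are at most \<epsilon> / 3 each.\<close>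
  obtain g where g: "continuous_on UNIV g" and
    gk: "(\<integral>\<^sup>+x\<in>cball 0 R. ennreal (norm (k x - g x)) \<partial>lborel) \<le> ennreal (\<epsilon> * a ^ CARD('n) / 3)"
    by (rule integrable_approx_continuous[OF k, of "\<epsilon> * a ^ CARD('n) / 3" R]) (use \<epsilon> an in auto)
  have [measurable]: "g \<in> borel_measurable borel" by (rule borel_measurable_continuous_onI[OF g])
  \<comment> \<open>The remaining third: \<epsilon>1 times the volume \<open>V\<close> of a ball
    that contains \<Omega>. The 1 in \<open>V + 1\<close> keeps the denominator positive.\<close>
  define \<epsilon>1 where "\<epsilon>1 = \<epsilon> / (3 * (V + 1))"
  have \<epsilon>1: "0 < \<epsilon>1" using \<epsilon> V by (simp add: \<epsilon>1_def)
  have "uniformly_continuous_on (cball 0 R) g"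
    using g by (intro compact_uniformly_continuous) (auto intro: continuous_on_subset)
  then obtain \<delta>0 where \<delta>0: "0 < \<delta>0" "\<And>x y. x \<in> cball 0 R \<Longrightarrow> y \<in> cball 0 R \<Longrightarrow> dist y x < \<delta>0 \<Longrightarrow> dist (g y) (g x) < \<epsilon>1"
    using \<epsilon>1 unfolding uniformly_continuous_on_def by metis
  define G where "G y = ennreal (norm (k y - g y)) * indicator (cball 0 R) y" for y
  have [measurable]: "cball (0 :: real ^ 'n) t \<in> sets borel" for t by simp
  have [measurable]: "G \<in> borel_measurable borel" unfolding G_def by measurable
  have G: "(\<integral>\<^sup>+x. G (c * x) \<partial>lborel) \<le> ennreal (\<epsilon> / 3)" if "\<And>j. a \<le> c $ j" for c :: "real ^ 'n"
  proof -
    have "(\<integral>\<^sup>+x. G (c * x) \<partial>lborel) \<le> ennreal (1 / a ^ CARD('n)) * (\<integral>\<^sup>+x. G x \<partial>lborel)"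
      by (rule nn_integral_diag_scale_le[OF _ a that]) simp
    also have "\<dots> \<le> ennreal (1 / a ^ CARD('n)) * ennreal (\<epsilon> * a ^ CARD('n) / 3)"
      using gk unfolding G_def by (intro mult_left_mono) auto
    also have "\<dots> = ennreal (\<epsilon> / 3)"
      using an a \<epsilon> by (simp flip: ennreal_mult)
    finally show ?thesis .
  qed
  show thesis
  \<comment> \<open>\<open>r + 1\<close> instead of \<open>r\<close> makes the distance between
    \<open>c * x\<close> and \<open>d * x\<close> strictly smaller than \<delta>0.\<close>
  proof (rule that[of "\<delta>0 / (r + 1)"])
    show "0 < \<delta>0 / (r + 1)" using \<delta>0 r by simp
    fix c d :: "real ^ 'n"
    assume "\<And>j. a \<le> c $ j \<and> c $ j \<le> b \<and> a \<le> d $ j \<and> d $ j \<le> b \<and> \<bar>c $ j - d $ j\<bar> \<le> \<delta>0 / (r + 1)"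
    then have cd: "a \<le> c $ j" "c $ j \<le> b" "a \<le> d $ j" "d $ j \<le> b" "\<bar>c $ j - d $ j\<bar> \<le> \<delta>0 / (r + 1)" for j
      by blast+
    have cabs: "\<bar>c $ j\<bar> \<le> \<bar>b\<bar>" "\<bar>d $ j\<bar> \<le> \<bar>b\<bar>" for j using cd[of j] a by auto
    have "(\<integral>\<^sup>+x\<in>\<Omega>. ennreal (norm (k (c * x) - k (d * x))) \<partial>lborel)
      \<le> (\<integral>\<^sup>+x. G (c * x) + G (d * x) + ennreal \<epsilon>1 * indicator (cball 0 r) x \<partial>lborel)"
    proof (rule nn_integral_mono)
      fix x
      show "ennreal (norm (k (c * x) - k (d * x))) * indicator \<Omega> x
        \<le> G (c * x) + G (d * x) + ennreal \<epsilon>1 * indicator (cball 0 r) x"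
      proof (cases "x \<in> \<Omega>")
        case True
        have in_ball: "c * x \<in> cball 0 R" "d * x \<in> cball 0 R"
          using norm_diag_scale_le[OF cabs(1), of x] norm_diag_scale_le[OF cabs(2), of x]
            mult_left_mono[OF r(2)[OF True] abs_ge_zero[of b]] unfolding R_def by auto
        have "dist (c * x) (d * x) = norm ((c - d) * x)" by (simp add: dist_norm left_diff_distrib)
        also have "\<dots> \<le> \<delta>0 / (r + 1) * norm x" by (rule norm_diag_scale_le) (use cd in auto)
        also have "\<dots> \<le> \<delta>0 / (r + 1) * r" using r \<delta>0 True by (intro mult_left_mono) auto
        also have "\<dots> < \<delta>0" using r \<delta>0 by (simp add: field_simps)
        finally have "dist (g (c * x)) (g (d * x)) < \<epsilon>1" using \<delta>0(2) in_ball by blast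
        then have "norm (k (c * x) - k (d * x)) \<le> norm (k (c * x) - g (c * x)) + norm (k (d * x) - g (d * x)) + \<epsilon>1"
          using norm_triangle_ineq[of "(k (c * x) - g (c * x)) - (k (d * x) - g (d * x))" "g (c * x) - g (d * x)"]
            norm_triangle_ineq4[of "k (c * x) - g (c * x)" "k (d * x) - g (d * x)"]
          by (simp add: dist_norm)
        then show ?thesis
          using True in_ball r \<epsilon>1 unfolding G_def
          by (auto simp: ennreal_leI simp flip: ennreal_plus)
      qed simp
    qed
    also have "\<dots> = (\<integral>\<^sup>+x. G (c * x) \<partial>lborel) + (\<integral>\<^sup>+x. G (d * x) \<partial>lborel) + (\<integral>\<^sup>+x. ennreal \<epsilon>1 * indicator (cball (0 :: real ^ 'n) r) x \<partial>lborel)"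
      by (simp add: nn_integral_add)
    also have "(\<integral>\<^sup>+x. ennreal \<epsilon>1 * indicator (cball (0 :: real ^ 'n) r) x \<partial>lborel) = ennreal (\<epsilon>1 * V)"
      using \<epsilon>1 V by (simp add: nn_integral_cmult_indicator emV ennreal_mult)
    also have "(\<integral>\<^sup>+x. G (c * x) \<partial>lborel) + (\<integral>\<^sup>+x. G (d * x) \<partial>lborel) + ennreal (\<epsilon>1 * V) \<le> ennreal (\<epsilon> / 3) + ennreal (\<epsilon> / 3) + ennreal (\<epsilon> / 3)"
    proof (intro add_mono G cd ennreal_leI)
      show "\<epsilon>1 * V \<le> \<epsilon> / 3" unfolding \<epsilon>1_def using V \<epsilon> by (simp add: field_simps)
    qed
    also have "\<dots> = ennreal \<epsilon>" using \<epsilon> by (simp flip: ennreal_plus)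
    finally show "(\<integral>\<^sup>+x\<in>\<Omega>. ennreal (norm (k (c * x) - k (d * x))) \<partial>lborel) \<le> ennreal \<epsilon>" .
  qed
qed

section \<open>Increments along rays\<close>

lemma set_integral_stretch:
  fixes K :: "real \<Rightarrow> 'b::euclidean_space"
  assumes \<xi>: "\<xi> \<noteq> 0" and XY: "\<And>s. \<xi> * s \<in> X \<longleftrightarrow> s \<in> Y" and K: "set_integrable lborel X K"
  shows "set_integrable lborel Y (\<lambda>s. K (\<xi> * s))"
    and "(LINT s:X|lborel. K s) = \<bar>\<xi>\<bar> *\<^sub>R (LINT s:Y|lborel. K (\<xi> * s))"
proof -
  have ind: "indicator X (\<xi> * s) = (indicator Y s :: real)" for s using XY by (simp add: indicator_def)
  show "set_integrable lborel Y (\<lambda>s. K (\<xi> * s))"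
    using lborel_integrable_real_affine[OF K[unfolded set_integrable_def] \<xi>, of 0]
    unfolding set_integrable_def by (simp only: ind add_0)
  show "(LINT s:X|lborel. K s) = \<bar>\<xi>\<bar> *\<^sub>R (LINT s:Y|lborel. K (\<xi> * s))"
    unfolding set_lebesgue_integral_def
    by (subst lborel_integral_real_affine[OF \<xi>, of _ 0]) (simp only: ind add_0)
qed

lemma coord_upd_times: "coord_upd d i s * x = coord_upd (d * x) i (s * x $ i)"
  by (simp add: vec_eq_iff)

lemma vec_times: "vec s * x = s *\<^sub>R (x :: real ^ 'n)"
  by (simp add: vec_eq_iff)

text \<open>The conclusion of \<open>ACL_on_line_integral\<close> as a predicate, so that the
  comparison with rays can be made without reference to ACL or to derivatives.\<close>

definition line_integral_on :: "real ^ 'n \<Rightarrow> real ^ 'n \<Rightarrow> 'n \<Rightarrow> (real ^ 'n \<Rightarrow> 'b::euclidean_space) \<Rightarrow> (real ^ 'n \<Rightarrow> 'b) \<Rightarrow> bool" where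
  "line_integral_on p q i f h \<longleftrightarrow>
     (AE x in lborel. (\<forall>j. j \<noteq> i \<longrightarrow> p $ j \<le> x $ j \<and> x $ j \<le> q $ j) \<longrightarrow>
      (\<forall>s1 s2. p $ i \<le> s1 \<longrightarrow> s1 \<le> s2 \<longrightarrow> s2 \<le> q $ i \<longrightarrow>
        set_integrable lborel {s1..s2} (\<lambda>s. h (coord_upd x i s)) \<and>
        f (coord_upd x i s2) - f (coord_upd x i s1) = (LINT s:{s1..s2}|lborel. h (coord_upd x i s))))"

text \<open>Substituting s times \<open>x $ i\<close> for the line parameter describes a segment in
  direction \<open>i\<close> by the dilation factor of that coordinate, the same parameter that runs
  along the ray. The null set of bad base points is pulled back by the dilation
  \<open>d\<close>.\<close>

lemma AE_scaled_line_integral: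
  fixes f h :: "real ^ 'n \<Rightarrow> 'b::euclidean_space"
  assumes line: "line_integral_on p q i f h"
    and c: "0 < c" "c \<le> c'" and d: "\<And>j. c \<le> d $ j \<and> d $ j \<le> c'"
  shows "AE x in lborel. (\<forall>j. \<forall>s\<in>{c..c'}. p $ j \<le> s * x $ j \<and> s * x $ j \<le> q $ j) \<longrightarrow>
    set_integrable lborel {c..c'} (\<lambda>s. x $ i *\<^sub>R h (coord_upd d i s * x)) \<and>
    f (coord_upd d i c' * x) - f (coord_upd d i c * x)
      = (LINT s:{c..c'}|lborel. x $ i *\<^sub>R h (coord_upd d i s * x))"
proof -
  have "0 < d $ j" for j using c d[of j] by linarith
  from AE_diag_scale[OF line[unfolded line_integral_on_def] this] show ?thesis
  proof eventually_elim
    case (elim x)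
    show ?case
    proof
      assume box: "\<forall>j. \<forall>s\<in>{c..c'}. p $ j \<le> s * x $ j \<and> s * x $ j \<le> q $ j"
      let ?\<xi> = "x $ i"
      let ?K = "\<lambda>s. h (coord_upd (d * x) i s)"
      have line': "set_integrable lborel {s1..s2} ?K \<and>
        f (coord_upd (d * x) i s2) - f (coord_upd (d * x) i s1) = (LINT s:{s1..s2}|lborel. ?K s)"
        if "p $ i \<le> s1" "s1 \<le> s2" "s2 \<le> q $ i" for s1 s2
        using elim box d that by auto
      have K: "?K (?\<xi> * s) = h (coord_upd d i s * x)" for s by (simp only: coord_upd_times mult.commute[of s])
      \<comment> \<open>For negative \<open>x $ i\<close> the substitution reverses the interval,
        and the two changes of sign cancel; for \<open>x $ i\<close> = 0 both sides vanish.\<close>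
      consider "?\<xi> = 0" | "?\<xi> > 0" | "?\<xi> < 0" by linarith
      then show "set_integrable lborel {c..c'} (\<lambda>s. ?\<xi> *\<^sub>R h (coord_upd d i s * x)) \<and>
        f (coord_upd d i c' * x) - f (coord_upd d i c * x)
          = (LINT s:{c..c'}|lborel. ?\<xi> *\<^sub>R h (coord_upd d i s * x))"
      proof cases
        case 1
        then show ?thesis
          by (simp add: coord_upd_times set_integrable_def set_lebesgue_integral_def)
      next
        case 2
        have L: "set_integrable lborel {c * ?\<xi>..c' * ?\<xi>} ?K"
          "f (coord_upd (d * x) i (c' * ?\<xi>)) - f (coord_upd (d * x) i (c * ?\<xi>)) = (LINT s:{c * ?\<xi>..c' * ?\<xi>}|lborel. ?K s)"
          using line'[of "c * ?\<xi>" "c' * ?\<xi>"] box c 2 by auto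
        have mem: "?\<xi> * s \<in> {c * ?\<xi>..c' * ?\<xi>} \<longleftrightarrow> s \<in> {c..c'}" for s using 2 by (simp add: mult.commute)
        have "set_integrable lborel {c..c'} (\<lambda>s. ?K (?\<xi> * s))"
          by (rule set_integral_stretch(1)[OF _ mem L(1)]) (use 2 in simp)
        moreover have "(LINT s:{c * ?\<xi>..c' * ?\<xi>}|lborel. ?K s) = ?\<xi> *\<^sub>R (LINT s:{c..c'}|lborel. ?K (?\<xi> * s))"
          using set_integral_stretch(2)[OF _ mem L(1)] 2 by simp
        ultimately show ?thesis
          using L(2) unfolding K by (simp add: coord_upd_times)
      next
        case 3
        have L: "set_integrable lborel {c' * ?\<xi>..c * ?\<xi>} ?K"
          "f (coord_upd (d * x) i (c * ?\<xi>)) - f (coord_upd (d * x) i (c' * ?\<xi>)) = (LINT s:{c' * ?\<xi>..c * ?\<xi>}|lborel. ?K s)"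
          using line'[of "c' * ?\<xi>" "c * ?\<xi>"] box c 3 by auto
        have mem: "?\<xi> * s \<in> {c' * ?\<xi>..c * ?\<xi>} \<longleftrightarrow> s \<in> {c..c'}" for s using 3 by (auto simp: mult.commute)
        have "set_integrable lborel {c..c'} (\<lambda>s. ?K (?\<xi> * s))"
          by (rule set_integral_stretch(1)[OF _ mem L(1)]) (use 3 in simp)
        moreover have "(LINT s:{c' * ?\<xi>..c * ?\<xi>}|lborel. ?K s) = - (?\<xi> *\<^sub>R (LINT s:{c..c'}|lborel. ?K (?\<xi> * s)))"
          using set_integral_stretch(2)[OF _ mem L(1)] 3 by simp
        ultimately show ?thesis
          using L(2) unfolding K by (simp add: coord_upd_times) (metis minus_diff_eq minus_minus)
      qed
    qed
  qed
qed

text \<open>By Fubini the integral over all rays is an integral of dilated integrals, and for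
  factors between \<open>a\<close> and \<open>b\<close> each of these is at most a fixed multiple of
  the integral of \<open>g\<close>.\<close>

lemma AE_nn_integral_ray_finite:
  fixes g :: "real ^ 'n \<Rightarrow> ennreal"
  assumes [measurable]: "g \<in> borel_measurable borel" and fin: "(\<integral>\<^sup>+x. g x \<partial>lborel) < \<infinity>" and a: "0 < a" "a \<le> b"
  shows "AE x in lborel. (\<integral>\<^sup>+s\<in>{a..b}. g (s *\<^sub>R x) \<partial>lborel) \<noteq> \<infinity>"
proof (rule nn_integral_PInf_AE)
  have "(\<integral>\<^sup>+x. (\<integral>\<^sup>+s\<in>{a..b}. g (s *\<^sub>R x) \<partial>lborel) \<partial>lborel)
      = (\<integral>\<^sup>+s. (\<integral>\<^sup>+x. g (s *\<^sub>R x) * indicator {a..b} s \<partial>lborel) \<partial>lborel)"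
    by (rule lborel_pair.Fubini') measurable
  also have "\<dots> \<le> (\<integral>\<^sup>+s. ennreal (1 / a ^ CARD('n)) * (\<integral>\<^sup>+x. g x \<partial>lborel) * indicator {a..b} s \<partial>lborel)"
  proof (rule nn_integral_mono)
    fix s :: real
    have "(\<integral>\<^sup>+x. g (s *\<^sub>R x) \<partial>lborel) \<le> ennreal (1 / a ^ CARD('n)) * (\<integral>\<^sup>+x. g x \<partial>lborel)" if "s \<in> {a..b}"
      using nn_integral_diag_scale_le[of g a "vec s"] that a by (simp add: vec_times)
    then show "(\<integral>\<^sup>+x. g (s *\<^sub>R x) * indicator {a..b} s \<partial>lborel)
        \<le> ennreal (1 / a ^ CARD('n)) * (\<integral>\<^sup>+x. g x \<partial>lborel) * indicator {a..b} s"
      by (auto simp: indicator_def)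
  qed
  also have "\<dots> = ennreal (1 / a ^ CARD('n)) * (\<integral>\<^sup>+x. g x \<partial>lborel) * ennreal (b - a)"
    using a by (simp add: nn_integral_cmult_indicator)
  also have "\<dots> < \<infinity>" using fin by (simp add: ennreal_mult_less_top)
  finally show "(\<integral>\<^sup>+x. (\<integral>\<^sup>+s\<in>{a..b}. g (s *\<^sub>R x) \<partial>lborel) \<partial>lborel) \<noteq> \<infinity>" by simp
qed measurable

lemma borel_measurable_nth [measurable]:
  fixes f :: "'a \<Rightarrow> real ^ 'n"
  assumes "f \<in> borel_measurable M"
  shows "(\<lambda>x. f x $ i) \<in> borel_measurable M"
  by (rule borel_measurable_continuous_on[OF _ assms]) (intro continuous_intros)

text \<open>With \<open>h\<close> the i-th partial derivative of a map f, the sum of these over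
  \<open>i\<close> is the integral of the chain-rule derivative of f(\<tau> x) from s to t.\<close>

definition ray_integral :: "(real ^ 'n \<Rightarrow> 'b::euclidean_space) \<Rightarrow> 'n \<Rightarrow> real \<Rightarrow> real \<Rightarrow> real ^ 'n \<Rightarrow> 'b" where
  "ray_integral h i s t x = (LINT \<tau>:{s..t}|lborel. x $ i *\<^sub>R h (\<tau> *\<^sub>R x))"

lemma borel_measurable_ray_integral [measurable]:
  assumes [measurable]: "h \<in> borel_measurable borel"
  shows "ray_integral h i s t \<in> borel_measurable borel"
  unfolding ray_integral_def set_lebesgue_integral_def by measurable

lemma AE_ray_integrable:
  fixes h :: "real ^ 'n \<Rightarrow> 'b::euclidean_space"
  assumes h: "integrable lborel h" and a: "0 < a" "a \<le> b"
  shows "AE x in lborel. set_integrable lborel {a..b} (\<lambda>\<tau>. x $ i *\<^sub>R h (\<tau> *\<^sub>R x))"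
proof -
  have [measurable]: "h \<in> borel_measurable borel" using h by auto
  have "(\<integral>\<^sup>+x. ennreal (norm (h x)) \<partial>lborel) < \<infinity>" using h by (simp add: integrable_iff_bounded)
  from AE_nn_integral_ray_finite[OF _ this a]
  have "AE x in lborel. (\<integral>\<^sup>+s\<in>{a..b}. ennreal (norm (h (s *\<^sub>R x))) \<partial>lborel) \<noteq> \<infinity>" by simp
  then show ?thesis
  proof eventually_elim
    case (elim x)
    have "(\<integral>\<^sup>+s. ennreal (norm (indicator {a..b} s *\<^sub>R h (s *\<^sub>R x))) \<partial>lborel)
        = (\<integral>\<^sup>+s\<in>{a..b}. ennreal (norm (h (s *\<^sub>R x))) \<partial>lborel)"
      by (intro nn_integral_cong) (auto simp: indicator_def)
    then have "set_integrable lborel {a..b} (\<lambda>\<tau>. h (\<tau> *\<^sub>R x))"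
      using elim unfolding set_integrable_def by (simp add: integrable_iff_bounded less_top)
    then show ?case by (rule set_integrable_scaleR_right)
  qed
qed

lemma ray_integral_combine:
  assumes int: "set_integrable lborel {a..b} (\<lambda>\<tau>. x $ i *\<^sub>R h (\<tau> *\<^sub>R x))"
    and "a \<le> s" "s \<le> t" "t \<le> u" "u \<le> b"
  shows "ray_integral h i s u x = ray_integral h i s t x + ray_integral h i t u x"
proof -
  have sub: "set_integrable lborel {v..w} (\<lambda>\<tau>. x $ i *\<^sub>R h (\<tau> *\<^sub>R x))" if "a \<le> v" "w \<le> b" for v w
    by (rule set_integrable_subset[OF int]) (use that in auto)
  have eq: "ray_integral h i v w x = integral {v..w} (\<lambda>\<tau>. x $ i *\<^sub>R h (\<tau> *\<^sub>R x))"
    "(\<lambda>\<tau>. x $ i *\<^sub>R h (\<tau> *\<^sub>R x)) integrable_on {v..w}" if "a \<le> v" "w \<le> b" for v w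
    using set_borel_integral_eq_integral[OF sub[OF that]] unfolding ray_integral_def by auto
  have le: "a \<le> t" "t \<le> b" using assms by auto
  have "integral {s..t} (\<lambda>\<tau>. x $ i *\<^sub>R h (\<tau> *\<^sub>R x)) + integral {t..u} (\<lambda>\<tau>. x $ i *\<^sub>R h (\<tau> *\<^sub>R x))
      = integral {s..u} (\<lambda>\<tau>. x $ i *\<^sub>R h (\<tau> *\<^sub>R x))"
    by (rule Henstock_Kurzweil_Integration.integral_combine) (use assms eq(2) in auto)
  then show ?thesis
    unfolding eq(1)[OF assms(2) assms(5)] eq(1)[OF assms(2) le(2)] eq(1)[OF le(1) assms(5)] by (rule sym)
qed

text \<open>From c x to c' x one coordinate is moved at a time. Each move is an integral of the partial
  derivative at points close to the ray, and in the mean over x the error is controlled by the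
  continuity of dilations in L1.\<close>

lemma staircase_step:
  fixes f :: "real ^ 'n \<Rightarrow> 'b::euclidean_space" and h :: "'n \<Rightarrow> real ^ 'n \<Rightarrow> 'b"
  assumes f[measurable]: "f \<in> borel_measurable borel" and h: "\<And>i. integrable lborel (h i)"
    and line: "\<And>i. line_integral_on p q i f (h i)"
    and a: "0 < a" and \<Omega>: "bounded \<Omega>" "\<Omega> \<in> sets borel"
    and box: "\<And>x s j. x \<in> \<Omega> \<Longrightarrow> a \<le> s \<Longrightarrow> s \<le> b \<Longrightarrow> p $ j \<le> s * x $ j \<and> s * x $ j \<le> q $ j"
    and E: "0 < E"
  obtains \<delta> where "0 < \<delta>" "\<And>c c'. a \<le> c \<Longrightarrow> c \<le> c' \<Longrightarrow> c' \<le> b \<Longrightarrow> c' - c \<le> \<delta> \<Longrightarrow>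
    (\<integral>\<^sup>+x\<in>\<Omega>. ennreal (norm (f (c' *\<^sub>R x) - f (c *\<^sub>R x) - (\<Sum>i\<in>UNIV. ray_integral (h i) i c c' x))) \<partial>lborel)
      \<le> ennreal ((c' - c) * E)"
proof -
  have [measurable]: "h i \<in> borel_measurable borel" "\<Omega> \<in> sets borel" for i using h \<Omega> by auto
  obtain r where r: "0 < r" "\<And>x. x \<in> \<Omega> \<Longrightarrow> norm x \<le> r" using \<Omega>(1) bounded_pos by metis
  define N where "N = real CARD('n)"
  have N: "0 < N" by (simp add: N_def)
  \<comment> \<open>A single move costs at most \<open>r\<close> times \<epsilon> times
    \<open>c' - c\<close>, because \<open>x $ i\<close> is bounded by \<open>r\<close>, and there
    are \<open>N\<close> moves.\<close>
  define \<epsilon> where "\<epsilon> = E / (N * r)"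
  have \<epsilon>: "0 < \<epsilon>" using E N r by (simp add: \<epsilon>_def)
  have "\<forall>i. \<exists>\<delta>. 0 < \<delta> \<and> (\<forall>c d. (\<forall>j. a \<le> c $ j \<and> c $ j \<le> b \<and> a \<le> d $ j \<and> d $ j \<le> b \<and> \<bar>c $ j - d $ j\<bar> \<le> \<delta>) \<longrightarrow>
    (\<integral>\<^sup>+x\<in>\<Omega>. ennreal (norm (h i (c * x) - h i (d * x))) \<partial>lborel) \<le> ennreal \<epsilon>)"
    by (rule allI, rule L1_continuous_diag_scale[where b=b, OF h a \<Omega> \<epsilon>]) blast
  from choice[OF this] obtain D where D0: "\<forall>i. 0 < D i \<and> (\<forall>c d. (\<forall>j. a \<le> c $ j \<and> c $ j \<le> b \<and> a \<le> d $ j \<and> d $ j \<le> b \<and> \<bar>c $ j - d $ j\<bar> \<le> D i) \<longrightarrow>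
    (\<integral>\<^sup>+x\<in>\<Omega>. ennreal (norm (h i (c * x) - h i (d * x))) \<partial>lborel) \<le> ennreal \<epsilon>)" ..
  then have D: "0 < D i" "(\<And>j. a \<le> c $ j \<and> c $ j \<le> b \<and> a \<le> d $ j \<and> d $ j \<le> b \<and> \<bar>c $ j - d $ j\<bar> \<le> D i) \<Longrightarrow>
    (\<integral>\<^sup>+x\<in>\<Omega>. ennreal (norm (h i (c * x) - h i (d * x))) \<partial>lborel) \<le> ennreal \<epsilon>" for i c d
    by simp_all
  define \<delta> where "\<delta> = Min (range D)"
  have \<delta>: "0 < \<delta>" "\<And>i. \<delta> \<le> D i" using D(1) unfolding \<delta>_def by auto
  show thesis
  proof (rule that[OF \<delta>(1)])
    fix c c' assume c: "a \<le> c" "c \<le> c'" "c' \<le> b" "c' - c \<le> \<delta>"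
    \<comment> \<open>The corner of the staircase after the coordinates in \<open>A\<close> have
      been moved: the empty set gives \<open>c\<close> times \<open>x\<close>, the full index set
      \<open>c'\<close> times \<open>x\<close>.\<close>
    define d where "d A = (\<chi> j. if j \<in> A then c' else c)" for A :: "'n set"
    define err where "err A x = f (d A * x) - f (c *\<^sub>R x) - (\<Sum>i\<in>A. ray_integral (h i) i c c' x)" for A x
    have [measurable]: "err A \<in> borel_measurable borel" for A unfolding err_def by measurable
    have "(\<integral>\<^sup>+x\<in>\<Omega>. ennreal (norm (err A x)) \<partial>lborel) \<le> ennreal (real (card A) * ((c' - c) * E / N))"
      if "finite A" for A
      using that
    proof (induction A rule: finite_induct)
      case empty
      have "d {} * x = c *\<^sub>R x" for x by (simp add: d_def vec_eq_iff)
      then show ?case by (simp add: err_def)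
    next
      case (insert i A)
      have d_bounds: "c \<le> d A $ j \<and> d A $ j \<le> c'" for j using c by (simp add: d_def)
      have d1: "coord_upd (d A) i c' = d (insert i A)" by (auto simp: d_def vec_eq_iff)
      have d0: "coord_upd (d A) i c = d A" using insert by (auto simp: d_def vec_eq_iff)
      \<comment> \<open>The mismatch between the partial derivative on the staircase and at the
        point of the ray with the same parameter \<open>s\<close>.\<close>
      define w where "w x s = ennreal (norm (h i (coord_upd (d A) i s * x) - h i (vec s * x)))" for x s
      have [measurable]: "(\<lambda>(x, s). w x s) \<in> borel_measurable (borel \<Otimes>\<^sub>M borel)"
        unfolding w_def vec_times by measurable
      have w1 [measurable]: "(\<lambda>x. w x s) \<in> borel_measurable borel" for s
        unfolding w_def vec_times by measurable
      have "AE x in lborel. (\<forall>j. \<forall>s\<in>{c..c'}. p $ j \<le> s * x $ j \<and> s * x $ j \<le> q $ j) \<longrightarrow>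
        set_integrable lborel {c..c'} (\<lambda>s. x $ i *\<^sub>R h i (coord_upd (d A) i s * x)) \<and>
        f (coord_upd (d A) i c' * x) - f (coord_upd (d A) i c * x)
          = (LINT s:{c..c'}|lborel. x $ i *\<^sub>R h i (coord_upd (d A) i s * x))"
        by (rule AE_scaled_line_integral[OF line _ c(2) d_bounds]) (use a c in auto)
      moreover have "AE x in lborel. set_integrable lborel {c..c'} (\<lambda>\<tau>. x $ i *\<^sub>R h i (\<tau> *\<^sub>R x))"
        by (rule AE_ray_integrable[OF h]) (use a c in auto)
      ultimately have "AE x in lborel. ennreal (norm (err (insert i A) x)) * indicator \<Omega> x
          \<le> ennreal (norm (err A x)) * indicator \<Omega> x + (\<integral>\<^sup>+s\<in>{c..c'}. ennreal r * (w x s * indicator \<Omega> x) \<partial>lborel)"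
      proof eventually_elim
        case (elim x)
        show ?case
        proof (cases "x \<in> \<Omega>")
          case True
          then have "\<forall>j. \<forall>s\<in>{c..c'}. p $ j \<le> s * x $ j \<and> s * x $ j \<le> q $ j" using box c by auto
          with elim(1) have I1: "set_integrable lborel {c..c'} (\<lambda>s. x $ i *\<^sub>R h i (coord_upd (d A) i s * x))"
            and eq: "f (d (insert i A) * x) - f (d A * x) = (LINT s:{c..c'}|lborel. x $ i *\<^sub>R h i (coord_upd (d A) i s * x))"
            unfolding d1 d0 by auto
          have I3: "set_integrable lborel {c..c'} (\<lambda>s. x $ i *\<^sub>R h i (coord_upd (d A) i s * x) - x $ i *\<^sub>R h i (s *\<^sub>R x))"
            using I1 elim(2) by (rule set_integral_diff(1))
          have "err (insert i A) x = err A x + (LINT s:{c..c'}|lborel. x $ i *\<^sub>R h i (coord_upd (d A) i s * x) - x $ i *\<^sub>R h i (s *\<^sub>R x))"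
            unfolding set_integral_diff(2)[OF I1 elim(2)] eq[symmetric]
            using insert by (simp add: err_def ray_integral_def algebra_simps)
          note err_eq = this
          have L_le: "ennreal (norm (LINT s:{c..c'}|lborel. x $ i *\<^sub>R h i (coord_upd (d A) i s * x) - x $ i *\<^sub>R h i (s *\<^sub>R x)))
              \<le> (\<integral>\<^sup>+s\<in>{c..c'}. ennreal r * (w x s * indicator \<Omega> x) \<partial>lborel)"
          proof -
            have "ennreal (norm (LINT s:{c..c'}|lborel. x $ i *\<^sub>R h i (coord_upd (d A) i s * x) - x $ i *\<^sub>R h i (s *\<^sub>R x)))
              \<le> (\<integral>\<^sup>+s. ennreal (norm (indicator {c..c'} s *\<^sub>R (x $ i *\<^sub>R h i (coord_upd (d A) i s * x) - x $ i *\<^sub>R h i (s *\<^sub>R x)))) \<partial>lborel)"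
              unfolding set_lebesgue_integral_def
              by (rule integral_norm_bound_ennreal) (use I3 in \<open>simp add: set_integrable_def\<close>)
            also have "\<dots> \<le> (\<integral>\<^sup>+s\<in>{c..c'}. ennreal r * (w x s * indicator \<Omega> x) \<partial>lborel)"
            proof (rule nn_integral_mono)
              fix s
              have "\<bar>x $ i\<bar> \<le> r" using r(2)[OF True] component_le_norm_cart[of x i] by linarith
              then have "norm (x $ i *\<^sub>R h i (coord_upd (d A) i s * x) - x $ i *\<^sub>R h i (s *\<^sub>R x))
                \<le> r * norm (h i (coord_upd (d A) i s * x) - h i (s *\<^sub>R x))"
                by (simp flip: scaleR_diff_right add: mult_right_mono)
              then show "ennreal (norm (indicator {c..c'} s *\<^sub>R (x $ i *\<^sub>R h i (coord_upd (d A) i s * x) - x $ i *\<^sub>R h i (s *\<^sub>R x))))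
                \<le> ennreal r * (w x s * indicator \<Omega> x) * indicator {c..c'} s"
                using True r(1) by (auto simp: indicator_def w_def vec_times ennreal_leI simp flip: ennreal_mult)
            qed
            finally show ?thesis .
          qed
          have "ennreal (norm (err (insert i A) x)) \<le> ennreal (norm (err A x))
              + ennreal (norm (LINT s:{c..c'}|lborel. x $ i *\<^sub>R h i (coord_upd (d A) i s * x) - x $ i *\<^sub>R h i (s *\<^sub>R x)))"
            unfolding err_eq by (simp add: norm_triangle_ineq ennreal_leI flip: ennreal_plus)
          also have "\<dots> \<le> ennreal (norm (err A x)) + (\<integral>\<^sup>+s\<in>{c..c'}. ennreal r * (w x s * indicator \<Omega> x) \<partial>lborel)"
            using L_le by (rule add_left_mono)
          finally have "ennreal (norm (err (insert i A) x)) \<le> ennreal (norm (err A x)) + (\<integral>\<^sup>+s\<in>{c..c'}. ennreal r * (w x s * indicator \<Omega> x) \<partial>lborel)" .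
          then show ?thesis using True by simp
        qed simp
      qed
      then have "(\<integral>\<^sup>+x\<in>\<Omega>. ennreal (norm (err (insert i A) x)) \<partial>lborel)
        \<le> (\<integral>\<^sup>+x. ennreal (norm (err A x)) * indicator \<Omega> x + (\<integral>\<^sup>+s\<in>{c..c'}. ennreal r * (w x s * indicator \<Omega> x) \<partial>lborel) \<partial>lborel)"
        by (rule nn_integral_mono_AE)
      also have "\<dots> = (\<integral>\<^sup>+x\<in>\<Omega>. ennreal (norm (err A x)) \<partial>lborel)
          + (\<integral>\<^sup>+x. (\<integral>\<^sup>+s\<in>{c..c'}. ennreal r * (w x s * indicator \<Omega> x) \<partial>lborel) \<partial>lborel)"
        by (rule nn_integral_add) measurable
      also have "(\<integral>\<^sup>+x. (\<integral>\<^sup>+s\<in>{c..c'}. ennreal r * (w x s * indicator \<Omega> x) \<partial>lborel) \<partial>lborel)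
          = (\<integral>\<^sup>+s. (\<integral>\<^sup>+x. ennreal r * (w x s * indicator \<Omega> x) * indicator {c..c'} s \<partial>lborel) \<partial>lborel)"
        by (rule lborel_pair.Fubini') measurable
      also have "\<dots> \<le> (\<integral>\<^sup>+s. ennreal (r * \<epsilon>) * indicator {c..c'} s \<partial>lborel)"
      proof (rule nn_integral_mono)
        fix s :: real
        have "(\<integral>\<^sup>+x. ennreal r * (w x s * indicator \<Omega> x) \<partial>lborel) \<le> ennreal (r * \<epsilon>)" if s: "s \<in> {c..c'}"
        proof -
          \<comment> \<open>All entries of both dilations lie between \<open>c\<close> and
            \<open>c'\<close>, so they differ by at most \<delta>.\<close>
          have "(\<integral>\<^sup>+x. w x s * indicator \<Omega> x \<partial>lborel) \<le> ennreal \<epsilon>"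
            unfolding w_def
            by (rule D(2)) (use s c \<delta>(2)[of i] in \<open>auto simp: d_def\<close>)
          then have "ennreal r * (\<integral>\<^sup>+x. w x s * indicator \<Omega> x \<partial>lborel) \<le> ennreal r * ennreal \<epsilon>"
            by (intro mult_left_mono) auto
          then show ?thesis using r \<epsilon> by (simp add: nn_integral_cmult ennreal_mult)
        qed
        then show "(\<integral>\<^sup>+x. ennreal r * (w x s * indicator \<Omega> x) * indicator {c..c'} s \<partial>lborel) \<le> ennreal (r * \<epsilon>) * indicator {c..c'} s"
          by (auto simp: indicator_def)
      qed
      also have "\<dots> = ennreal (r * \<epsilon> * (c' - c))"
        using c r \<epsilon> by (simp add: nn_integral_cmult_indicator ennreal_mult)
      also have "r * \<epsilon> * (c' - c) = (c' - c) * E / N"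
        using r N by (simp add: \<epsilon>_def field_simps)
      also have "(\<integral>\<^sup>+x\<in>\<Omega>. ennreal (norm (err A x)) \<partial>lborel) + ennreal ((c' - c) * E / N)
          \<le> ennreal (real (card A) * ((c' - c) * E / N)) + ennreal ((c' - c) * E / N)"
        using insert by (intro add_right_mono) auto
      also have "\<dots> = ennreal (real (card (insert i A)) * ((c' - c) * E / N))"
      proof -
        define X where "X = (c' - c) * E / N"
        have "0 \<le> X" using c E N by (simp add: X_def)
        then show ?thesis
          using insert unfolding X_def[symmetric] by (simp add: distrib_right add.commute flip: ennreal_plus)
      qed
      finally show ?case by (simp add: add_left_mono)
    qed
    from this[of UNIV] have "(\<integral>\<^sup>+x\<in>\<Omega>. ennreal (norm (err UNIV x)) \<partial>lborel) \<le> ennreal ((c' - c) * E)"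
      using N by (simp add: N_def)
    moreover have "d UNIV * x = c' *\<^sub>R x" for x by (simp add: d_def vec_eq_iff)
    ultimately show "(\<integral>\<^sup>+x\<in>\<Omega>. ennreal (norm (f (c' *\<^sub>R x) - f (c *\<^sub>R x) - (\<Sum>i\<in>UNIV. ray_integral (h i) i c c' x))) \<partial>lborel)
      \<le> ennreal ((c' - c) * E)"
      by (simp add: err_def)
  qed
qed

text \<open>The bound of \<open>staircase_step\<close> is proportional to the length of the
  parameter interval, so the errors of a fine subdivision add up to at most (b - a) E, for every E >
  0. Hence the error vanishes for almost every \<open>x\<close>, with a null set that still depends
  on \<open>a\<close> and \<open>b\<close>.\<close>

lemma AE_ray_increment_le:
  fixes f :: "real ^ 'n \<Rightarrow> 'b::euclidean_space" and h :: "'n \<Rightarrow> real ^ 'n \<Rightarrow> 'b"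
  assumes f[measurable]: "f \<in> borel_measurable borel" and h: "\<And>i. integrable lborel (h i)"
    and line: "\<And>i. line_integral_on p q i f (h i)"
    and a: "0 < a" "a \<le> b"
  shows "AE x in lborel. a *\<^sub>R x \<in> cbox p q \<and> b *\<^sub>R x \<in> cbox p q \<longrightarrow>
    ennreal (norm (f (b *\<^sub>R x) - f (a *\<^sub>R x))) \<le> (\<integral>\<^sup>+s\<in>{a..b}. ennreal (norm (\<Sum>i\<in>UNIV. x $ i *\<^sub>R h i (s *\<^sub>R x))) \<partial>lborel)"
proof -
  have [measurable]: "h i \<in> borel_measurable borel" for i using h by auto
  define \<Omega> where "\<Omega> = {x. a *\<^sub>R x \<in> cbox p q \<and> b *\<^sub>R x \<in> cbox p q}"
  have \<Omega>m[measurable]: "\<Omega> \<in> sets borel"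
  proof -
    have "closed ((\<lambda>x. a *\<^sub>R x) -` cbox p q)" "closed ((\<lambda>x. b *\<^sub>R x) -` cbox p q)"
      by (intro continuous_closed_vimage continuous_intros closed_cbox)+
    then have "closed ((\<lambda>x. a *\<^sub>R x) -` cbox p q \<inter> (\<lambda>x. b *\<^sub>R x) -` cbox p q)" by (rule closed_Int)
    moreover have "\<Omega> = (\<lambda>x. a *\<^sub>R x) -` cbox p q \<inter> (\<lambda>x. b *\<^sub>R x) -` cbox p q" by (auto simp: \<Omega>_def)
    ultimately show ?thesis by simp
  qed
  have \<Omega>b: "bounded \<Omega>"
  proof -
    have "\<Omega> \<subseteq> (\<lambda>y. (1 / a) *\<^sub>R y) ` cbox p q"
    proof
      fix x assume "x \<in> \<Omega>"
      then have "a *\<^sub>R x \<in> cbox p q" "x = (1 / a) *\<^sub>R (a *\<^sub>R x)" using a by (auto simp: \<Omega>_def)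
      then show "x \<in> (\<lambda>y. (1 / a) *\<^sub>R y) ` cbox p q" by blast
    qed
    then show ?thesis using bounded_scaling[OF bounded_cbox] bounded_subset by blast
  qed
  have box: "p $ j \<le> s * x $ j \<and> s * x $ j \<le> q $ j" if "x \<in> \<Omega>" "a \<le> s" "s \<le> b" for x s j
  proof (cases "0 \<le> x $ j")
    case True
    then have "a * x $ j \<le> s * x $ j" "s * x $ j \<le> b * x $ j" using that by (auto intro: mult_right_mono)
    then show ?thesis using that(1) unfolding \<Omega>_def by (auto simp: mem_box_cart) (meson order_trans)+
  next
    case False
    then have "b * x $ j \<le> s * x $ j" "s * x $ j \<le> a * x $ j" using that by (auto intro: mult_right_mono_neg)
    then show ?thesis using that(1) unfolding \<Omega>_def by (auto simp: mem_box_cart) (meson order_trans)+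
  qed
  define err where "err s t x = f (t *\<^sub>R x) - f (s *\<^sub>R x) - (\<Sum>i\<in>UNIV. ray_integral (h i) i s t x)" for s t x
  have [measurable]: "err s t \<in> borel_measurable borel" for s t unfolding err_def by measurable
  have "AE x in lborel. \<forall>i\<in>UNIV. set_integrable lborel {a..b} (\<lambda>\<tau>. x $ i *\<^sub>R h i (\<tau> *\<^sub>R x))"
    by (intro AE_finite_allI AE_ray_integrable h a) simp
  then have int: "AE x in lborel. \<forall>i. set_integrable lborel {a..b} (\<lambda>\<tau>. x $ i *\<^sub>R h i (\<tau> *\<^sub>R x))" by simp
  have small: "(\<integral>\<^sup>+x\<in>\<Omega>. ennreal (norm (err a b x)) \<partial>lborel) \<le> ennreal ((b - a) * E)" if E: "0 < E" for E
  proof -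
    obtain \<delta> where \<delta>: "0 < \<delta>" "\<And>c c'. a \<le> c \<Longrightarrow> c \<le> c' \<Longrightarrow> c' \<le> b \<Longrightarrow> c' - c \<le> \<delta> \<Longrightarrow>
      (\<integral>\<^sup>+x\<in>\<Omega>. ennreal (norm (err c c' x)) \<partial>lborel) \<le> ennreal ((c' - c) * E)"
      unfolding err_def by (rule staircase_step[where b=b, OF f h line a(1) \<Omega>b \<Omega>m box E]) blast+
    \<comment> \<open>\<open>Bolzano\<close> stands in for an explicit subdivision: a property that
      passes to the union of adjacent intervals and holds for short intervals around each point
      holds for [a, b]. The trivial premises give the claim the shape of that property.\<close>
    have "a \<le> a \<longrightarrow> b \<le> b \<longrightarrow> (\<integral>\<^sup>+x\<in>\<Omega>. ennreal (norm (err a b x)) \<partial>lborel) \<le> ennreal ((b - a) * E)"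
    proof (rule Bolzano[OF a(2), where P="\<lambda>s t. a \<le> s \<longrightarrow> t \<le> b \<longrightarrow> (\<integral>\<^sup>+x\<in>\<Omega>. ennreal (norm (err s t x)) \<partial>lborel) \<le> ennreal ((t - s) * E)"])
      fix s t u :: real
      assume st: "a \<le> s \<longrightarrow> t \<le> b \<longrightarrow> (\<integral>\<^sup>+x\<in>\<Omega>. ennreal (norm (err s t x)) \<partial>lborel) \<le> ennreal ((t - s) * E)"
        and tu: "a \<le> t \<longrightarrow> u \<le> b \<longrightarrow> (\<integral>\<^sup>+x\<in>\<Omega>. ennreal (norm (err t u x)) \<partial>lborel) \<le> ennreal ((u - t) * E)"
        and le: "s \<le> t" "t \<le> u"
      show "a \<le> s \<longrightarrow> u \<le> b \<longrightarrow> (\<integral>\<^sup>+x\<in>\<Omega>. ennreal (norm (err s u x)) \<partial>lborel) \<le> ennreal ((u - s) * E)"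
      proof (intro impI)
        assume ab: "a \<le> s" "u \<le> b"
        have "AE x in lborel. ennreal (norm (err s u x)) * indicator \<Omega> x
          \<le> ennreal (norm (err s t x)) * indicator \<Omega> x + ennreal (norm (err t u x)) * indicator \<Omega> x"
          using int
        proof eventually_elim
          case (elim x)
          have "(\<Sum>i\<in>UNIV. ray_integral (h i) i s u x) = (\<Sum>i\<in>UNIV. ray_integral (h i) i s t x) + (\<Sum>i\<in>UNIV. ray_integral (h i) i t u x)"
            unfolding sum.distrib[symmetric]
            by (rule sum.cong[OF refl], rule ray_integral_combine[where a=a and b=b]) (use elim ab le in auto)
          then have "err s u x = err s t x + err t u x" by (simp add: err_def)
          then have "norm (err s u x) \<le> norm (err s t x) + norm (err t u x)" by (simp add: norm_triangle_ineq)
          then show ?case by (auto simp: indicator_def ennreal_leI simp flip: ennreal_plus)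
        qed
        then have "(\<integral>\<^sup>+x\<in>\<Omega>. ennreal (norm (err s u x)) \<partial>lborel)
          \<le> (\<integral>\<^sup>+x. ennreal (norm (err s t x)) * indicator \<Omega> x + ennreal (norm (err t u x)) * indicator \<Omega> x \<partial>lborel)"
          by (rule nn_integral_mono_AE)
        also have "\<dots> = (\<integral>\<^sup>+x\<in>\<Omega>. ennreal (norm (err s t x)) \<partial>lborel) + (\<integral>\<^sup>+x\<in>\<Omega>. ennreal (norm (err t u x)) \<partial>lborel)"
          by (rule nn_integral_add) measurable
        also have "\<dots> \<le> ennreal ((t - s) * E) + ennreal ((u - t) * E)"
          using st tu ab le by (intro add_mono) auto
        also have "\<dots> = ennreal ((u - s) * E)"
          using le E by (simp add: left_diff_distrib flip: ennreal_plus)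
        finally show "(\<integral>\<^sup>+x\<in>\<Omega>. ennreal (norm (err s u x)) \<partial>lborel) \<le> ennreal ((u - s) * E)" .
      qed
    next
      fix x :: real
      show "\<exists>d>0. \<forall>s t. s \<le> x \<and> x \<le> t \<and> t - s < d \<longrightarrow>
        (a \<le> s \<longrightarrow> t \<le> b \<longrightarrow> (\<integral>\<^sup>+x\<in>\<Omega>. ennreal (norm (err s t x)) \<partial>lborel) \<le> ennreal ((t - s) * E))"
        by (rule exI[of _ \<delta>]) (auto intro!: \<delta>)
    qed
    then show ?thesis by simp
  qed
  have "(\<integral>\<^sup>+x\<in>\<Omega>. ennreal (norm (err a b x)) \<partial>lborel) \<le> 0"
  proof (rule ennreal_le_epsilon)
    fix e :: real assume "0 < e"
    \<comment> \<open>Dividing by \<open>b - a + 1\<close> covers the case \<open>a = b\<close> as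
      well.\<close>
    then have "(\<integral>\<^sup>+x\<in>\<Omega>. ennreal (norm (err a b x)) \<partial>lborel) \<le> ennreal ((b - a) * (e / (b - a + 1)))"
      using a by (intro small) simp
    also have "\<dots> \<le> ennreal e"
      using a \<open>0 < e\<close> by (intro ennreal_leI) (simp add: field_simps)
    finally show "(\<integral>\<^sup>+x\<in>\<Omega>. ennreal (norm (err a b x)) \<partial>lborel) \<le> 0 + ennreal e" by simp
  qed
  then have "(\<integral>\<^sup>+x. ennreal (norm (err a b x)) * indicator \<Omega> x \<partial>lborel) = 0" by simp
  then have "AE x in lborel. ennreal (norm (err a b x)) * indicator \<Omega> x = 0"
    by (subst (asm) nn_integral_0_iff_AE) simp_all
  with int show ?thesis
  proof eventually_elim
    case (elim x)
    show ?case
    proof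
      assume "a *\<^sub>R x \<in> cbox p q \<and> b *\<^sub>R x \<in> cbox p q"
      then have "err a b x = 0" using elim(2) by (simp add: \<Omega>_def)
      then have "f (b *\<^sub>R x) - f (a *\<^sub>R x) = (\<Sum>i\<in>UNIV. ray_integral (h i) i a b x)"
        by (simp add: err_def)
      also have "\<dots> = (\<integral>\<tau>. (\<Sum>i\<in>UNIV. indicator {a..b} \<tau> *\<^sub>R (x $ i *\<^sub>R h i (\<tau> *\<^sub>R x))) \<partial>lborel)"
        unfolding ray_integral_def set_lebesgue_integral_def
        using elim(1) by (intro Bochner_Integration.integral_sum[symmetric]) (auto simp: set_integrable_def)
      finally have "ennreal (norm (f (b *\<^sub>R x) - f (a *\<^sub>R x)))
          \<le> (\<integral>\<^sup>+\<tau>. ennreal (norm (\<Sum>i\<in>UNIV. indicator {a..b} \<tau> *\<^sub>R (x $ i *\<^sub>R h i (\<tau> *\<^sub>R x)))) \<partial>lborel)"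
        using elim(1) by (simp only:) (intro integral_norm_bound_ennreal Bochner_Integration.integrable_sum, auto simp: set_integrable_def)
      also have "\<dots> = (\<integral>\<^sup>+s\<in>{a..b}. ennreal (norm (\<Sum>i\<in>UNIV. x $ i *\<^sub>R h i (s *\<^sub>R x))) \<partial>lborel)"
        by (intro nn_integral_cong) (auto simp: indicator_def)
      finally show "ennreal (norm (f (b *\<^sub>R x) - f (a *\<^sub>R x))) \<le> (\<integral>\<^sup>+s\<in>{a..b}. ennreal (norm (\<Sum>i\<in>UNIV. x $ i *\<^sub>R h i (s *\<^sub>R x))) \<partial>lborel)" .
    qed
  qed
qed

section \<open>A logarithmic weight\<close>

definition log_weight :: "real \<Rightarrow> real" where
  "log_weight r = 1 / (r * (1 - ln r))"

text \<open>An antiderivative of \<open>log_weight\<close> on (0, 1) that tends to minus infinity at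
  0.\<close>

definition log_potential :: "real \<Rightarrow> real" where
  "log_potential r = - ln (1 - ln r)"

lemma ln_less_1: "0 < r \<Longrightarrow> r < 1 \<Longrightarrow> ln r < (1 :: real)"
  using ln_less_zero[of r] by linarith

lemma log_weight_pos: "0 < r \<Longrightarrow> r < 1 \<Longrightarrow> 0 < log_weight r"
  using ln_less_1[of r] unfolding log_weight_def by (intro divide_pos_pos mult_pos_pos) auto

lemma borel_measurable_log_weight [measurable]: "log_weight \<in> borel_measurable borel"
  unfolding log_weight_def by measurable

lemma isCont_log_weight: "0 < r \<Longrightarrow> r < 1 \<Longrightarrow> isCont log_weight r"
  using ln_less_1[of r] unfolding log_weight_def by (auto intro!: continuous_intros)

lemma DERIV_log_potential:
  assumes "0 < r" "r < 1" shows "(log_potential has_real_derivative log_weight r) (at r)"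
  using assms ln_less_1[of r] unfolding log_potential_def log_weight_def
  by (auto intro!: derivative_eq_intros simp: field_simps)

text \<open>The threshold is the solution of ln (1 - ln r) = M.\<close>

lemma log_potential_at_0:
  assumes "0 < r" "r < exp (1 - exp M)" shows "log_potential r < - M"
proof -
  have "ln r < 1 - exp M" using assms by (metis exp_less_cancel_iff exp_ln)
  then have "exp M < 1 - ln r" by simp
  then have "M < ln (1 - ln r)" by (metis exp_gt_zero ln_exp ln_less_cancel_iff order_less_trans)
  then show ?thesis by (simp add: log_potential_def)
qed

text \<open>The integrand is 1 / (t (1 - ln t)^n). As 1 - ln t is at least 1, the exponent may be
  lowered to 2; here \<open>2 \<le> n\<close> enters. For exponent 2 the antiderivative 1 / (1 - ln
  t) rises from 0 to 1.\<close>

lemma nn_integral_log_weight_power: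
  assumes n: "2 \<le> n"
  shows "(\<integral>\<^sup>+t\<in>{0<..<1}. ennreal (log_weight t ^ n * t ^ (n - 1)) \<partial>lborel) < \<infinity>"
proof -
  let ?F = "\<lambda>t::real. 1 / (1 - ln t)" and ?f = "\<lambda>t::real. 1 / (t * (1 - ln t)^2)"
  have ln_neg: "ln t < 0" if "0 < t" "t < 1" for t :: real using that by simp
  have "set_integrable lborel (einterval 0 1) ?f"
  proof (rule interval_integral_FTC_nonneg(1)[where F="?F" and A=0 and B=1])
    fix t :: real assume t: "0 < ereal t" "ereal t < 1"
    then have t': "0 < t" "t < 1" by (auto simp: zero_ereal_def one_ereal_def)
    show "DERIV ?F t :> ?f t"
      using t' ln_less_1[OF t'] by (auto intro!: derivative_eq_intros simp: field_simps power2_eq_square)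
    show "isCont ?f t" using t' ln_less_1[OF t'] by (auto intro!: continuous_intros)
  next
    show "AE t in lborel. 0 < ereal t \<longrightarrow> ereal t < 1 \<longrightarrow> 0 \<le> ?f t"
      by (auto simp: zero_ereal_def one_ereal_def)
    have "filterlim (\<lambda>t::real. 1 - ln t) at_top (at_right 0)"
      unfolding filterlim_at_top
    proof
      fix Z :: real
      have "eventually (\<lambda>t::real. t \<in> {0<..<exp (1 - Z)}) (at_right 0)"
        by (rule eventually_at_right_real) simp
      then show "eventually (\<lambda>t::real. Z \<le> 1 - ln t) (at_right 0)"
      proof eventually_elim
        case (elim t)
        then have "ln t < 1 - Z" by (metis exp_less_cancel_iff exp_ln greaterThanLessThan_iff)
        then show ?case by simp
      qed
    qed
    then have "(?F \<longlongrightarrow> 0) (at_right 0)"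
      by (intro tendsto_divide_0[OF tendsto_const] filterlim_at_top_imp_at_infinity)
    then show "((?F \<circ> real_of_ereal) \<longlongrightarrow> 0) (at_right 0)"
      by (simp only: zero_ereal_def ereal_tendsto_simps)
    have "(?F \<longlongrightarrow> 1 / (1 - ln 1)) (at_left 1)"
      by (intro tendsto_intros) auto
    then show "((?F \<circ> real_of_ereal) \<longlongrightarrow> 1) (at_left 1)"
      by (simp add: one_ereal_def ereal_tendsto_simps)
  qed simp
  moreover have "einterval 0 1 = {0<..<1::real}"
    by (auto simp: einterval_def zero_ereal_def one_ereal_def)
  ultimately have I: "integrable lborel (\<lambda>t. indicator {0<..<1} t *\<^sub>R ?f t)"
    by (simp add: set_integrable_def)
  have "(\<integral>\<^sup>+t\<in>{0<..<1}. ennreal (log_weight t ^ n * t ^ (n - 1)) \<partial>lborel)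
      \<le> (\<integral>\<^sup>+t. ennreal (norm (indicator {0<..<1} t *\<^sub>R ?f t)) \<partial>lborel)"
  proof (rule nn_integral_mono)
    fix t :: real
    have "log_weight t ^ n * t ^ (n - 1) \<le> ?f t" if t: "0 < t" "t < 1"
    proof -
      define L where "L = 1 - ln t"
      have L: "1 \<le> L" using ln_neg[OF t] by (simp add: L_def)
      obtain m where m: "n = Suc m" using n by (cases n) auto
      have "log_weight t ^ n * t ^ (n - 1) = 1 / (t * L ^ n)"
        using t L unfolding log_weight_def L_def[symmetric] by (simp add: m power_mult_distrib power_divide field_simps)
      also have "\<dots> \<le> 1 / (t * L ^ 2)"
        using t L power_increasing[OF n L] by (intro divide_left_mono mult_left_mono mult_pos_pos) auto
      finally show ?thesis by (simp add: L_def)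
    qed
    then show "ennreal (log_weight t ^ n * t ^ (n - 1)) * indicator {0<..<1} t
        \<le> ennreal (norm (indicator {0<..<1} t *\<^sub>R ?f t))"
      by (auto simp: indicator_def intro!: ennreal_leI)
  qed
  also have "\<dots> < \<infinity>" using I by (simp add: integrable_iff_bounded)
  finally show ?thesis .
qed

text \<open>After a translation of \<open>y0\<close> to 0, polar coordinates give the radial
  integral of \<open>nn_integral_log_weight_power\<close> times the finite area of the
  sphere.\<close>

lemma integrable_log_weight_power:
  fixes y0 :: "real ^ 'n"
  assumes n: "2 \<le> CARD('n)"
  shows "integrable lborel (\<lambda>y. if 0 < norm (y - y0) \<and> norm (y - y0) < 1 then log_weight (norm (y - y0)) ^ CARD('n) else 0)"
proof -
  define W where "W z = (if 0 < norm z \<and> norm z < 1 then log_weight (norm z) ^ CARD('n) else 0)" for z :: "real ^ 'n"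
  have [measurable]: "W \<in> borel_measurable borel" unfolding W_def by measurable
  have W0: "0 \<le> W z" for z using log_weight_pos[of "norm z"] by (auto simp: W_def intro!: zero_le_power less_imp_le)
  let ?c = "\<integral>\<^sup>+t\<in>{0<..<1}. ennreal (log_weight t ^ CARD('n) * t ^ (CARD('n) - 1)) \<partial>lborel"
  have "(\<integral>\<^sup>+z. ennreal (W z) \<partial>lborel)
      = (\<integral>\<^sup>+u. (\<integral>\<^sup>+t\<in>{0<..}. ennreal (W (t *\<^sub>R u)) * ennreal (t ^ (CARD('n) - 1)) \<partial>lborel) \<partial>(sphere_area :: (real ^ 'n) measure))"
    by (rule nn_integral_polar[symmetric]) simp
  also have "\<dots> = (\<integral>\<^sup>+u. ?c \<partial>(sphere_area :: (real ^ 'n) measure))"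
    using AE_sphere_area_norm[where ?'n = 'n]
  proof (intro nn_integral_cong_AE, eventually_elim)
    case (elim u)
    then show ?case
      by (intro nn_integral_cong) (auto simp: W_def indicator_def ennreal_mult'')
  qed
  also have "\<dots> = ?c * emeasure sphere_area (space (sphere_area :: (real ^ 'n) measure))"
    by simp
  also have "emeasure sphere_area (space (sphere_area :: (real ^ 'n) measure)) = of_nat CARD('n) * emeasure lborel (punctured_ball :: (real ^ 'n) set)"
    using nn_integral_sphere_area[of "\<lambda>_ :: real ^ 'n. 1"] by simp
  also have "?c * (of_nat CARD('n) * emeasure lborel (punctured_ball :: (real ^ 'n) set)) < \<infinity>"
  proof -
    have "emeasure lborel (punctured_ball :: (real ^ 'n) set) \<le> emeasure lborel (cball (0 :: real ^ 'n) 1)"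
      by (rule emeasure_mono) (auto simp: punctured_ball_def)
    then have "emeasure lborel (punctured_ball :: (real ^ 'n) set) < \<infinity>"
      using emeasure_lborel_cball_finite[of "0 :: real ^ 'n" 1] by (rule le_less_trans)
    then show ?thesis using nn_integral_log_weight_power[OF n]
      by (simp add: ennreal_mult_less_top of_nat_less_top)
  qed
  finally have "(\<integral>\<^sup>+z. ennreal (W z) \<partial>lborel) < \<infinity>" .
  moreover have "(\<integral>\<^sup>+z. ennreal (W z) \<partial>lborel) = (\<integral>\<^sup>+y. ennreal (W (- y0 + y)) \<partial>lborel)"
    by (subst lborel_distr_plus[of "- y0", symmetric]) (simp add: nn_integral_distr)
  ultimately have "integrable lborel (\<lambda>y. W (- y0 + y))"
    using W0 by (simp add: integrable_iff_bounded)
  then show ?thesis by (simp add: W_def)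
qed

text \<open>The weighted length dominates the increments of \<open>log_potential\<close> of the
  distance to \<open>y0\<close>, which are unbounded near 0. Only the increment bound
  \<open>inc\<close> links \<gamma> to \<open>v\<close>, so in place of a chain rule the weight is
  treated as nearly constant on short pieces, at the price of a factor 2.\<close>

lemma path_log_weight_infinite:
  fixes \<gamma> :: "real \<Rightarrow> 'a::euclidean_space" and v :: "real \<Rightarrow> real"
  assumes [measurable]: "\<gamma> \<in> borel_measurable borel" "v \<in> borel_measurable borel"
    and v0: "\<And>t. 0 \<le> v t" and t0: "0 < t0"
    and cont: "continuous_on {0<..t0} \<gamma>"
    and unit: "\<And>t. 0 < t \<Longrightarrow> t \<le> t0 \<Longrightarrow> 0 < norm (\<gamma> t - y0) \<and> norm (\<gamma> t - y0) < 1"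
    and lim: "(\<gamma> \<longlongrightarrow> y0) (at_right 0)"
    and inc: "\<And>a b. 0 < a \<Longrightarrow> a \<le> b \<Longrightarrow> b \<le> t0 \<Longrightarrow> ennreal (norm (\<gamma> b - \<gamma> a)) \<le> (\<integral>\<^sup>+s\<in>{a<..<b}. ennreal (v s) \<partial>lborel)"
  shows "(\<integral>\<^sup>+t\<in>{0<..<t0}. ennreal (log_weight (norm (\<gamma> t - y0)) * v t) \<partial>lborel) = \<infinity>"
proof -
  define g where "g t = norm (\<gamma> t - y0)" for t
  have [measurable]: "g \<in> borel_measurable borel" unfolding g_def by measurable
  have g01: "0 < g t" "g t < 1" if "0 < t" "t \<le> t0" for t using unit that by (auto simp: g_def)
  \<comment> \<open>The factor 2 is the ratio of the bounds 4/3 and 2/3 for the weight on a short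
    piece. Open intervals make adjacent pieces disjoint, so \<open>I\<close> is
    superadditive.\<close>
  define I where "I a b = (\<integral>\<^sup>+t\<in>{a<..<b}. ennreal (2 * (log_weight (g t) * v t)) \<partial>lborel)" for a b
  have I_add: "I a b + I b c \<le> I a c" if "a \<le> b" "b \<le> c" for a b c
  proof -
    have "I a b + I b c = (\<integral>\<^sup>+t. ennreal (2 * (log_weight (g t) * v t)) * indicator {a<..<b} t
        + ennreal (2 * (log_weight (g t) * v t)) * indicator {b<..<c} t \<partial>lborel)"
      unfolding I_def by (rule nn_integral_add[symmetric]) measurable
    also have "\<dots> \<le> I a c"
      unfolding I_def using that by (intro nn_integral_mono) (auto simp: indicator_def)
    finally show ?thesis .
  qed
  have main: "ennreal \<bar>log_potential (g b) - log_potential (g a)\<bar> \<le> I a b" if ab: "0 < a" "a \<le> b" "b \<le> t0" for a b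
  proof -
    have "a \<le> a \<longrightarrow> b \<le> b \<longrightarrow> ennreal \<bar>log_potential (g b) - log_potential (g a)\<bar> \<le> I a b"
    proof (rule Bolzano[OF ab(2), where P="\<lambda>s t. a \<le> s \<longrightarrow> t \<le> b \<longrightarrow> ennreal \<bar>log_potential (g t) - log_potential (g s)\<bar> \<le> I s t"])
      fix s t u
      assume 1: "a \<le> s \<longrightarrow> t \<le> b \<longrightarrow> ennreal \<bar>log_potential (g t) - log_potential (g s)\<bar> \<le> I s t"
        and 2: "a \<le> t \<longrightarrow> u \<le> b \<longrightarrow> ennreal \<bar>log_potential (g u) - log_potential (g t)\<bar> \<le> I t u"
        and le: "s \<le> t" "t \<le> u"
      show "a \<le> s \<longrightarrow> u \<le> b \<longrightarrow> ennreal \<bar>log_potential (g u) - log_potential (g s)\<bar> \<le> I s u"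
      proof (intro impI)
        assume "a \<le> s" "u \<le> b"
        have "ennreal \<bar>log_potential (g u) - log_potential (g s)\<bar>
          \<le> ennreal \<bar>log_potential (g t) - log_potential (g s)\<bar> + ennreal \<bar>log_potential (g u) - log_potential (g t)\<bar>"
          by (simp add: ennreal_leI flip: ennreal_plus)
        also have "\<dots> \<le> I s t + I t u"
          using 1 2 le \<open>a \<le> s\<close> \<open>u \<le> b\<close> by (intro add_mono) auto
        also have "\<dots> \<le> I s u" using I_add[OF le] .
        finally show "ennreal \<bar>log_potential (g u) - log_potential (g s)\<bar> \<le> I s u" .
      qed
    next
      fix \<tau> assume \<tau>: "a \<le> \<tau>" "\<tau> \<le> b"
      define r0 where "r0 = g \<tau>"
      have r0: "0 < r0" "r0 < 1" using g01[of \<tau>] \<tau> ab by (auto simp: r0_def)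
      define \<rho> where "\<rho> = log_weight r0"
      have \<rho>: "0 < \<rho>" using log_weight_pos[OF r0] by (simp add: \<rho>_def)
      have "(log_weight \<longlongrightarrow> \<rho>) (at r0)"
        using isCont_log_weight[OF r0] by (simp add: isCont_def \<rho>_def)
      then have "\<forall>\<^sub>F r in at r0. dist (log_weight r) \<rho> < \<rho> / 3"
        using \<rho> by (intro tendstoD) auto
      then obtain e1 where e1: "0 < e1" "\<And>r. r \<noteq> r0 \<Longrightarrow> dist r r0 < e1 \<Longrightarrow> dist (log_weight r) \<rho> < \<rho> / 3"
        unfolding eventually_at by blast
      \<comment> \<open>Within \<open>e\<close> of \<open>r0\<close> the distance stays in (0, 1)
        and the weight between 2/3 and 4/3 of \<rho>.\<close>
      define e where "e = min e1 (min r0 (1 - r0))"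
      have e: "0 < e" "e \<le> e1" "e \<le> r0" "e \<le> 1 - r0" using e1 r0 by (auto simp: e_def)
      have near: "0 < r" "r < 1" "2/3 * \<rho> \<le> log_weight r" "log_weight r \<le> 4/3 * \<rho>" if "\<bar>r - r0\<bar> < e" for r
      proof -
        show "0 < r" "r < 1" using that e by auto
        have "dist (log_weight r) \<rho> < \<rho> / 3"
          using e1(2)[of r] that e \<rho> by (cases "r = r0") (auto simp: \<rho>_def dist_real_def)
        then show "2/3 * \<rho> \<le> log_weight r" "log_weight r \<le> 4/3 * \<rho>" by (auto simp: dist_real_def abs_if split: if_splits)
      qed
      have "continuous_on {0<..t0} g" unfolding g_def by (intro continuous_intros cont)
      then have "\<exists>d>0. \<forall>t\<in>{0<..t0}. dist t \<tau> < d \<longrightarrow> dist (g t) (g \<tau>) < e"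
        using \<tau> ab e by (auto simp: continuous_on_iff)
      then obtain d where d: "0 < d" "\<And>t. 0 < t \<Longrightarrow> t \<le> t0 \<Longrightarrow> \<bar>t - \<tau>\<bar> < d \<Longrightarrow> \<bar>g t - r0\<bar> < e"
        by (auto simp: dist_real_def r0_def)
      show "\<exists>d>0. \<forall>s t. s \<le> \<tau> \<and> \<tau> \<le> t \<and> t - s < d \<longrightarrow>
          (a \<le> s \<longrightarrow> t \<le> b \<longrightarrow> ennreal \<bar>log_potential (g t) - log_potential (g s)\<bar> \<le> I s t)"
      proof (intro exI[of _ d] conjI allI impI d(1))
        fix s t assume st: "s \<le> \<tau> \<and> \<tau> \<le> t \<and> t - s < d" "a \<le> s" "t \<le> b"
        have gn: "\<bar>g x - r0\<bar> < e" if "s \<le> x" "x \<le> t" for x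
          using d(2)[of x] that st ab by auto
        have "norm (log_potential (g t) - log_potential (g s)) \<le> 4/3 * \<rho> * norm (g t - g s)"
        proof (rule field_differentiable_bound[of "{r. \<bar>r - r0\<bar> < e}" log_potential log_weight])
          have "{r. \<bar>r - r0\<bar> < e} = {r0 - e<..<r0 + e}" by auto
          then show "convex {r. \<bar>r - r0\<bar> < e}" by simp
          show "(log_potential has_field_derivative log_weight r) (at r within {r. \<bar>r - r0\<bar> < e})"
            if "r \<in> {r. \<bar>r - r0\<bar> < e}" for r
            using DERIV_log_potential[of r] near[of r] that by (auto intro: has_field_derivative_at_within)
          show "norm (log_weight r) \<le> 4/3 * \<rho>" if "r \<in> {r. \<bar>r - r0\<bar> < e}" for r
            using near[of r] log_weight_pos[of r] that by auto
        qed (use gn[of t] gn[of s] st in auto)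
        moreover have "norm (g t - g s) \<le> norm (\<gamma> t - \<gamma> s)"
          unfolding g_def real_norm_def using norm_triangle_ineq3[of "\<gamma> t - y0" "\<gamma> s - y0"] by simp
        ultimately have "\<bar>log_potential (g t) - log_potential (g s)\<bar> \<le> 4/3 * \<rho> * norm (\<gamma> t - \<gamma> s)"
          using \<rho> by (smt (verit) mult_left_mono real_norm_def divide_nonneg_nonneg mult_nonneg_nonneg)
        then have "ennreal \<bar>log_potential (g t) - log_potential (g s)\<bar> \<le> ennreal (4/3 * \<rho>) * ennreal (norm (\<gamma> t - \<gamma> s))"
          using \<rho> by (simp add: ennreal_leI flip: ennreal_mult)
        also have "\<dots> \<le> ennreal (4/3 * \<rho>) * (\<integral>\<^sup>+x\<in>{s<..<t}. ennreal (v x) \<partial>lborel)"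
          using st ab by (intro mult_left_mono inc) auto
        also have "\<dots> = (\<integral>\<^sup>+x. ennreal (4/3 * \<rho>) * (ennreal (v x) * indicator {s<..<t} x) \<partial>lborel)"
          by (rule nn_integral_cmult[symmetric]) measurable
        also have "\<dots> \<le> I s t"
          unfolding I_def
        proof (rule nn_integral_mono)
          fix x
          have "4/3 * \<rho> * v x \<le> 2 * (log_weight (g x) * v x)" if "s < x" "x < t"
            using mult_right_mono[OF near(3)[OF gn[of x]] v0[of x]] that
            by (simp add: algebra_simps)
          then show "ennreal (4/3 * \<rho>) * (ennreal (v x) * indicator {s<..<t} x)
              \<le> ennreal (2 * (log_weight (g x) * v x)) * indicator {s<..<t} x"
            using \<rho> v0[of x] by (auto simp: indicator_def ennreal_leI simp flip: ennreal_mult)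
        qed
        finally show "ennreal \<bar>log_potential (g t) - log_potential (g s)\<bar> \<le> I s t" .
      qed
    qed
    then show ?thesis by simp
  qed
  have big: "ennreal M \<le> I 0 t0" if M: "0 \<le> M" for M
  proof -
    have "(g \<longlongrightarrow> norm (y0 - y0)) (at_right 0)" unfolding g_def by (intro tendsto_intros lim)
    then have "(g \<longlongrightarrow> 0) (at_right 0)" by simp
    \<comment> \<open>The threshold of \<open>log_potential_at_0\<close>, with \<open>M\<close>
      raised by the potential at the outer end so that the difference exceeds
      \<open>M\<close>.\<close>
    then have "\<forall>\<^sub>F t in at_right 0. g t < exp (1 - exp (M + \<bar>log_potential (g t0)\<bar>))"
      by (rule order_tendstoD(2)) simp
    moreover have "\<forall>\<^sub>F t in at_right 0. t \<in> {0<..<t0}" using t0 by (rule eventually_at_right_real)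
    ultimately have "\<forall>\<^sub>F t in at_right 0. g t < exp (1 - exp (M + \<bar>log_potential (g t0)\<bar>)) \<and> t \<in> {0<..<t0}"
      by (rule eventually_conj)
    from eventually_happens'[OF trivial_limit_at_right_real this]
    obtain t where t: "g t < exp (1 - exp (M + \<bar>log_potential (g t0)\<bar>))" "0 < t" "t < t0" by auto
    have "log_potential (g t) < - (M + \<bar>log_potential (g t0)\<bar>)"
      by (rule log_potential_at_0) (use t g01 in auto)
    then have "M \<le> \<bar>log_potential (g t0) - log_potential (g t)\<bar>" by linarith
    then have "ennreal M \<le> ennreal \<bar>log_potential (g t0) - log_potential (g t)\<bar>" by (rule ennreal_leI)
    also have "\<dots> \<le> I t t0" using t by (intro main) auto
    also have "\<dots> \<le> I 0 t0" unfolding I_def using t by (intro nn_integral_mono) (auto simp: indicator_def)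
    finally show ?thesis .
  qed
  have "I 0 t0 = \<infinity>"
  proof (rule ccontr)
    assume "I 0 t0 \<noteq> \<infinity>"
    then obtain M where "I 0 t0 = ennreal M" "0 \<le> M" by (cases "I 0 t0") auto
    then show False using big[of "M + 1"] by simp
  qed
  moreover have "I 0 t0 = 2 * (\<integral>\<^sup>+t\<in>{0<..<t0}. ennreal (log_weight (g t) * v t) \<partial>lborel)"
  proof -
    have "I 0 t0 = (\<integral>\<^sup>+t. 2 * (ennreal (log_weight (g t) * v t) * indicator {0<..<t0} t) \<partial>lborel)"
      unfolding I_def
    proof (intro nn_integral_cong)
      fix t
      show "ennreal (2 * (log_weight (g t) * v t)) * indicator {0<..<t0} t
        = 2 * (ennreal (log_weight (g t) * v t) * indicator {0<..<t0} t)"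
        using ennreal_mult'[of 2 "log_weight (g t) * v t"] by (simp add: mult.assoc)
    qed
    also have "\<dots> = 2 * (\<integral>\<^sup>+t. ennreal (log_weight (g t) * v t) * indicator {0<..<t0} t \<partial>lborel)"
      by (rule nn_integral_cmult) measurable
    finally show ?thesis .
  qed
  ultimately show ?thesis unfolding g_def by (auto simp: ennreal_mult_eq_top_iff)
qed

text \<open>If \<open>q < P\<close>, replacing \<open>q\<close> by \<open>P\<close> in the equation
  leaves \<open>P \<le> Z\<close>. This crude form of Young's inequality is enough where only
  finiteness is at stake.\<close>

lemma le_add_if_power_eq:
  fixes P Z q :: real
  assumes "0 \<le> P" "0 \<le> Z" "0 \<le> q" and eq: "P ^ Suc m = Z * q ^ m"
  shows "P \<le> q + Z"
proof (cases "P \<le> q")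
  case False
  then have "P > 0" "q \<le> P" using assms by auto
  then have "P * P ^ m \<le> Z * P ^ m" using eq assms by (auto intro!: mult_left_mono power_mono)
  then show ?thesis using \<open>P > 0\<close> assms by simp
qed (use assms in auto)

lemma borel_measurable_sphere_area:
  "h \<in> borel_measurable borel \<Longrightarrow> h \<in> borel_measurable (sphere_area :: (real ^ 'n) measure)"
  by (subst measurable_cong_sets[OF _ refl, of _ "restrict_space borel (sphere 0 1)"])
    (simp_all add: sphere_area_def measurable_restrict_space1)

text \<open>By the polar formula for the indicator of a null set, almost every ray meets it in a set
  of measure 0 for t^(n-1) dt, and this density is positive for t > 0.\<close>

lemma AE_sphere_area_of_AE:
  fixes P :: "real ^ 'n \<Rightarrow> bool"
  assumes "AE x in lborel. P x"
  shows "AE u in sphere_area. AE t in lborel. 0 < t \<longrightarrow> P (t *\<^sub>R u)"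
proof -
  from AE_E[OF assms] obtain N where N: "{x \<in> space lborel. \<not> P x} \<subseteq> N" "emeasure lborel N = 0" "N \<in> sets lborel" .
  have [measurable]: "N \<in> sets borel" using N by simp
  let ?X = "\<lambda>u :: real ^ 'n. \<integral>\<^sup>+t\<in>{0<..}. indicator N (t *\<^sub>R u) * ennreal (t ^ (CARD('n) - 1)) \<partial>lborel"
  have "?X \<in> borel_measurable borel" by measurable
  then have m: "?X \<in> borel_measurable sphere_area" by (rule borel_measurable_sphere_area)
  have "(\<integral>\<^sup>+u. ?X u \<partial>sphere_area) = 0"
    using N nn_integral_polar[of "indicator N :: real ^ 'n \<Rightarrow> ennreal"] by simp
  then have "AE u in sphere_area. ?X u = 0" by (subst (asm) nn_integral_0_iff_AE[OF m])
  then show ?thesis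
  proof eventually_elim
    case (elim u)
    then have "AE t in lborel. indicator N (t *\<^sub>R u) * ennreal (t ^ (CARD('n) - 1)) * indicator {0<..} t = 0"
      by (subst (asm) nn_integral_0_iff_AE) simp_all
    then show ?case
    proof eventually_elim
      case (elim t)
      then show ?case
        using N(1) zero_less_power[of t "CARD('n) - 1"] by (auto simp: indicator_def split: if_splits)
    qed
  qed
qed

section \<open>Maps of the punctured ball\<close>

lemma compact_norm_gt:
  assumes "compact Q" "Q \<subseteq> (punctured_ball :: (real ^ 'n) set)"
  obtains \<epsilon> where "0 < \<epsilon>" "\<epsilon> < 1" "\<And>x. x \<in> Q \<Longrightarrow> \<epsilon> < norm x"
proof (cases "Q = {}")
  case True
  then show thesis using that[of "1/2"] by simp
next
  case False
  then obtain x where x: "x \<in> Q" "\<And>y. y \<in> Q \<Longrightarrow> norm x \<le> norm y"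
    using continuous_attains_inf[OF assms(1), of norm] by (auto intro: continuous_intros)
  then have nx: "0 < norm x" "norm x < 1" using assms(2) by (auto simp: punctured_ball_def)
  show thesis
  \<comment> \<open>Half of the minimal norm, since \<epsilon> has to lie strictly below all
    norms.\<close>
  proof (rule that[of "norm x / 2"])
    show "norm x / 2 < norm y" if "y \<in> Q" for y using x(2)[OF that] nx by linarith
  qed (use nx in auto)
qed

text \<open>What the argument takes from quasiconformality. \<open>S\<close> is a Borel set of
  regular points of full measure, so that derivatives cut off outside \<open>S\<close> become Borel
  functions. The constant in \<open>dilatation\<close> depends on \<epsilon> and may blow up at the
  origin. \<open>acl\<close> speaks of a map \<open>F\<close> that agrees with \<open>f\<close> on
  the ball, because absolute continuity is given for an extension of \<open>f\<close> and not for
  the total function \<open>f\<close>.\<close>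

locale punctured_qc_map =
  fixes f :: "real ^ 'n \<Rightarrow> real ^ 'n" and S :: "(real ^ 'n) set"
  assumes card: "2 \<le> CARD('n)"
    and cont: "continuous_on punctured_ball f" and inj: "inj_on f punctured_ball"
    and S_borel [measurable]: "S \<in> sets borel" and S_sub: "S \<subseteq> punctured_ball"
    and regular: "\<And>x. x \<in> S \<Longrightarrow> regular_point f x"
    and AE_S: "AE x in lborel. x \<in> punctured_ball \<longrightarrow> x \<in> S"
    and dilatation: "\<And>\<epsilon>. 0 < \<epsilon> \<Longrightarrow> \<epsilon> < 1 \<Longrightarrow> \<exists>K\<ge>0. AE x in lborel. x \<in> S \<longrightarrow> \<epsilon> < norm x \<longrightarrow>
      onorm (Df f x) ^ CARD('n) \<le> K * jacobian_det f x"
    and acl: "\<And>p q. cbox p q \<subseteq> punctured_ball \<Longrightarrow>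
      \<exists>G F. ACL_on G F \<and> cbox p q \<subseteq> G \<and> (\<forall>x\<in>punctured_ball. F x = f x)"
begin

text \<open>The values of \<open>f\<close> off the ball are arbitrary; this version is Borel on the
  whole space.\<close>

definition zero_ext :: "real ^ 'n \<Rightarrow> real ^ 'n" where
  "zero_ext x = (if x \<in> punctured_ball then f x else 0)"

text \<open>Off \<open>S\<close> the Frechet derivative may be an arbitrary value, so here and in
  \<open>jac\<close> it is replaced by 0.\<close>

definition part :: "'n \<Rightarrow> real ^ 'n \<Rightarrow> real ^ 'n" where
  "part i x = (if x \<in> S then Df f x (axis i 1) else 0)"

definition jac :: "real ^ 'n \<Rightarrow> real" where
  "jac x = (if x \<in> S then jacobian_det f x else 0)"

lemma has_derivative_f: "x \<in> S \<Longrightarrow> (f has_derivative Df f x) (at x)"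
  using regular unfolding regular_point_def by (simp add: frechet_derivative_works)

lemma has_derivative_eq_on_ball:
  assumes "x \<in> S" "\<And>x. x \<in> punctured_ball \<Longrightarrow> F x = f x"
  shows "(F has_derivative Df f x) (at x)"
  by (rule has_derivative_transform_within_open[OF has_derivative_f[OF assms(1)] open_punctured_ball])
    (use assms S_sub in auto)

lemma linear_Df: "x \<in> S \<Longrightarrow> linear (Df f x)"
  using has_derivative_f has_derivative_linear by blast

lemma borel_measurable_zero_ext [measurable]: "zero_ext \<in> borel_measurable borel"
  unfolding zero_ext_def by (intro borel_measurable_continuous_on_if cont continuous_intros) simp

text \<open>A pointwise limit of difference quotients with step 1 / (m + 1). They are formed with
  \<open>zero_ext\<close>, because the shifted point may leave the ball.\<close>

lemma borel_measurable_part [measurable]: "part i \<in> borel_measurable borel"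
proof (rule borel_measurable_LIMSEQ_metric)
  let ?e = "axis i 1 :: real ^ 'n"
  define g where "g m x = (if x \<in> S then real (Suc m) *\<^sub>R (zero_ext (x + inverse (real (Suc m)) *\<^sub>R ?e) - zero_ext x) else 0)" for m x
  show "g m \<in> borel_measurable borel" for m unfolding g_def by measurable
  fix x
  show "(\<lambda>m. g m x) \<longlonglongrightarrow> part i x"
  proof (cases "x \<in> S")
    case True
    have d: "(zero_ext has_derivative Df f x) (at x)"
      by (rule has_derivative_eq_on_ball[OF True]) (simp add: zero_ext_def)
    define h where "h m = inverse (real (Suc m)) *\<^sub>R ?e" for m
    have nh: "norm (h m) = inverse (real (Suc m))" for m by (simp add: h_def)
    have "h \<longlonglongrightarrow> 0 *\<^sub>R ?e" unfolding h_def by (intro tendsto_intros LIMSEQ_inverse_real_of_nat)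
    then have h: "filterlim h (at 0) sequentially"
      by (auto simp: filterlim_at h_def axis_eq_0_iff)
    have "((\<lambda>h. norm (zero_ext (x + h) - zero_ext x - Df f x h) / norm h) \<longlongrightarrow> 0) (at 0)"
      using d by (simp add: has_derivative_at)
    from filterlim_compose[OF this h]
    have "(\<lambda>m. norm (zero_ext (x + h m) - zero_ext x - Df f x (h m)) / norm (h m)) \<longlonglongrightarrow> 0" .
    moreover have "norm (zero_ext (x + h m) - zero_ext x - Df f x (h m)) / norm (h m) = norm (g m x - part i x)" for m
    proof -
      have "Df f x (h m) = inverse (real (Suc m)) *\<^sub>R part i x"
        using True linear_Df[OF True] by (simp add: h_def linear_cmul part_def)
      then have "g m x - part i x = real (Suc m) *\<^sub>R (zero_ext (x + h m) - zero_ext x - Df f x (h m))"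
        using True by (simp add: g_def h_def scaleR_diff_right)
      then show ?thesis by (simp add: nh divide_inverse mult.commute del: of_nat_Suc)
    qed
    ultimately have "(\<lambda>m. g m x - part i x) \<longlonglongrightarrow> 0" by (simp add: tendsto_norm_zero_iff)
    then show ?thesis by (rule LIM_zero_cancel)
  qed (simp add: g_def part_def)
qed

lemma Df_eq: "x \<in> S \<Longrightarrow> Df f x v = (\<Sum>i\<in>UNIV. v $ i *\<^sub>R part i x)"
proof -
  assume x: "x \<in> S"
  have "v = (\<Sum>i\<in>UNIV. v $ i *\<^sub>R axis i 1)" by (simp add: vec_eq_iff axis_def if_distrib cong: if_cong)
  then have "Df f x v = Df f x (\<Sum>i\<in>UNIV. v $ i *\<^sub>R axis i 1)" by simp
  also have "\<dots> = (\<Sum>i\<in>UNIV. v $ i *\<^sub>R Df f x (axis i 1))"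
    using linear_Df[OF x] by (simp add: linear_sum linear_cmul)
  finally show ?thesis using x by (simp add: part_def)
qed

lemma jac_pos: "x \<in> S \<Longrightarrow> 0 < jac x"
  using regular by (simp add: jac_def regular_point_def)

lemma jac_nonneg: "0 \<le> jac x"
  using jac_pos by (cases "x \<in> S") (auto simp: jac_def less_imp_le)

lemma borel_measurable_jac [measurable]: "jac \<in> borel_measurable borel"
proof -
  have "jac = (\<lambda>x. if x \<in> S then (\<Sum>p | p permutes UNIV. of_int (sign p) * (\<Prod>i\<in>UNIV. part (p i) x $ i)) else 0)"
    by (auto simp: fun_eq_iff jac_def jacobian_det_def det_def matrix_def part_def)
  also have "\<dots> \<in> borel_measurable borel" by measurable
  finally show ?thesis .
qed

text \<open>The source of all integrability. With \<open>w\<close> the indicator of a compact image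
  it bounds the Jacobian over a box; with a power of the logarithmic weight it works up to the
  origin, independently of the dilatation.\<close>

lemma nn_integral_jac_le:
  assumes w: "integrable lborel w" "\<And>y. 0 \<le> w y"
  shows "(\<integral>\<^sup>+x\<in>S. ennreal (jac x * w (f x)) \<partial>lborel) \<le> (\<integral>\<^sup>+y. ennreal (w y) \<partial>lborel)"
proof -
  have [measurable]: "w \<in> borel_measurable borel" using w by auto
  have abs: "\<bar>det (matrix (Df f x))\<bar> = jac x" if "x \<in> S" for x
    using jac_pos[OF that] that by (simp add: jac_def jacobian_det_def)
  have eq: "ennreal (jac x * w (f x)) * indicator S x = ennreal (\<bar>det (matrix (Df f x))\<bar> * w (f x)) * indicator S x" for x
    by (simp add: indicator_def abs)
  have "(\<lambda>x. indicator S x * ennreal (\<bar>det (matrix (Df f x))\<bar> * w (f x))) = (\<lambda>x. indicator S x * ennreal (jac x * w (zero_ext x)))"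
    using S_sub by (auto simp: fun_eq_iff indicator_def abs zero_ext_def)
  also have "\<dots> \<in> borel_measurable borel" by measurable
  finally have m: "(\<lambda>x. indicator S x * ennreal (\<bar>det (matrix (Df f x))\<bar> * w (f x))) \<in> borel_measurable borel" .
  show ?thesis
    unfolding eq
    by (rule nn_integral_change_of_variables_le[OF S_borel has_derivative_f inj_on_subset[OF inj S_sub] w m])
qed

text \<open>On the box the n-th power of the derivative is at most K times the Jacobian, whose
  integral is at most the finite measure of the compact image. A nonnegative number is at most 1
  plus its n-th power, which passes to the first power.\<close>

lemma integrable_part:
  assumes Q: "cbox p q \<subseteq> punctured_ball"
  shows "integrable lborel (\<lambda>x. indicator (cbox p q) x *\<^sub>R part i x)"
proof -
  have Qm[measurable]: "cbox p q \<in> sets borel" by simp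
  obtain \<epsilon> where \<epsilon>: "0 < \<epsilon>" "\<epsilon> < 1" "\<And>x. x \<in> cbox p q \<Longrightarrow> \<epsilon> < norm x"
    using compact_norm_gt[OF compact_cbox Q] by blast
  obtain K where K: "0 \<le> K" "AE x in lborel. x \<in> S \<longrightarrow> \<epsilon> < norm x \<longrightarrow> onorm (Df f x) ^ CARD('n) \<le> K * jacobian_det f x"
    using dilatation[OF \<epsilon>(1,2)] by blast
  have fQ: "compact (f ` cbox p q)"
    using cont Q by (intro compact_continuous_image) (auto intro: continuous_on_subset)
  define w where "w y = (indicator (f ` cbox p q) y :: real)" for y
  have w: "integrable lborel w" "\<And>y. 0 \<le> w y"
    unfolding w_def using fQ emeasure_compact_finite[OF fQ] by (auto intro!: integrable_real_indicator simp: compact_imp_closed)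
  have "(\<integral>\<^sup>+x. ennreal (norm (indicator (cbox p q) x *\<^sub>R part i x)) \<partial>lborel)
    \<le> (\<integral>\<^sup>+x. indicator (cbox p q) x + ennreal K * (ennreal (jac x * w (zero_ext x)) * indicator S x) \<partial>lborel)"
    using K(2)
  proof (intro nn_integral_mono_AE, eventually_elim)
    case (elim x)
    show ?case
    proof (cases "x \<in> cbox p q \<and> x \<in> S")
      case True
      let ?a = "norm (part i x)"
      have "?a \<le> onorm (Df f x) * norm (axis i 1 :: real ^ 'n)"
        using True onorm[OF has_derivative_bounded_linear[OF has_derivative_f], of x "axis i 1"]
        by (simp add: part_def)
      then have "?a \<le> onorm (Df f x)" by simp
      then have "?a ^ CARD('n) \<le> onorm (Df f x) ^ CARD('n)" by (intro power_mono) auto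
      also have "\<dots> \<le> K * jac x" using elim True \<epsilon>(3) by (auto simp: jac_def)
      finally have 1: "?a ^ CARD('n) \<le> K * jac x" .
      have "?a \<le> 1 + ?a ^ CARD('n)"
      proof (cases "?a \<le> 1")
        case False
        then have "?a ^ 1 \<le> ?a ^ CARD('n)" using card by (intro power_increasing) auto
        then show ?thesis by simp
      qed (simp add: add_increasing2)
      with 1 have "?a \<le> 1 + K * jac x" by simp
      moreover have "w (zero_ext x) = 1" using True Q by (auto simp: w_def zero_ext_def)
      ultimately show ?thesis
        using True K(1) jac_nonneg[of x]
        by (simp add: ennreal_leI ennreal_mult[symmetric] ennreal_1[symmetric] ennreal_plus[symmetric] del: ennreal_1 ennreal_plus)
    qed (auto simp: indicator_def part_def)
  qed
  also have "\<dots> = emeasure lborel (cbox p q) + ennreal K * (\<integral>\<^sup>+x. ennreal (jac x * w (zero_ext x)) * indicator S x \<partial>lborel)"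
    using w by (subst nn_integral_add) (auto simp: nn_integral_cmult borel_measurable_integrable)
  also have "(\<integral>\<^sup>+x. ennreal (jac x * w (zero_ext x)) * indicator S x \<partial>lborel) = (\<integral>\<^sup>+x\<in>S. ennreal (jac x * w (f x)) \<partial>lborel)"
    using S_sub by (intro nn_integral_cong) (auto simp: indicator_def zero_ext_def)
  also have "emeasure lborel (cbox p q) + ennreal K * \<dots> < \<infinity>"
  proof -
    have "(\<integral>\<^sup>+x\<in>S. ennreal (jac x * w (f x)) \<partial>lborel) \<le> (\<integral>\<^sup>+y. ennreal (w y) \<partial>lborel)"
      by (rule nn_integral_jac_le[OF w])
    also have "\<dots> < \<infinity>" using w by (simp add: integrable_iff_bounded)
    finally show ?thesis using emeasure_lborel_cbox_finite[of p q] by (simp add: ennreal_mult_less_top)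
  qed
  finally show ?thesis by (simp add: integrable_iff_bounded)
qed

text \<open>The segments stay in the box, hence in the ball, where \<open>zero_ext\<close>,
  \<open>f\<close> and the map from \<open>acl\<close> agree; the integral formula passes from one
  to the other.\<close>

lemma line_integral_on_zero_ext:
  assumes Q: "cbox p q \<subseteq> punctured_ball"
  shows "line_integral_on p q i zero_ext (\<lambda>x. indicator (cbox p q) x *\<^sub>R part i x)"
proof -
  obtain G F where F: "ACL_on G F" "cbox p q \<subseteq> G" "\<And>x. x \<in> punctured_ball \<Longrightarrow> F x = f x"
    using acl[OF Q] by blast
  have "AE x in lborel. x \<in> cbox p q \<longrightarrow>
    ((\<lambda>s. F (coord_upd x i s)) has_vector_derivative indicator (cbox p q) x *\<^sub>R part i x) (at (x $ i))"
    using AE_S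
  proof eventually_elim
    case (elim x)
    show ?case
    proof
      assume x: "x \<in> cbox p q"
      then have S: "x \<in> S" using elim Q by blast
      have upd: "coord_upd x i s = x + (s - x $ i) *\<^sub>R axis i 1" for s
        using coord_upd_eq_translate[of x i "s - x $ i"] by simp
      have "((\<lambda>s. x + (s - x $ i) *\<^sub>R axis i 1) has_derivative (\<lambda>s. s *\<^sub>R axis i 1)) (at (x $ i))"
        by (auto intro!: derivative_eq_intros)
      then have "((\<lambda>s. F (x + (s - x $ i) *\<^sub>R axis i 1)) has_derivative (\<lambda>s. Df f x (s *\<^sub>R axis i 1))) (at (x $ i))"
        by (rule has_derivative_compose) (use has_derivative_eq_on_ball[OF S F(3)] in simp)
      then show "((\<lambda>s. F (coord_upd x i s)) has_vector_derivative indicator (cbox p q) x *\<^sub>R part i x) (at (x $ i))"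
        unfolding has_vector_derivative_def upd using linear_Df[OF S] x S by (simp add: linear_cmul part_def)
    qed
  qed
  from ACL_on_line_integral[OF F(1,2) this integrable_part[OF Q]]
  show ?thesis
    unfolding line_integral_on_def
  proof eventually_elim
    case (elim x)
    show ?case
    proof (intro impI allI)
      fix s1 s2 assume x: "\<forall>j. j \<noteq> i \<longrightarrow> p $ j \<le> x $ j \<and> x $ j \<le> q $ j" and s: "p $ i \<le> s1" "s1 \<le> s2" "s2 \<le> q $ i"
      have "zero_ext (coord_upd x i s) = F (coord_upd x i s)" if "p $ i \<le> s" "s \<le> q $ i" for s
      proof -
        have "coord_upd x i s \<in> cbox p q" using x that by (auto simp: mem_box_cart)
        then show ?thesis using Q F(3) by (auto simp: zero_ext_def)
      qed
      then show "set_integrable lborel {s1..s2} (\<lambda>s. indicator (cbox p q) (coord_upd x i s) *\<^sub>R part i (coord_upd x i s)) \<and>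
        zero_ext (coord_upd x i s2) - zero_ext (coord_upd x i s1)
          = (LINT s:{s1..s2}|lborel. indicator (cbox p q) (coord_upd x i s) *\<^sub>R part i (coord_upd x i s))"
        using elim x s by auto
    qed
  qed
qed

text \<open>By the chain rule this is the speed of the curve f(s x) at parameters with s x in
  \<open>S\<close>, and 0 at the others.\<close>

definition speed :: "real ^ 'n \<Rightarrow> real \<Rightarrow> real" where
  "speed x s = norm (\<Sum>i\<in>UNIV. x $ i *\<^sub>R part i (s *\<^sub>R x))"

lemma borel_measurable_speed [measurable]: "speed x \<in> borel_measurable borel"
  unfolding speed_def by measurable

lemma AE_ray_increment_le_cbox:
  assumes Q: "cbox p q \<subseteq> punctured_ball" and ab: "0 < a" "a \<le> b"
  shows "AE x in lborel. a *\<^sub>R x \<in> cbox p q \<and> b *\<^sub>R x \<in> cbox p q \<longrightarrow>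
    ennreal (norm (zero_ext (b *\<^sub>R x) - zero_ext (a *\<^sub>R x))) \<le> (\<integral>\<^sup>+s\<in>{a..b}. ennreal (speed x s) \<partial>lborel)"
  using AE_ray_increment_le[OF borel_measurable_zero_ext integrable_part[OF Q] line_integral_on_zero_ext[OF Q] ab]
proof eventually_elim
  case (elim x)
  have "(\<integral>\<^sup>+s\<in>{a..b}. ennreal (norm (\<Sum>i\<in>UNIV. x $ i *\<^sub>R indicator (cbox p q) (s *\<^sub>R x) *\<^sub>R part i (s *\<^sub>R x))) \<partial>lborel)
      \<le> (\<integral>\<^sup>+s\<in>{a..b}. ennreal (speed x s) \<partial>lborel)"
    unfolding speed_def by (intro nn_integral_mono) (auto simp: indicator_def)
  then show ?case using elim by (auto intro: order_trans)
qed

end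

section \<open>Increments along almost every ray of the ball\<close>

lemma countable_cbox_cover:
  fixes U :: "'a::euclidean_space set"
  assumes U: "open U"
  obtains D where "countable D" "\<And>p q. (p, q) \<in> D \<Longrightarrow> cbox p q \<subseteq> U" "\<And>x. x \<in> U \<Longrightarrow> \<exists>(p, q)\<in>D. x \<in> box p q"
proof -
  let ?A = "{(p, q). cbox p q \<subseteq> U}"
  let ?B = "\<lambda>(p, q). box p q"
  \<comment> \<open>Lindelof's theorem for the open boxes whose closures lie in \<open>U\<close>;
    countability will allow the exceptional sets of all boxes to be united.\<close>
  obtain F where F: "F \<subseteq> ?B ` ?A" "countable F" "\<Union>F = \<Union>(?B ` ?A)"
    by (rule Lindelof[of "?B ` ?A"]) (auto intro: open_box)
  then obtain D where D: "countable D" "D \<subseteq> ?A" "F = ?B ` D"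
    using countable_subset_image[of F ?B ?A] by blast
  show thesis
  proof (rule that[OF D(1)])
    show "cbox p q \<subseteq> U" if "(p, q) \<in> D" for p q using that D(2) by blast
    fix x assume "x \<in> U"
    then obtain p q where "x \<in> box p q" "cbox p q \<subseteq> U"
      using open_contains_cbox[OF U] by metis
    then have "x \<in> \<Union>(?B ` ?A)" by blast
    then have "x \<in> \<Union>(?B ` D)" using F(3) D(3) by simp
    then show "\<exists>(p, q)\<in>D. x \<in> box p q" by blast
  qed
qed

context punctured_qc_map
begin

lemma continuous_on_ray:
  "continuous_on {t. t *\<^sub>R x \<in> punctured_ball} (\<lambda>t. zero_ext (t *\<^sub>R x))"
proof -
  have "continuous_on punctured_ball zero_ext"
    using cont by (rule continuous_on_eq) (simp add: zero_ext_def)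
  then show ?thesis by (rule continuous_on_compose2) (auto intro!: continuous_intros)
qed

text \<open>The null set in the estimate for a box depends on the box and on the endpoints.
  Countably many boxes and rational endpoints leave one null set; off it, continuity along the ray
  gives real endpoints within a box, and a Bolzano argument chains the boxes that the ray
  meets.\<close>

lemma AE_ray_increment_le_ball:
  "AE x in lborel. \<forall>a b. 0 < a \<longrightarrow> a \<le> b \<longrightarrow> x \<noteq> 0 \<longrightarrow> b * norm x < 1 \<longrightarrow>
    ennreal (norm (zero_ext (b *\<^sub>R x) - zero_ext (a *\<^sub>R x))) \<le> (\<integral>\<^sup>+s\<in>{a<..<b}. ennreal (speed x s) \<partial>lborel)"
proof -
  obtain D where D: "countable D" "\<And>p q. (p, q) \<in> D \<Longrightarrow> cbox p q \<subseteq> punctured_ball"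
    "\<And>x :: real ^ 'n. x \<in> punctured_ball \<Longrightarrow> \<exists>(p, q)\<in>D. x \<in> box p q"
    by (rule countable_cbox_cover[OF open_punctured_ball]) blast
  have "AE x in lborel. \<forall>z\<in>D. \<forall>a\<in>\<rat>. \<forall>b\<in>\<rat>. 0 < a \<longrightarrow> a \<le> b \<longrightarrow>
      (a *\<^sub>R x \<in> cbox (fst z) (snd z) \<and> b *\<^sub>R x \<in> cbox (fst z) (snd z) \<longrightarrow>
      ennreal (norm (zero_ext (b *\<^sub>R x) - zero_ext (a *\<^sub>R x))) \<le> (\<integral>\<^sup>+s\<in>{a..b}. ennreal (speed x s) \<partial>lborel))"
    unfolding AE_ball_countable[OF D(1)] AE_ball_countable[OF countable_rat]
  proof (intro ballI)
    fix z and a b :: real assume z: "z \<in> D"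
    show "AE x in lborel. 0 < a \<longrightarrow> a \<le> b \<longrightarrow>
      (a *\<^sub>R x \<in> cbox (fst z) (snd z) \<and> b *\<^sub>R x \<in> cbox (fst z) (snd z) \<longrightarrow>
      ennreal (norm (zero_ext (b *\<^sub>R x) - zero_ext (a *\<^sub>R x))) \<le> (\<integral>\<^sup>+s\<in>{a..b}. ennreal (speed x s) \<partial>lborel))"
    proof (cases "0 < a \<and> a \<le> b")
      case True
      then show ?thesis
        using AE_ray_increment_le_cbox[of "fst z" "snd z" a b] D(2)[of "fst z" "snd z"] z by simp
    qed auto
  qed
  then show ?thesis
  proof eventually_elim
    case (elim x)
    show ?case
    proof (intro allI impI)
      fix a b :: real assume ab: "0 < a" "a \<le> b" "x \<noteq> 0" "b * norm x < 1"
      have ball: "t *\<^sub>R x \<in> punctured_ball" if "0 < t" "t \<le> b" for t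
      proof -
        have "t * norm x \<le> b * norm x" using that by (intro mult_right_mono) auto
        then have "t * norm x < 1" using ab(4) by (rule le_less_trans)
        then show ?thesis using that ab by (simp add: punctured_ball_def)
      qed
      define I where "I s t = (\<integral>\<^sup>+\<tau>\<in>{s<..<t}. ennreal (speed x \<tau>) \<partial>lborel)" for s t
      have I_add: "I r s + I s t \<le> I r t" if "r \<le> s" "s \<le> t" for r s t
      proof -
        have "I r s + I s t = (\<integral>\<^sup>+\<tau>. ennreal (speed x \<tau>) * indicator {r<..<s} \<tau> + ennreal (speed x \<tau>) * indicator {s<..<t} \<tau> \<partial>lborel)"
          unfolding I_def by (rule nn_integral_add[symmetric]) measurable
        also have "\<dots> \<le> I r t"
          unfolding I_def using that by (intro nn_integral_mono) (auto simp: indicator_def)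
        finally show ?thesis .
      qed
      have "a \<le> a \<longrightarrow> b \<le> b \<longrightarrow> ennreal (norm (zero_ext (b *\<^sub>R x) - zero_ext (a *\<^sub>R x))) \<le> I a b"
      proof (rule Bolzano[OF ab(2), where P="\<lambda>s t. a \<le> s \<longrightarrow> t \<le> b \<longrightarrow> ennreal (norm (zero_ext (t *\<^sub>R x) - zero_ext (s *\<^sub>R x))) \<le> I s t"])
        fix r s t
        assume 1: "a \<le> r \<longrightarrow> s \<le> b \<longrightarrow> ennreal (norm (zero_ext (s *\<^sub>R x) - zero_ext (r *\<^sub>R x))) \<le> I r s"
          and 2: "a \<le> s \<longrightarrow> t \<le> b \<longrightarrow> ennreal (norm (zero_ext (t *\<^sub>R x) - zero_ext (s *\<^sub>R x))) \<le> I s t"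
          and le: "r \<le> s" "s \<le> t"
        show "a \<le> r \<longrightarrow> t \<le> b \<longrightarrow> ennreal (norm (zero_ext (t *\<^sub>R x) - zero_ext (r *\<^sub>R x))) \<le> I r t"
        proof (intro impI)
          assume "a \<le> r" "t \<le> b"
          have "norm (zero_ext (t *\<^sub>R x) - zero_ext (r *\<^sub>R x)) \<le> norm (zero_ext (s *\<^sub>R x) - zero_ext (r *\<^sub>R x)) + norm (zero_ext (t *\<^sub>R x) - zero_ext (s *\<^sub>R x))"
            using norm_triangle_ineq[of "zero_ext (s *\<^sub>R x) - zero_ext (r *\<^sub>R x)" "zero_ext (t *\<^sub>R x) - zero_ext (s *\<^sub>R x)"] by simp
          then have "ennreal (norm (zero_ext (t *\<^sub>R x) - zero_ext (r *\<^sub>R x)))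
              \<le> ennreal (norm (zero_ext (s *\<^sub>R x) - zero_ext (r *\<^sub>R x))) + ennreal (norm (zero_ext (t *\<^sub>R x) - zero_ext (s *\<^sub>R x)))"
            by (simp add: ennreal_leI flip: ennreal_plus)
          also have "\<dots> \<le> I r s + I s t" using 1 2 le \<open>a \<le> r\<close> \<open>t \<le> b\<close> by (intro add_mono) auto
          also have "\<dots> \<le> I r t" using I_add[OF le] .
          finally show "ennreal (norm (zero_ext (t *\<^sub>R x) - zero_ext (r *\<^sub>R x))) \<le> I r t" .
        qed
      next
        fix \<tau> assume \<tau>: "a \<le> \<tau>" "\<tau> \<le> b"
        obtain p q where pq: "(p, q) \<in> D" "\<tau> *\<^sub>R x \<in> box p q" using D(3)[OF ball[of \<tau>]] \<tau> ab by auto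
        have "open ((\<lambda>t. t *\<^sub>R x) -` box p q)"
          by (intro continuous_open_vimage open_box continuous_intros)
        then obtain d where d: "0 < d" "\<And>t. dist t \<tau> < d \<Longrightarrow> t *\<^sub>R x \<in> box p q"
          using pq(2) unfolding open_dist by (metis vimageE vimageI2)
        show "\<exists>d>0. \<forall>s t. s \<le> \<tau> \<and> \<tau> \<le> t \<and> t - s < d \<longrightarrow>
          (a \<le> s \<longrightarrow> t \<le> b \<longrightarrow> ennreal (norm (zero_ext (t *\<^sub>R x) - zero_ext (s *\<^sub>R x))) \<le> I s t)"
        proof (intro exI[of _ d] conjI allI impI d(1))
          fix s t assume st: "s \<le> \<tau> \<and> \<tau> \<le> t \<and> t - s < d" "a \<le> s" "t \<le> b"
          have box: "v *\<^sub>R x \<in> cbox p q" if "s \<le> v" "v \<le> t" for v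
            using d(2)[of v] that st box_subset_cbox[of p q] by (auto simp: dist_real_def)
          show "ennreal (norm (zero_ext (t *\<^sub>R x) - zero_ext (s *\<^sub>R x))) \<le> I s t"
          proof (cases "s = t")
            case False
            then have lt: "s < t" using st by simp
            show ?thesis
            proof (rule ennreal_le_epsilon)
              fix e :: real assume e: "0 < e"
              have "continuous_on {0<..b} (\<lambda>t. zero_ext (t *\<^sub>R x))"
                by (rule continuous_on_subset[OF continuous_on_ray]) (use ball in auto)
              then have c: "\<exists>\<delta>>0. \<forall>v\<in>{0<..b}. dist v u < \<delta> \<longrightarrow> dist (zero_ext (v *\<^sub>R x)) (zero_ext (u *\<^sub>R x)) < e / 2"
                if "u \<in> {0<..b}" for u
                using that half_gt_zero[OF e] unfolding continuous_on_iff by blast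
              obtain \<delta>s where \<delta>s: "0 < \<delta>s" "\<And>v. v \<in> {0<..b} \<Longrightarrow> dist v s < \<delta>s \<Longrightarrow> dist (zero_ext (v *\<^sub>R x)) (zero_ext (s *\<^sub>R x)) < e / 2"
                using c[of s] st ab lt by auto
              obtain \<delta>t where \<delta>t: "0 < \<delta>t" "\<And>v. v \<in> {0<..b} \<Longrightarrow> dist v t < \<delta>t \<Longrightarrow> dist (zero_ext (v *\<^sub>R x)) (zero_ext (t *\<^sub>R x)) < e / 2"
                using c[of t] st ab lt by auto
              \<comment> \<open>Rational endpoints with s < s' < t' < t, so close to s and t that
                each end error is below e / 2. Being interior, they make the integral over the
                closed interval at most \<open>I s t\<close>.\<close>
              have "s < min (s + \<delta>s) t" using \<delta>s lt by simp
              from Rats_dense_in_real[OF this] obtain s' where s': "s' \<in> \<rat>" "s < s'" "s' < s + \<delta>s" "s' < t" by auto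
              have "max (t - \<delta>t) s' < t" using \<delta>t s' by simp
              from Rats_dense_in_real[OF this] obtain t' where t': "t' \<in> \<rat>" "t - \<delta>t < t'" "s' < t'" "t' < t" by auto
              have "norm (zero_ext (s' *\<^sub>R x) - zero_ext (s *\<^sub>R x)) < e / 2"
                using \<delta>s(2)[of s'] s' st ab by (auto simp: dist_norm)
              moreover have "norm (zero_ext (t *\<^sub>R x) - zero_ext (t' *\<^sub>R x)) < e / 2"
                using \<delta>t(2)[of t'] s' t' st ab by (auto simp: dist_norm norm_minus_commute)
              moreover have "norm (zero_ext (t *\<^sub>R x) - zero_ext (s *\<^sub>R x)) \<le> norm (zero_ext (t' *\<^sub>R x) - zero_ext (s' *\<^sub>R x))
                  + (norm (zero_ext (s' *\<^sub>R x) - zero_ext (s *\<^sub>R x)) + norm (zero_ext (t *\<^sub>R x) - zero_ext (t' *\<^sub>R x)))"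
                using norm_triangle_ineq[of "zero_ext (t' *\<^sub>R x) - zero_ext (s' *\<^sub>R x)" "(zero_ext (s' *\<^sub>R x) - zero_ext (s *\<^sub>R x)) + (zero_ext (t *\<^sub>R x) - zero_ext (t' *\<^sub>R x))"]
                  norm_triangle_ineq[of "zero_ext (s' *\<^sub>R x) - zero_ext (s *\<^sub>R x)" "zero_ext (t *\<^sub>R x) - zero_ext (t' *\<^sub>R x)"] by simp
              ultimately have "norm (zero_ext (t *\<^sub>R x) - zero_ext (s *\<^sub>R x)) \<le> norm (zero_ext (t' *\<^sub>R x) - zero_ext (s' *\<^sub>R x)) + e" by linarith
              then have "ennreal (norm (zero_ext (t *\<^sub>R x) - zero_ext (s *\<^sub>R x))) \<le> ennreal (norm (zero_ext (t' *\<^sub>R x) - zero_ext (s' *\<^sub>R x))) + ennreal e"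
                using e by (simp add: ennreal_leI flip: ennreal_plus)
              also have "ennreal (norm (zero_ext (t' *\<^sub>R x) - zero_ext (s' *\<^sub>R x))) \<le> (\<integral>\<^sup>+\<tau>\<in>{s'..t'}. ennreal (speed x \<tau>) \<partial>lborel)"
              proof -
                have "0 < s'" "s' \<le> t'" using s' t' st ab by auto
                moreover have "s' *\<^sub>R x \<in> cbox p q" "t' *\<^sub>R x \<in> cbox p q" using box s' t' by auto
                ultimately show ?thesis using elim pq(1) s'(1) t'(1) by fastforce
              qed
              also have "\<dots> \<le> I s t"
                unfolding I_def using s' t' by (intro nn_integral_mono) (auto simp: indicator_def)
              finally show "ennreal (norm (zero_ext (t *\<^sub>R x) - zero_ext (s *\<^sub>R x))) \<le> I s t + ennreal e"
                by (simp add: add_right_mono)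
            qed
          qed simp
        qed
      qed
      then show "ennreal (norm (zero_ext (b *\<^sub>R x) - zero_ext (a *\<^sub>R x))) \<le> (\<integral>\<^sup>+s\<in>{a<..<b}. ennreal (speed x s) \<partial>lborel)"
        by (simp add: I_def)
    qed
  qed
qed

text \<open>The estimate is invariant under rescaling of the base point, so a single good point c u
  settles the whole ray, and almost every ray contains one.\<close>

lemma AE_sphere_ray_increment_le:
  "AE u in sphere_area. \<forall>a b. 0 < a \<longrightarrow> a \<le> b \<longrightarrow> b < 1 \<longrightarrow>
    ennreal (norm (zero_ext (b *\<^sub>R u) - zero_ext (a *\<^sub>R u))) \<le> (\<integral>\<^sup>+s\<in>{a<..<b}. ennreal (speed u s) \<partial>lborel)"
  using AE_sphere_area_of_AE[OF AE_ray_increment_le_ball] AE_sphere_area_norm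
proof eventually_elim
  case (elim u)
  define P where "P c \<longleftrightarrow> (\<forall>a b. 0 < a \<longrightarrow> a \<le> b \<longrightarrow> c *\<^sub>R u \<noteq> 0 \<longrightarrow> b * norm (c *\<^sub>R u) < 1 \<longrightarrow>
    ennreal (norm (zero_ext (b *\<^sub>R c *\<^sub>R u) - zero_ext (a *\<^sub>R c *\<^sub>R u))) \<le> (\<integral>\<^sup>+s\<in>{a<..<b}. ennreal (speed (c *\<^sub>R u) s) \<partial>lborel))" for c
  \<comment> \<open>Almost every positive \<open>c\<close> is good, and the positive half-line is
    not a null set.\<close>
  have "\<exists>c>0. P c"
  proof (rule ccontr)
    assume "\<not> (\<exists>c>0. P c)"
    then have "AE c in lborel. \<not> 0 < (c :: real)" using elim(1) unfolding P_def[symmetric] by auto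
    then have "emeasure lborel {c :: real. 0 < c} = 0" by (subst (asm) AE_iff_measurable[OF _ refl]) simp_all
    moreover have "emeasure lborel {0<..1 :: real} \<le> emeasure lborel {c :: real. 0 < c}" by (rule emeasure_mono) auto
    ultimately show False by simp
  qed
  then obtain c where c: "0 < c" "P c" by blast
  show ?case
  proof (intro allI impI)
    fix a b :: real assume ab: "0 < a" "a \<le> b" "b < 1"
    have "ennreal (norm (zero_ext ((b / c) *\<^sub>R c *\<^sub>R u) - zero_ext ((a / c) *\<^sub>R c *\<^sub>R u)))
        \<le> (\<integral>\<^sup>+s\<in>{a / c<..<b / c}. ennreal (speed (c *\<^sub>R u) s) \<partial>lborel)"
    proof (rule c(2)[unfolded P_def, rule_format])
      show "c *\<^sub>R u \<noteq> 0" using c elim(2) by auto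
    qed (use c ab elim(2) in \<open>auto simp: divide_right_mono\<close>)
    moreover have "(\<integral>\<^sup>+s\<in>{a<..<b}. ennreal (speed u s) \<partial>lborel) = (\<integral>\<^sup>+s\<in>{a / c<..<b / c}. ennreal (speed (c *\<^sub>R u) s) \<partial>lborel)"
    proof -
      have "(\<integral>\<^sup>+s\<in>{a<..<b}. ennreal (speed u s) \<partial>lborel)
          = ennreal c * (\<integral>\<^sup>+s. ennreal (speed u (c * s)) * indicator {a<..<b} (c * s) \<partial>lborel)"
        using c by (subst nn_integral_real_affine[where c=c and t=0]) simp_all
      also have "\<dots> = (\<integral>\<^sup>+s. ennreal c * (ennreal (speed u (c * s)) * indicator {a<..<b} (c * s)) \<partial>lborel)"
        by (rule nn_integral_cmult[symmetric]) measurable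
      also have "\<dots> = (\<integral>\<^sup>+s\<in>{a / c<..<b / c}. ennreal (speed (c *\<^sub>R u) s) \<partial>lborel)"
      proof (rule nn_integral_cong)
        fix s
        have "speed (c *\<^sub>R u) s = norm (c *\<^sub>R (\<Sum>i\<in>UNIV. u $ i *\<^sub>R part i ((c * s) *\<^sub>R u)))"
          by (simp add: speed_def scaleR_sum_right mult.commute)
        then have "speed (c *\<^sub>R u) s = c * speed u (c * s)" using c by (simp add: speed_def)
        then have "ennreal (speed (c *\<^sub>R u) s) = ennreal c * ennreal (speed u (c * s))"
          using c by (simp add: ennreal_mult speed_def)
        moreover have "indicator {a<..<b} (c * s) = (indicator {a / c<..<b / c} s :: ennreal)"
          using c by (auto simp: indicator_def field_simps)
        ultimately show "ennreal c * (ennreal (speed u (c * s)) * indicator {a<..<b} (c * s))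
            = ennreal (speed (c *\<^sub>R u) s) * indicator {a / c<..<b / c} s" by (simp add: mult.assoc)
      qed
      finally show ?thesis .
    qed
    ultimately show "ennreal (norm (zero_ext (b *\<^sub>R u) - zero_ext (a *\<^sub>R u))) \<le> (\<integral>\<^sup>+s\<in>{a<..<b}. ennreal (speed u s) \<partial>lborel)"
      using c by simp
  qed
qed

section \<open>The normal dilatation along rays\<close>

definition ndil :: "real ^ 'n \<Rightarrow> real" where
  "ndil x = (if x \<in> S then normal_dilatation f x else 0)"

lemma borel_measurable_ndil [measurable]: "ndil \<in> borel_measurable borel"
proof -
  have "ndil = (\<lambda>x. if x \<in> S then (norm (\<Sum>i\<in>UNIV. sgn x $ i *\<^sub>R part i x) ^ CARD('n) / jac x) powr (1 / (real CARD('n) - 1)) else 0)"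
    using regular by (auto simp: fun_eq_iff ndil_def normal_dilatation_def Df_eq jac_def)
  also have "\<dots> \<in> borel_measurable borel" by measurable
  finally show ?thesis .
qed

lemma ndil_nonneg: "0 \<le> ndil x"
  by (simp add: ndil_def normal_dilatation_def)

text \<open>Undoing the root in the definition leaves a relation between natural powers, the form in
  which the dilatation enters the estimate along rays.\<close>

lemma ndil_power:
  assumes x: "x \<in> S"
  shows "ndil x ^ (CARD('n) - 1) = norm (Df f x (sgn x)) ^ CARD('n) / jac x"
proof -
  define m where "m = CARD('n) - 1"
  have m: "0 < m" "real CARD('n) - 1 = real m" using card by (auto simp: m_def of_nat_diff)
  define A where "A = norm (Df f x (sgn x)) ^ CARD('n) / jac x"
  have A: "0 \<le> A" using jac_nonneg by (simp add: A_def)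
  have "ndil x = A powr (1 / real m)"
    using x regular[OF x] by (simp add: ndil_def normal_dilatation_def A_def jac_def m(2))
  moreover have "(A powr (1 / real m)) ^ m = A"
  proof (cases "A = 0")
    case False
    then have "0 < A" using A by simp
    then show ?thesis using m by (simp add: powr_realpow[symmetric] powr_powr)
  qed (use m in simp)
  ultimately show ?thesis by (simp add: A_def m_def)
qed

lemma AE_normal_dilatation_integral_infinite:
  assumes y0: "y0 \<notin> f ` punctured_ball" and lim: "(f \<longlongrightarrow> y0) (at 0)"
  shows "AE u in sphere_area. (\<integral>\<^sup>+t\<in>{0<..<1}. ennreal (normal_dilatation f (t *\<^sub>R u) / t) \<partial>lborel) = \<infinity>"
proof -
  define n where "n = CARD('n)"
  have n: "2 \<le> n" using card by (simp add: n_def)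
  have "\<forall>\<^sub>F x in at 0. dist (f x) y0 < 1" using lim by (rule tendstoD) simp
  \<comment> \<open>Within distance \<open>d\<close> of the origin the image stays in the unit ball
    around \<open>y0\<close>, where the weight is meaningful.\<close>
  then obtain d where d: "0 < d" "\<And>x. x \<noteq> 0 \<Longrightarrow> dist x 0 < d \<Longrightarrow> dist (f x) y0 < 1"
    unfolding eventually_at by blast
  define t0 where "t0 = min (d / 2) (1 / 2)"
  have t0: "0 < t0" "t0 < 1" "t0 < d" using d by (auto simp: t0_def)
  define w where "w y = (if 0 < norm (y - y0) \<and> norm (y - y0) < 1 then log_weight (norm (y - y0)) ^ n else 0)" for y
  have w: "integrable lborel w" unfolding w_def n_def by (rule integrable_log_weight_power[OF card])
  have w0: "0 \<le> w y" for y using log_weight_pos[of "norm (y - y0)"] by (auto simp: w_def intro!: zero_le_power less_imp_le)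
  have [measurable]: "w \<in> borel_measurable borel" using w by auto
  \<comment> \<open>The factor t^(n-1) is kept out of \<open>Z\<close>; it is supplied by the polar
    formula.\<close>
  define Z where "Z x = jac x * w (zero_ext x)" for x
  have Z0: "0 \<le> Z x" for x using jac_nonneg w0 by (simp add: Z_def)
  have [measurable]: "Z \<in> borel_measurable borel" unfolding Z_def by measurable
  let ?X = "\<lambda>u :: real ^ 'n. \<integral>\<^sup>+t\<in>{0<..}. ennreal (Z (t *\<^sub>R u)) * ennreal (t ^ (CARD('n) - 1)) \<partial>lborel"
  have "(\<integral>\<^sup>+u. ?X u \<partial>sphere_area) = (\<integral>\<^sup>+x. ennreal (Z x) \<partial>lborel)"
    by (rule nn_integral_polar) simp
  also have "\<dots> = (\<integral>\<^sup>+x\<in>S. ennreal (jac x * w (f x)) \<partial>lborel)"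
    using S_sub by (intro nn_integral_cong) (auto simp: indicator_def Z_def jac_def zero_ext_def)
  also have "\<dots> \<le> (\<integral>\<^sup>+y. ennreal (w y) \<partial>lborel)" by (rule nn_integral_jac_le[OF w w0])
  also have "\<dots> < \<infinity>" using w w0 by (simp add: integrable_iff_bounded)
  finally have "(\<integral>\<^sup>+u. ?X u \<partial>sphere_area) \<noteq> \<infinity>" by simp
  moreover have "?X \<in> borel_measurable sphere_area" by (rule borel_measurable_sphere_area) measurable
  ultimately have "AE u in sphere_area. ?X u \<noteq> \<infinity>" by (intro nn_integral_PInf_AE)
  then show ?thesis
    using AE_sphere_area_norm AE_sphere_ray_increment_le AE_sphere_area_of_AE[OF AE_S]
  proof eventually_elim
    case (elim u)
    let ?g = "\<lambda>t. norm (zero_ext (t *\<^sub>R u) - y0)"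
    have u: "u \<noteq> 0" using elim(2) by auto
    have ball: "t *\<^sub>R u \<in> punctured_ball" if "0 < t" "t < 1" for t
      using that elim(2) u by (simp add: punctured_ball_def)
    have unit: "0 < ?g t \<and> ?g t < 1" if t: "0 < t" "t \<le> t0" for t
    proof -
      have b: "t *\<^sub>R u \<in> punctured_ball" using ball t t0 by simp
      then have "f (t *\<^sub>R u) \<noteq> y0" using y0 by blast
      moreover have "dist (f (t *\<^sub>R u)) y0 < 1"
        using elim(2) t t0 by (intro d(2)) auto
      ultimately show ?thesis using b by (simp add: zero_ext_def dist_norm)
    qed
    have inf: "(\<integral>\<^sup>+t\<in>{0<..<t0}. ennreal (log_weight (?g t) * speed u t) \<partial>lborel) = \<infinity>"
    proof (rule path_log_weight_infinite)
      show "0 \<le> speed u t" for t by (simp add: speed_def)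
      show "continuous_on {0<..t0} (\<lambda>t. zero_ext (t *\<^sub>R u))"
        by (rule continuous_on_subset[OF continuous_on_ray]) (use ball t0 in auto)
      show "((\<lambda>t. zero_ext (t *\<^sub>R u)) \<longlongrightarrow> y0) (at_right 0)"
      proof -
        have "((\<lambda>t. t *\<^sub>R u) \<longlongrightarrow> 0 *\<^sub>R u) (at_right 0)" by (intro tendsto_intros)
        moreover have "\<forall>\<^sub>F t in at_right 0. t *\<^sub>R u \<noteq> 0"
          using eventually_at_right_less[of 0] by eventually_elim (use elim(2) in auto)
        ultimately have "filterlim (\<lambda>t. t *\<^sub>R u) (at 0) (at_right 0)" by (simp add: filterlim_at)
        from filterlim_compose[OF lim this] have "((\<lambda>t. f (t *\<^sub>R u)) \<longlongrightarrow> y0) (at_right 0)" .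
        moreover have "\<forall>\<^sub>F t in at_right 0. f (t *\<^sub>R u) = zero_ext (t *\<^sub>R u)"
          using eventually_at_right_real[OF zero_less_one] by eventually_elim (use ball in \<open>auto simp: zero_ext_def\<close>)
        ultimately show ?thesis by (rule Lim_transform_eventually)
      qed
      show "ennreal (norm (zero_ext (b *\<^sub>R u) - zero_ext (a *\<^sub>R u))) \<le> (\<integral>\<^sup>+s\<in>{a<..<b}. ennreal (speed u s) \<partial>lborel)"
        if "0 < a" "a \<le> b" "b \<le> t0" for a b
        using elim(3) that t0 by auto
    qed (use unit t0 in auto)
    \<comment> \<open>The pointwise splitting is made at almost every \<open>t\<close> below
      \<open>t0\<close>, where \<open>t\<close> times \<open>u\<close> lies in \<open>S\<close>; for
      other \<open>t\<close> the left side vanishes.\<close>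
    have "(\<integral>\<^sup>+t\<in>{0<..<t0}. ennreal (log_weight (?g t) * speed u t) \<partial>lborel)
        \<le> (\<integral>\<^sup>+t. ennreal (ndil (t *\<^sub>R u) / t) * indicator {0<..<1} t
            + ennreal (Z (t *\<^sub>R u)) * ennreal (t ^ (CARD('n) - 1)) * indicator {0<..} t \<partial>lborel)"
      using elim(4)
    proof (intro nn_integral_mono_AE, eventually_elim)
      case (elim t)
      show ?case
      proof (cases "0 < t \<and> t < t0")
        case True
        then have t: "0 < t" "t < 1" "t \<le> t0" using t0 by auto
        have x: "t *\<^sub>R u \<in> S" using elim t ball by simp
        have sg: "sgn (t *\<^sub>R u) = u" using t \<open>norm u = 1\<close> by (simp add: sgn_div_norm)
        have sp: "speed u t = norm (Df f (t *\<^sub>R u) u)" by (simp add: speed_def Df_eq[OF x])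
        define \<rho> where "\<rho> = log_weight (?g t)"
        have \<rho>: "0 < \<rho>" using unit[OF t(1,3)] log_weight_pos by (simp add: \<rho>_def)
        have J: "0 < jac (t *\<^sub>R u)" using jac_pos[OF x] .
        obtain m where m: "n = Suc m" using n by (cases n) auto
        have Zt: "Z (t *\<^sub>R u) = jac (t *\<^sub>R u) * \<rho> ^ n"
          using unit[OF t(1,3)] by (simp add: Z_def w_def \<rho>_def)
        have nd: "ndil (t *\<^sub>R u) ^ m * jac (t *\<^sub>R u) = speed u t ^ n"
          using ndil_power[OF x] J sg sp m by (simp add: n_def[symmetric])
        \<comment> \<open>Here P is the weighted speed and q is Q / t. By the definition of Q, P^n
          is Z t^m times q^m with m = n - 1; the powers of t cancel.\<close>
        have "\<rho> * speed u t \<le> ndil (t *\<^sub>R u) / t + Z (t *\<^sub>R u) * t ^ m"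
        proof (rule le_add_if_power_eq)
          have "Z (t *\<^sub>R u) * t ^ m * (ndil (t *\<^sub>R u) / t) ^ m = \<rho> ^ n * (ndil (t *\<^sub>R u) ^ m * jac (t *\<^sub>R u))"
            using t by (simp add: Zt power_divide)
          then show "(\<rho> * speed u t) ^ Suc m = Z (t *\<^sub>R u) * t ^ m * (ndil (t *\<^sub>R u) / t) ^ m"
            by (simp add: nd m power_mult_distrib)
        qed (use \<rho> t Z0 ndil_nonneg in \<open>auto simp: speed_def\<close>)
        then have "ennreal (\<rho> * speed u t) \<le> ennreal (ndil (t *\<^sub>R u) / t) + ennreal (Z (t *\<^sub>R u)) * ennreal (t ^ m)"
          using t Z0 ndil_nonneg by (simp add: ennreal_leI flip: ennreal_plus ennreal_mult)
        then show ?thesis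
          using True t m by (simp add: \<rho>_def n_def[symmetric])
      qed auto
    qed
    also have "\<dots> = (\<integral>\<^sup>+t\<in>{0<..<1}. ennreal (ndil (t *\<^sub>R u) / t) \<partial>lborel) + ?X u"
      by (rule nn_integral_add) measurable
    \<comment> \<open>\<open>?X u\<close> is finite on this ray, so the infinite sum must come from
      the dilatation term.\<close>
    finally have "(\<integral>\<^sup>+t\<in>{0<..<1}. ennreal (ndil (t *\<^sub>R u) / t) \<partial>lborel) = \<infinity>"
      using elim(1) unfolding inf by (auto simp: top_unique ennreal_add_eq_top)
    moreover have "(\<integral>\<^sup>+t\<in>{0<..<1}. ennreal (normal_dilatation f (t *\<^sub>R u) / t) \<partial>lborel)
        = (\<integral>\<^sup>+t\<in>{0<..<1}. ennreal (ndil (t *\<^sub>R u) / t) \<partial>lborel)"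
      using elim(4)
      by (intro nn_integral_cong_AE, eventually_elim) (use ball in \<open>auto simp: indicator_def ndil_def\<close>)
    ultimately show ?case by simp
  qed
qed

lemma I_Q_eq_0:
  assumes "y0 \<notin> f ` punctured_ball" "(f \<longlongrightarrow> y0) (at 0)"
  shows "I_Q f = 0"
proof -
  \<comment> \<open>A positive exponent keeps the power of \<infinity> infinite; with exponent 0 it
    would be 1.\<close>
  have "CARD('n) - 1 \<noteq> 0" using card by simp
  note top_power = top_power_ennreal[of "CARD('n) - 1", unfolded if_not_P[OF this]]
  have "AE u in sphere_area. inverse ((\<integral>\<^sup>+t\<in>{0<..<1}. ennreal (normal_dilatation f (t *\<^sub>R u) / t) \<partial>lborel) ^ (CARD('n) - 1)) = 0"
    using AE_normal_dilatation_integral_infinite[OF assms]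
    by eventually_elim (simp only: infinity_ennreal_def top_power ennreal_inverse_top)
  then have "I_Q f = (\<integral>\<^sup>+u. 0 \<partial>(sphere_area :: (real ^ 'n) measure))"
    unfolding I_Q_def by (rule nn_integral_cong_AE)
  then show ?thesis by simp
qed

end

section \<open>Locally quasiconformal embeddings\<close>

lemma punctured_ball_subset: "punctured_ball \<subseteq> closed_punctured_ball"
  by (auto simp: punctured_ball_def closed_punctured_ball_def)

lemma ex_punctured_qc_map:
  fixes f :: "real ^ 'n \<Rightarrow> real ^ 'n"
  assumes card: "CARD('n) \<ge> 2" and emb: "locally_quasiconformal_embedding f"
    and ori: "orientation_preserving_on punctured_ball f"
  obtains S where "punctured_qc_map f S"
proof -
  obtain g where hom: "homeomorphism closed_punctured_ball (f ` closed_punctured_ball) f g"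
    using emb unfolding locally_quasiconformal_embedding_def by blast
  have cont: "continuous_on punctured_ball f"
    using homeomorphism_cont1[OF hom] punctured_ball_subset continuous_on_subset by blast
  have inj: "inj_on f punctured_ball"
    using homeomorphism_apply1[OF hom] punctured_ball_subset by (metis inj_onI subsetD)
  obtain G F where G: "closed_punctured_ball \<subseteq> G" "\<And>x. x \<in> closed_punctured_ball \<Longrightarrow> F x = f x"
    and qc: "\<And>\<epsilon>. 0 < \<epsilon> \<Longrightarrow> \<epsilon> < 1 \<Longrightarrow> quasiconformal F {x \<in> G. \<epsilon> < norm x} (F ` {x \<in> G. \<epsilon> < norm x})"
    using emb unfolding locally_quasiconformal_embedding_def by blast
  have Ff: "F x = f x" if "x \<in> punctured_ball" for x
    using that G(2) punctured_ball_subset by blast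
  have "AE x in lborel. x \<in> punctured_ball \<longrightarrow> regular_point f x"
    using ori unfolding orientation_preserving_on_def
    by (subst (asm) AE_restrict_space_iff) (auto simp: AE_completion_iff)
  \<comment> \<open>Removing a Borel null set that covers the non-regular points, instead of these
    points themselves, makes \<open>S\<close> a Borel set.\<close>
  from AE_E[OF this] obtain N where N: "{x \<in> space lborel. \<not> (x \<in> punctured_ball \<longrightarrow> regular_point f x)} \<subseteq> N"
    "emeasure lborel N = 0" "N \<in> sets lborel" .
  define S where "S = punctured_ball - N"
  have S: "S \<in> sets borel" "S \<subseteq> punctured_ball" using N by (auto simp: S_def)
  have reg: "regular_point f x" if "x \<in> S" for x using that N(1) by (auto simp: S_def)
  have "AE x in lborel. x \<notin> N" using N by (intro AE_not_in) (auto simp: null_sets_def)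
  then have AE_S: "AE x in lborel. x \<in> punctured_ball \<longrightarrow> x \<in> S" by eventually_elim (simp add: S_def)
  have dil: "\<exists>K\<ge>0. AE x in lborel. x \<in> S \<longrightarrow> \<epsilon> < norm x \<longrightarrow> onorm (Df f x) ^ CARD('n) \<le> K * jacobian_det f x"
    if \<epsilon>: "0 < \<epsilon>" "\<epsilon> < 1" for \<epsilon>
  proof -
    let ?G = "{x \<in> G. \<epsilon> < norm x}"
    obtain K where K: "is_domain ?G" "AE x in lebesgue_on ?G. F differentiable (at x) \<and> outer_dilatation F x \<le> ennreal K"
      using qc[OF \<epsilon>] unfolding quasiconformal_def K_quasiconformal_def by blast
    have "?G \<in> sets borel" using K(1) by (auto simp: is_domain_def)
    then have "AE x in lborel. x \<in> ?G \<longrightarrow> F differentiable (at x) \<and> outer_dilatation F x \<le> ennreal K"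
      using K(2) by (subst (asm) AE_restrict_space_iff) (auto simp: AE_completion_iff)
    \<comment> \<open>\<open>ennreal K\<close> is 0 for negative \<open>K\<close>; the maximum with
      0 turns the bound back into one between real numbers.\<close>
    then have "AE x in lborel. x \<in> S \<longrightarrow> \<epsilon> < norm x \<longrightarrow> onorm (Df f x) ^ CARD('n) \<le> max K 0 * jacobian_det f x"
    proof eventually_elim
      case (elim x)
      show ?case
      proof (intro impI)
        assume x: "x \<in> S" "\<epsilon> < norm x"
        then have F: "F differentiable (at x)" "outer_dilatation F x \<le> ennreal K"
          using elim S(2) G(1) punctured_ball_subset by auto
        \<comment> \<open>Agreement of the two maps on an open set around \<open>x\<close> carries
          the dilatation bound from the extension to \<open>f\<close>.\<close>
        have "Df F x = Df f x"
          by (rule frechet_derivative_transform_within_open[OF F(1) open_punctured_ball]) (use x S(2) Ff in auto)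
        then have le: "ennreal (onorm (Df f x) ^ CARD('n)) / ennreal (jacobian_det f x) \<le> ennreal K"
          using F(2) by (simp add: outer_dilatation_def jacobian_det_def)
        have J: "0 < jacobian_det f x" and d: "(f has_derivative Df f x) (at x)"
          using reg[OF x(1)] by (auto simp: regular_point_def frechet_derivative_works)
        have o: "0 \<le> onorm (Df f x)" using onorm_pos_le[OF has_derivative_bounded_linear[OF d]] .
        have "ennreal (onorm (Df f x) ^ CARD('n) / jacobian_det f x) \<le> ennreal K"
          using le J o by (simp add: divide_ennreal)
        also have "\<dots> \<le> ennreal (max K 0)" by (rule ennreal_leI) simp
        finally have "ennreal (onorm (Df f x) ^ CARD('n) / jacobian_det f x) \<le> ennreal (max K 0)" .
        then have "onorm (Df f x) ^ CARD('n) / jacobian_det f x \<le> max K 0"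
          by (subst (asm) ennreal_le_iff) auto
        then show "onorm (Df f x) ^ CARD('n) \<le> max K 0 * jacobian_det f x"
          using J by (simp add: pos_divide_le_eq)
      qed
    qed
    then show ?thesis by (intro exI[of _ "max K 0"]) auto
  qed
  have acl: "\<exists>G F. ACL_on G F \<and> cbox p q \<subseteq> G \<and> (\<forall>x\<in>punctured_ball. F x = f x)"
    if Q: "cbox p q \<subseteq> punctured_ball" for p q
  proof -
    \<comment> \<open>\<open>ACL_on\<close> is given away from the origin only; a compact box in the
      punctured ball keeps a positive distance from it.\<close>
    obtain \<epsilon> where \<epsilon>: "0 < \<epsilon>" "\<epsilon> < 1" "\<And>x. x \<in> cbox p q \<Longrightarrow> \<epsilon> < norm x"
      using compact_norm_gt[OF compact_cbox Q] by blast
    have "ACL_on {x \<in> G. \<epsilon> < norm x} F"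
      using qc[OF \<epsilon>(1,2)] unfolding quasiconformal_def K_quasiconformal_def by blast
    moreover have "cbox p q \<subseteq> {x \<in> G. \<epsilon> < norm x}" using \<epsilon>(3) Q G(1) punctured_ball_subset by blast
    ultimately show ?thesis using Ff by blast
  qed
  have "punctured_qc_map f S"
    by unfold_locales (use card cont inj S reg AE_S dil acl in auto)
  then show thesis by (rule that)
qed

theorem corollary3p4:
  fixes f :: "real ^ 'n \<Rightarrow> real ^ 'n"
  assumes "CARD('n) \<ge> 2"
    and "locally_quasiconformal_embedding f"
    and "orientation_preserving_on punctured_ball f"
    and "nested_sphere_images f"
    and "\<not> admits_cavitation f"
  shows "I_Q f = 0"
proof -
  obtain S where S: "punctured_qc_map f S" using ex_punctured_qc_map[OF assms(1-3)] by blast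
  interpret punctured_qc_map f S by (rule S)
  show ?thesis
    using limit_at_0_of_no_cavitation[OF card cont inj assms(4,5)] I_Q_eq_0 by blast
qed

end
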